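(* Let $\Omega\subset\mathbb R^3$ be a bounded smooth domain, $r>0$, $\Omega_r:=\{rx:x\in\Omega\}$, $q\in(2,8/3)$, $k\in\mathbb N$, and $b\in(0,b^* )$. For each $\varepsilon>0$ let $(u_{j,\varepsilon},\phi_{j,\varepsilon},\lambda_{j,\varepsilon})\in S_{r,b}\times(H_0^1(\Omega_r)\cap W_0^{1,4}(\Omega_r))\times\mathbb R$, $j=1,\dots,k$, be the $k$ distinct normalized solutions, obtained by the minimax construction described in the context, of $$\begin{cases}-\Delta u+\phi u+\lambda u=|u|^{q-2}u+|u|^4u, & x\in\Omega_r,\\ -\Delta\phi-\varepsilon^4\Delta_4\phi=u^2, & x\in\Omega_r,\\ u=\phi=0, & x\in\partial\Omega_r.\end{cases}$$ Then, as $\varepsilon\to0$, for each $j=1,\dots,k$ there exists $(u_{j,0},\phi_{j,0},\lambda_{j,0})\in S_{r,b}\times H_0^1(\Omega_r)\times\mathbb R$ such that $$\lim_{\varepsilon\to0}u_{j,\varepsilon}=u_{j,0}\ \text{ in }H_0^1(\Omega_r),\qquad \lim_{\varepsilon\to0}\phi_{j,\varepsilon}=\phi_{j,0}\ \text{ in }H_0^1(\Omega_r),$$ where $(u_{j,0},\phi_{j,0})$ is a solution of the Schrödinger–Poisson system $$\begin{cases}-\Delta u+\phi u=\lambda u+|u|^{q-2}u+|u|^4u, & x\in\Omega_r,\\ -\Delta\phi=u^2, & x\in\Omega_r,\\ u=\phi=0, & x\in\partial\Omega_r,\\ \int_{\Omega_r}u^2\,dx=b^2\end{cases}$$ with $\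lambda=\lambda_{j,0}$.
   Context: Notation: $\Delta_4\phi:=\operatorname{div}(|\nabla\phi|^2\nabla\phi)$; $\mathbb H:=H_0^1(\Omega_r)\cap W_0^{1,4}(\Omega_r)$; $S_{r,b}:=\{u\in H_0^1(\Omega_r):\int_{\Omega_r}u^2\,dx=b^2\}$. Solutions are understood in the weak sense. For $u\in H_0^1(\Omega_r)$, $\phi_\varepsilon(u)\in\mathbb H$ is the unique weak solution of $-\Delta\phi-\varepsilon^4\Delta_4\phi=u^2$ in $\Omega_r$, $\phi=0$ on $\partial\Omega_r$. Constants: $S>0$ is the best Sobolev constant, $S=\inf\{\int_{\mathbb R^3}|\nabla u|^2dx:\int_{\mathbb R^3}|u|^6dx=1\}$; $C_{3,q}>0$ is a constant with $\int_{\mathbb R^3}|u|^qdx\le C_{3,q}(\int_{\mathbb R^3}|u|^2dx)^{(6-q)/4}(\int_{\mathbb R^3}|\nabla u|^2dx)^{3(q-2)/4}$ for all $u\in H^1(\mathbb R^3)$. Let $\mathcal G(t):=\frac12t^2-\frac1qb^{3-q/2}C_{3,q}t^{3(q-2)/2}-\frac1{6S^3}t^6$. The number $b^*>0$ is such that for every $b\in(0,b^* )$ there are $0<R_1<R_2<\infty$ with $\mathcal G>0$ on $(R_1,R_2)$, $\mathcal G<0$ on $(0,R_1)\cup(R_2,\infty)$, $R_1^2<S^{3/2}$, and $\frac12 s^2-\frac1{6S^3}s^6\ge0$ for $s\in[0,R_1]$. Fix $T\in C^\infty(\mathbb R^+,[0,1])$ with $T(t)=1$ for $t\le R_1$ and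 $T(t)=0$ for $t\ge R_2$. Truncated functional: $$E^T_\varepsilon(u):=\tfrac12\int_{\Omega_r}|\nabla u|^2dx+\tfrac14\int_{\Omega_r}|\nabla\phi_\varepsilon(u)|^2dx+\tfrac{3\varepsilon^4}{8}\int_{\Omega_r}|\nabla\phi_\varepsilon(u)|^4dx-\tfrac1q\int_{\Omega_r}|u|^qdx-\tfrac{T(\|\nabla u\|_2)}6\int_{\Omega_r}|u|^6dx.$$ Minimax construction: a set $D\subset S_{r,b}$ is symmetric if $D=-D$; for closed symmetric $D$ the genus $\sigma(D)$ is $0$ if $D=\emptyset$, otherwise the least $m\in\mathbb N$ for which there is an odd continuous map $D\to\mathbb R^m\setminus\{0\}$, and $+\infty$ if there is none. Let $d_{j,\varepsilon}:=\inf\{\sup_{u\in D}E^T_\varepsilon(u): D\subset S_{r,b}\text{ closed, symmetric},\ \sigma(D)\ge j\}$. The solutions referred to are those for which $u_{j,\varepsilon}$ is a critical point of $E^T_\varepsilon|_{S_{r,b}}$ with $E^T_\varepsilon(u_{j,\varepsilon})=d_{j,\varepsilon}<0$, $\phi_{j,\varepsilon}=\phi_\varepsilon(u_{j,\varepsilon})$, and $\lambda_{j,\varepsilon}$ is the associated Lagrange multiplier (i.e. the real number for which the first equation holds), for $j=1,\dots,k$.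
   Formalization: The limits as ε→0 hold along a subsequence (common to all j) of any sequence ε_n→0, not for the full family: replacing u_{j,ε} by −u_{j,ε} for some ε gives another admissible family, so full convergence fails in general. *)

theory Defs
  imports "HOL-Analysis.Analysis"
begin

text \<open>
  Elements of Lebesgue and Sobolev spaces on an open set \<open>\<Omega>\<close> are represented by functions on the
  whole space, and two of them stand for the same element when they agree almost everywhere
  on \<open>\<Omega>\<close>; values outside \<open>\<Omega>\<close> are irrelevant. All notions below respect this identification.
\<close>

primrec Ck_on :: "nat \<Rightarrow> ('a::euclidean_space \<Rightarrow> real) \<Rightarrow> 'a set \<Rightarrow> bool" where
  "Ck_on 0 f U \<longleftrightarrow> continuous_on U f"
| "Ck_on (Suc n) f U \<longleftrightarrow> (\<forall>x\<in>U. f differentiable (at x)) \<and>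
     (\<forall>v\<in>Basis. Ck_on n (\<lambda>x. frechet_derivative f (at x) v) U)"

text \<open>Only meaningful for open \<open>U\<close>.\<close>

definition smooth_on :: "('a::euclidean_space \<Rightarrow> real) \<Rightarrow> 'a set \<Rightarrow> bool" where
  "smooth_on f U \<longleftrightarrow> (\<forall>n. Ck_on n f U)"

text \<open>The boundary is smooth when \<open>\<Omega>\<close> is locally the sublevel set of a smooth function without
  critical points.\<close>

definition smooth_bounded_domain :: "(real^3) set \<Rightarrow> bool" where
  "smooth_bounded_domain \<Omega> \<longleftrightarrow> open \<Omega> \<and> connected \<Omega> \<and> \<Omega> \<noteq> {} \<and> bounded \<Omega> \<and>
     (\<forall>x\<in>frontier \<Omega>. \<exists>U \<rho>. open U \<and> x \<in> U \<and> smooth_on \<rho> U \<and>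
        (\<forall>y\<in>U. frechet_derivative \<rho> (at y) \<noteq> (\<lambda>_. 0)) \<and>
        \<Omega> \<inter> U = {y\<in>U. \<rho> y < 0})"

definition test_functions :: "(real^3) set \<Rightarrow> (real^3 \<Rightarrow> real) set" where
  "test_functions \<Omega> = {\<psi>. smooth_on \<psi> UNIV \<and>
     compact (closure {x. \<psi> x \<noteq> 0}) \<and> closure {x. \<psi> x \<noteq> 0} \<subseteq> \<Omega>}"

definition Lp_fun :: "real \<Rightarrow> (real^3) set \<Rightarrow> (real^3 \<Rightarrow> 'b::euclidean_space) set" where
  "Lp_fun p \<Omega> = {f. f \<in> borel_measurable (lebesgue_on \<Omega>) \<and>
     integrable (lebesgue_on \<Omega>) (\<lambda>x. norm (f x) powr p)}"

definition has_weak_gradient ::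
    "(real^3) set \<Rightarrow> (real^3 \<Rightarrow> real) \<Rightarrow> (real^3 \<Rightarrow> real^3) \<Rightarrow> bool" where
  "has_weak_gradient \<Omega> u g \<longleftrightarrow>
     (\<forall>K. compact K \<and> K \<subseteq> \<Omega> \<longrightarrow> integrable (lebesgue_on K) u \<and> integrable (lebesgue_on K) g) \<and>
     (\<forall>\<psi>\<in>test_functions \<Omega>. \<forall>i.
        (LINT x|lebesgue_on \<Omega>. u x * frechet_derivative \<psi> (at x) (axis i 1)) =
        - (LINT x|lebesgue_on \<Omega>. g x $ i * \<psi> x))"

text \<open>A choice of representative of the weak gradient, which is unique almost everywhere on \<open>\<Omega>\<close>.\<close>

definition wgrad :: "(real^3) set \<Rightarrow> (real^3 \<Rightarrow> real) \<Rightarrow> real^3 \<Rightarrow> real^3" where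
  "wgrad \<Omega> u = (SOME g. has_weak_gradient \<Omega> u g)"

definition W1 :: "real \<Rightarrow> (real^3) set \<Rightarrow> (real^3 \<Rightarrow> real) set" where
  "W1 p \<Omega> = {u. u \<in> Lp_fun p \<Omega> \<and> (\<exists>g. has_weak_gradient \<Omega> u g \<and> g \<in> Lp_fun p \<Omega>)}"

definition W1_0 :: "real \<Rightarrow> (real^3) set \<Rightarrow> (real^3 \<Rightarrow> real) set" where
  "W1_0 p \<Omega> = {u \<in> W1 p \<Omega>. \<exists>\<psi>. (\<forall>n. \<psi> n \<in> test_functions \<Omega>) \<and>
     (\<lambda>n::nat. (LINT x|lebesgue_on \<Omega>. \<bar>u x - \<psi> n x\<bar> powr p) +
        (LINT x|lebesgue_on \<Omega>. norm (wgrad \<Omega> (\<lambda>y. u y - \<psi> n y) x) powr p)) \<longlonglongrightarrow> 0}"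

abbreviation H1 :: "(real^3) set \<Rightarrow> (real^3 \<Rightarrow> real) set" where
  "H1 \<equiv> W1 2"

abbreviation H1_0 :: "(real^3) set \<Rightarrow> (real^3 \<Rightarrow> real) set" where
  "H1_0 \<equiv> W1_0 2"

definition HH :: "(real^3) set \<Rightarrow> (real^3 \<Rightarrow> real) set" where
  "HH \<Omega> = H1_0 \<Omega> \<inter> W1_0 4 \<Omega>"

definition grad_norm :: "(real^3) set \<Rightarrow> (real^3 \<Rightarrow> real) \<Rightarrow> real" where
  "grad_norm \<Omega> u = sqrt (LINT x|lebesgue_on \<Omega>. (norm (wgrad \<Omega> u x))\<^sup>2)"

definition H1_norm :: "(real^3) set \<Rightarrow> (real^3 \<Rightarrow> real) \<Rightarrow> real" where
  "H1_norm \<Omega> u = sqrt ((LINT x|lebesgue_on \<Omega>. (u x)\<^sup>2) + (grad_norm \<Omega> u)\<^sup>2)"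

text \<open>The norm topology of \<open>H1_0 \<Omega>\<close>. On representatives it comes from a pseudometric: closed sets
  are saturated with respect to equality almost everywhere, and continuous maps into Hausdorff
  spaces factor through it.\<close>

definition H1_0_top :: "(real^3) set \<Rightarrow> (real^3 \<Rightarrow> real) topology" where
  "H1_0_top \<Omega> = topology (\<lambda>U. U \<subseteq> H1_0 \<Omega> \<and>
     (\<forall>u\<in>U. \<exists>d>0. \<forall>v\<in>H1_0 \<Omega>. H1_norm \<Omega> (\<lambda>x. v x - u x) < d \<longrightarrow> v \<in> U))"

lemma openin_H1_0_top:
  "openin (H1_0_top \<Omega>) U \<longleftrightarrow> U \<subseteq> H1_0 \<Omega> \<and>
     (\<forall>u\<in>U. \<exists>d>0. \<forall>v\<in>H1_0 \<Omega>. H1_norm \<Omega> (\<lambda>x. v x - u x) < d \<longrightarrow> v \<in> U)"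
proof -
  let ?P = "\<lambda>U. U \<subseteq> H1_0 \<Omega> \<and>
     (\<forall>u\<in>U. \<exists>d>0. \<forall>v\<in>H1_0 \<Omega>. H1_norm \<Omega> (\<lambda>x. v x - u x) < d \<longrightarrow> v \<in> U)"
  have "istopology ?P"
    unfolding istopology_def
  proof (intro conjI allI impI)
    fix S T assume S: "?P S" and T: "?P T"
    show "S \<inter> T \<subseteq> H1_0 \<Omega>" using S by blast
    show "\<forall>u\<in>S \<inter> T. \<exists>d>0. \<forall>v\<in>H1_0 \<Omega>. H1_norm \<Omega> (\<lambda>x. v x - u x) < d \<longrightarrow> v \<in> S \<inter> T"
    proof
      fix u assume u: "u \<in> S \<inter> T"
      then obtain d where d: "d > 0"
        "\<forall>v\<in>H1_0 \<Omega>. H1_norm \<Omega> (\<lambda>x. v x - u x) < d \<longrightarrow> v \<in> S"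
        using S by blast
      from u obtain e where e: "e > 0"
        "\<forall>v\<in>H1_0 \<Omega>. H1_norm \<Omega> (\<lambda>x. v x - u x) < e \<longrightarrow> v \<in> T"
        using T by blast
      show "\<exists>d>0. \<forall>v\<in>H1_0 \<Omega>. H1_norm \<Omega> (\<lambda>x. v x - u x) < d \<longrightarrow> v \<in> S \<inter> T"
        using d e by (intro exI[of _ "min d e"]) auto
    qed
  next
    fix \<K> assume K: "\<forall>K\<in>\<K>. ?P K"
    show "\<Union>\<K> \<subseteq> H1_0 \<Omega>" using K by blast
    show "\<forall>u\<in>\<Union>\<K>. \<exists>d>0. \<forall>v\<in>H1_0 \<Omega>. H1_norm \<Omega> (\<lambda>x. v x - u x) < d \<longrightarrow> v \<in> \<Union>\<K>"
      using K by (meson Union_iff)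
  qed
  then show ?thesis
    unfolding H1_0_top_def by (simp add: topology_inverse')
qed

lemma topspace_H1_0_top [simp]: "topspace (H1_0_top \<Omega>) = H1_0 \<Omega>"
proof
  show "topspace (H1_0_top \<Omega>) \<subseteq> H1_0 \<Omega>"
    using openin_H1_0_top openin_topspace by blast
  have "openin (H1_0_top \<Omega>) (H1_0 \<Omega>)"
    unfolding openin_H1_0_top by (auto intro: exI[of _ "1::real"])
  then show "H1_0 \<Omega> \<subseteq> topspace (H1_0_top \<Omega>)"
    by (rule openin_subset)
qed

definition mass_sphere :: "(real^3) set \<Rightarrow> real \<Rightarrow> (real^3 \<Rightarrow> real) set" where
  "mass_sphere \<Omega> b = {u \<in> H1_0 \<Omega>. (LINT x|lebesgue_on \<Omega>. (u x)\<^sup>2) = b\<^sup>2}"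

text \<open>By the Sobolev embeddings in dimension three and Hoelder's inequality, all integrands below are
  integrable for functions in the indicated spaces, so the convention that the integral of a
  non-integrable function is zero plays no role.\<close>

text \<open>\<open>-\<Delta>\<phi> - \<epsilon>\<^sup>4 \<Delta>\<^sub>4\<phi> = u\<^sup>2\<close> with zero boundary values.\<close>

definition quasi_poisson_solution ::
    "(real^3) set \<Rightarrow> real \<Rightarrow> (real^3 \<Rightarrow> real) \<Rightarrow> (real^3 \<Rightarrow> real) \<Rightarrow> bool" where
  "quasi_poisson_solution \<Omega> \<epsilon> u \<phi> \<longleftrightarrow> \<phi> \<in> HH \<Omega> \<and>
     (\<forall>\<psi>\<in>HH \<Omega>.
        (LINT x|lebesgue_on \<Omega>. wgrad \<Omega> \<phi> x \<bullet> wgrad \<Omega> \<psi> x) +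
        \<epsilon>^4 * (LINT x|lebesgue_on \<Omega>. (norm (wgrad \<Omega> \<phi> x))\<^sup>2 * (wgrad \<Omega> \<phi> x \<bullet> wgrad \<Omega> \<psi> x)) =
        (LINT x|lebesgue_on \<Omega>. (u x)\<^sup>2 * \<psi> x))"

text \<open>The weak solution is unique up to equality almost everywhere on \<open>\<Omega>\<close>.\<close>

definition phi_sol :: "(real^3) set \<Rightarrow> real \<Rightarrow> (real^3 \<Rightarrow> real) \<Rightarrow> real^3 \<Rightarrow> real" where
  "phi_sol \<Omega> \<epsilon> u = (SOME \<phi>. quasi_poisson_solution \<Omega> \<epsilon> u \<phi>)"

definition poisson_solution ::
    "(real^3) set \<Rightarrow> (real^3 \<Rightarrow> real) \<Rightarrow> (real^3 \<Rightarrow> real) \<Rightarrow> bool" where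
  "poisson_solution \<Omega> u \<phi> \<longleftrightarrow> \<phi> \<in> H1_0 \<Omega> \<and>
     (\<forall>\<psi>\<in>H1_0 \<Omega>. (LINT x|lebesgue_on \<Omega>. wgrad \<Omega> \<phi> x \<bullet> wgrad \<Omega> \<psi> x) =
        (LINT x|lebesgue_on \<Omega>. (u x)\<^sup>2 * \<psi> x))"

text \<open>The Schroedinger equation with the multiplier on the left-hand side,
  \<open>-\<Delta>u + \<phi> u + \<mu> u = \<bar>u\<bar>\<^sup>q\<^sup>-\<^sup>2 u + \<bar>u\<bar>\<^sup>4 u\<close>.\<close>

definition schroedinger_solution ::
    "(real^3) set \<Rightarrow> real \<Rightarrow> (real^3 \<Rightarrow> real) \<Rightarrow> (real^3 \<Rightarrow> real) \<Rightarrow> real \<Rightarrow> bool" where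
  "schroedinger_solution \<Omega> q u \<phi> \<mu> \<longleftrightarrow> u \<in> H1_0 \<Omega> \<and>
     (\<forall>\<psi>\<in>H1_0 \<Omega>.
        (LINT x|lebesgue_on \<Omega>. wgrad \<Omega> u x \<bullet> wgrad \<Omega> \<psi> x) +
        (LINT x|lebesgue_on \<Omega>. \<phi> x * u x * \<psi> x) +
        \<mu> * (LINT x|lebesgue_on \<Omega>. u x * \<psi> x) =
        (LINT x|lebesgue_on \<Omega>. \<bar>u x\<bar> powr (q - 2) * u x * \<psi> x) +
        (LINT x|lebesgue_on \<Omega>. \<bar>u x\<bar>^4 * u x * \<psi> x))"

definition quasi_SP_solution ::
    "(real^3) set \<Rightarrow> real \<Rightarrow> real \<Rightarrow> (real^3 \<Rightarrow> real) \<Rightarrow> (real^3 \<Rightarrow> real) \<Rightarrow> real \<Rightarrow> bool" where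
  "quasi_SP_solution \<Omega> q \<epsilon> u \<phi> \<mu> \<longleftrightarrow>
     schroedinger_solution \<Omega> q u \<phi> \<mu> \<and> quasi_poisson_solution \<Omega> \<epsilon> u \<phi>"

text \<open>In the limit system the multiplier is on the right-hand side,
  \<open>-\<Delta>u + \<phi> u = \<mu> u + \<bar>u\<bar>\<^sup>q\<^sup>-\<^sup>2 u + \<bar>u\<bar>\<^sup>4 u\<close>, hence the change of sign.\<close>

definition SP_solution ::
    "(real^3) set \<Rightarrow> real \<Rightarrow> real \<Rightarrow> (real^3 \<Rightarrow> real) \<Rightarrow> (real^3 \<Rightarrow> real) \<Rightarrow> real \<Rightarrow> bool" where
  "SP_solution \<Omega> q b u \<phi> \<mu> \<longleftrightarrow>
     schroedinger_solution \<Omega> q u \<phi> (- \<mu>) \<and> poisson_solution \<Omega> u \<phi> \<and>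
     (LINT x|lebesgue_on \<Omega>. (u x)\<^sup>2) = b\<^sup>2"

text \<open>The infimum is over the homogeneous Sobolev space of \<open>L\<^sup>6\<close> functions on \<open>\<real>\<^sup>3\<close> with
  square-integrable weak gradient.\<close>

definition sobolev_const :: real where
  "sobolev_const = Inf {(LINT x|lebesgue_on UNIV. (norm (wgrad UNIV u x))\<^sup>2) | u.
     u \<in> Lp_fun 6 UNIV \<and> (\<exists>g. has_weak_gradient UNIV u g \<and> g \<in> Lp_fun 2 UNIV) \<and>
     (LINT x|lebesgue_on UNIV. \<bar>u x\<bar>^6) = 1}"

definition gagliardo_nirenberg_const :: "real \<Rightarrow> real \<Rightarrow> bool" where
  "gagliardo_nirenberg_const q C \<longleftrightarrow> C > 0 \<and>
     (\<forall>u\<in>H1 UNIV. (LINT x|lebesgue_on UNIV. \<bar>u x\<bar> powr q) \<le>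
        C * (LINT x|lebesgue_on UNIV. \<bar>u x\<bar>\<^sup>2) powr ((6 - q) / 4) *
        (LINT x|lebesgue_on UNIV. (norm (wgrad UNIV u x))\<^sup>2) powr (3 * (q - 2) / 4))"

definition GG :: "real \<Rightarrow> real \<Rightarrow> real \<Rightarrow> real \<Rightarrow> real" where
  "GG q C b t = t\<^sup>2 / 2 - 1 / q * b powr (3 - q / 2) * C * t powr (3 * (q - 2) / 2) -
     1 / (6 * sobolev_const^3) * t^6"

definition truncation_radii :: "real \<Rightarrow> real \<Rightarrow> real \<Rightarrow> real \<Rightarrow> real \<Rightarrow> bool" where
  "truncation_radii q C b R1 R2 \<longleftrightarrow> 0 < R1 \<and> R1 < R2 \<and>
     (\<forall>t\<in>{R1<..<R2}. GG q C b t > 0) \<and>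
     (\<forall>t\<in>{0<..<R1} \<union> {R2<..}. GG q C b t < 0) \<and>
     R1\<^sup>2 < sobolev_const powr (3/2) \<and>
     (\<forall>s\<in>{0..R1}. s\<^sup>2 / 2 - 1 / (6 * sobolev_const^3) * s^6 \<ge> 0)"

definition mass_threshold :: "real \<Rightarrow> real \<Rightarrow> real \<Rightarrow> bool" where
  "mass_threshold q C bstar \<longleftrightarrow> bstar > 0 \<and>
     (\<forall>b\<in>{0<..<bstar}. \<exists>R1 R2. truncation_radii q C b R1 R2)"

text \<open>Smoothness at the endpoint \<open>0\<close> of the half-line is automatic, the function being
  constant on \<open>{0..R1}\<close>.\<close>

definition truncation_function :: "real \<Rightarrow> real \<Rightarrow> (real \<Rightarrow> real) \<Rightarrow> bool" where
  "truncation_function R1 R2 T \<longleftrightarrow> smooth_on T {0<..} \<and>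
     (\<forall>t\<ge>0. 0 \<le> T t \<and> T t \<le> 1) \<and> (\<forall>t\<in>{0..R1}. T t = 1) \<and> (\<forall>t\<ge>R2. T t = 0)"

definition ET :: "(real^3) set \<Rightarrow> real \<Rightarrow> (real \<Rightarrow> real) \<Rightarrow> real \<Rightarrow> (real^3 \<Rightarrow> real) \<Rightarrow> real" where
  "ET \<Omega> q T \<epsilon> u =
     1/2 * (LINT x|lebesgue_on \<Omega>. (norm (wgrad \<Omega> u x))\<^sup>2) +
     1/4 * (LINT x|lebesgue_on \<Omega>. (norm (wgrad \<Omega> (phi_sol \<Omega> \<epsilon> u) x))\<^sup>2) +
     3 * \<epsilon>^4 / 8 * (LINT x|lebesgue_on \<Omega>. (norm (wgrad \<Omega> (phi_sol \<Omega> \<epsilon> u) x))^4) -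
     1/q * (LINT x|lebesgue_on \<Omega>. \<bar>u x\<bar> powr q) -
     T (grad_norm \<Omega> u) / 6 * (LINT x|lebesgue_on \<Omega>. \<bar>u x\<bar>^6)"

definition H1_0_has_derivative ::
    "(real^3) set \<Rightarrow> ((real^3 \<Rightarrow> real) \<Rightarrow> real) \<Rightarrow> ((real^3 \<Rightarrow> real) \<Rightarrow> real) \<Rightarrow> (real^3 \<Rightarrow> real) \<Rightarrow> bool"
  where
  "H1_0_has_derivative \<Omega> E L u \<longleftrightarrow>
     (\<forall>v\<in>H1_0 \<Omega>. \<forall>w\<in>H1_0 \<Omega>. \<forall>a c. L (\<lambda>x. a * v x + c * w x) = a * L v + c * L w) \<and>
     (\<exists>K. \<forall>v\<in>H1_0 \<Omega>. \<bar>L v\<bar> \<le> K * H1_norm \<Omega> v) \<and>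
     (\<forall>e>0. \<exists>d>0. \<forall>v\<in>H1_0 \<Omega>. H1_norm \<Omega> v < d \<longrightarrow>
        \<bar>E (\<lambda>x. u x + v x) - E u - L v\<bar> \<le> e * H1_norm \<Omega> v)"

text \<open>Critical point of \<open>E\<close> restricted to the sphere: the derivative vanishes on the tangent
  space of the sphere at \<open>u\<close>, which consists of the functions orthogonal to \<open>u\<close> in \<open>L\<^sup>2\<close>.\<close>

definition critical_on_sphere ::
    "(real^3) set \<Rightarrow> real \<Rightarrow> ((real^3 \<Rightarrow> real) \<Rightarrow> real) \<Rightarrow> (real^3 \<Rightarrow> real) \<Rightarrow> bool" where
  "critical_on_sphere \<Omega> b E u \<longleftrightarrow> u \<in> mass_sphere \<Omega> b \<and>
     (\<exists>L. H1_0_has_derivative \<Omega> E L u \<and>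
        (\<forall>v\<in>H1_0 \<Omega>. (LINT x|lebesgue_on \<Omega>. u x * v x) = 0 \<longrightarrow> L v = 0))"

definition symmetric_set :: "(real^3 \<Rightarrow> real) set \<Rightarrow> bool" where
  "symmetric_set D \<longleftrightarrow> (\<lambda>u x. - u x) ` D = D"

text \<open>The infimum of the empty set of extended natural numbers is \<open>\<infinity>\<close>.\<close>

definition genus :: "(real^3) set \<Rightarrow> (real^3 \<Rightarrow> real) set \<Rightarrow> enat" where
  "genus \<Omega> D = (if D = {} then 0 else Inf {enat m | m. \<exists>h.
     continuous_map (subtopology (H1_0_top \<Omega>) D)
       (subtopology (Euclidean_space m) (- {\<lambda>i. 0})) h \<and>
     (\<forall>u\<in>D. h (\<lambda>x. - u x) = (\<lambda>i. - h u i))})"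

definition minimax_level ::
    "(real^3) set \<Rightarrow> real \<Rightarrow> (real \<Rightarrow> real) \<Rightarrow> real \<Rightarrow> real \<Rightarrow> nat \<Rightarrow> ereal" where
  "minimax_level \<Omega> q T b \<epsilon> j =
     (INF D\<in>{D. D \<subseteq> mass_sphere \<Omega> b \<and>
          closedin (subtopology (H1_0_top \<Omega>) (mass_sphere \<Omega> b)) D \<and>
          symmetric_set D \<and> genus \<Omega> D \<ge> enat j}.
        SUP u\<in>D. ereal (ET \<Omega> q T \<epsilon> u))"

definition minimax_solution ::
    "(real^3) set \<Rightarrow> real \<Rightarrow> (real \<Rightarrow> real) \<Rightarrow> real \<Rightarrow> real \<Rightarrow> nat \<Rightarrow>
     (real^3 \<Rightarrow> real) \<Rightarrow> (real^3 \<Rightarrow> real) \<Rightarrow> real \<Rightarrow> bool" where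
  "minimax_solution \<Omega> q T b \<epsilon> j u \<phi> \<mu> \<longleftrightarrow>
     u \<in> mass_sphere \<Omega> b \<and> \<phi> \<in> HH \<Omega> \<and> quasi_SP_solution \<Omega> q \<epsilon> u \<phi> \<mu> \<and>
     critical_on_sphere \<Omega> b (ET \<Omega> q T \<epsilon>) u \<and>
     ereal (ET \<Omega> q T \<epsilon> u) = minimax_level \<Omega> q T b \<epsilon> j \<and>
     minimax_level \<Omega> q T b \<epsilon> j < 0 \<and>
     (AE x in lebesgue_on \<Omega>. \<phi> x = phi_sol \<Omega> \<epsilon> u x)"

end

theory Submission
  imports Defs "HOL-Complex_Analysis.Great_Picard"
begin

text \<open>
  Negative energy together with the truncation forces \<open>\<parallel>\<nabla>u\<parallel> \<le> R1\<close>: the two \<open>\<phi>\<close>-terms of the energy are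
  nonnegative, and the Gagliardo--Nirenberg and Sobolev inequalities bound the rest from below by \<open>GG\<close>.
  Testing the equations with the solutions themselves bounds \<open>\<phi>\<close> and the multiplier, so a subsequence
  converges strongly in \<open>L\<^sup>2\<close> and weakly in \<open>H\<^sup>1\<close>. By Hoelder's inequality the \<open>\<Delta>\<^sub>4\<close>-term is of order \<open>\<epsilon>\<close>
  for a fixed test function, hence the limit of \<open>\<phi>\<close> solves the Poisson equation, and comparing energies
  makes the convergence strong. For \<open>u\<close>, testing with \<open>v = u - u\<^sub>0\<close> gives
  \<open>\<parallel>\<nabla>v\<parallel>\<^sup>2 = \<parallel>v\<parallel>\<^sub>6\<^sup>6 + o(1) \<le> \<parallel>\<nabla>v\<parallel>\<^sup>6 / S\<^sup>3 + o(1)\<close>, while \<open>\<parallel>\<nabla>v\<parallel>\<^sup>2 \<le> R1\<^sup>2 + o(1)\<close> stays below \<open>S\<^sup>3\<^sup>/\<^sup>2\<close>;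
  therefore \<open>v\<close> tends to zero in \<open>H\<^sup>1\<close>.
\<close>

section \<open>Square-integrable functions\<close>

text \<open>The obstacle is the critical power. The embedding of H^1 into L^6 is not compact, so
  strong L^2 convergence of a subsequence settles the lower order terms but not the quintic one. The
  number S^(3/2) is the nonzero root of t = t^3 / S^3: as long as t = |grad v|^2 stays a fixed
  distance below it, t <= t^3 / S^3 + o(1) leaves only t -> 0. The Poisson part has a different
  obstacle, because test functions of the quasilinear equation must lie in W^{1,4}; the limit
  equation is therefore reached on smooth test functions and extended by density. Weak gradients
  enter through \<open>wgrad\<close>, an arbitrarily chosen representative, so the analysis is
  carried out on pairs (u, G) that are L^2 limits of smooth functions together with their classical
  gradients. Sobolev-type inequalities are proved for compactly supported smooth functions and pass
  to such pairs by Fatou's lemma. Compactness comes from averages over cubic grids: countably many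
  numbers, made convergent by one diagonal argument for all solutions and multipliers at
  once.\<close>

definition square_integrable :: "'a measure \<Rightarrow> ('a \<Rightarrow> 'b::euclidean_space) \<Rightarrow> bool" where
  "square_integrable M f \<longleftrightarrow> f \<in> borel_measurable M \<and> integrable M (\<lambda>x. (norm (f x))\<^sup>2)"

definition sqnorm :: "'a measure \<Rightarrow> ('a \<Rightarrow> 'b::euclidean_space) \<Rightarrow> real" where
  "sqnorm M f = (LINT x|M. (norm (f x))\<^sup>2)"

lemma sqnorm_nonneg [simp]: "0 \<le> sqnorm M f"
  by (simp add: sqnorm_def)

lemma norm_add_sq_le: "(norm (x + y))\<^sup>2 \<le> 2 * (norm x)\<^sup>2 + 2 * (norm (y::'a::real_inner))\<^sup>2"
proof -
  have "(norm (x + y))\<^sup>2 + (norm (x - y))\<^sup>2 = 2 * (norm x)\<^sup>2 + 2 * (norm y)\<^sup>2"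
    by (simp add: power2_norm_eq_inner inner_simps inner_commute)
  then show ?thesis by (smt (verit) zero_le_power2)
qed

lemma abs_inner_le_sq: "\<bar>x \<bullet> y\<bar> \<le> (norm x)\<^sup>2 + (norm (y::'a::real_inner))\<^sup>2"
proof -
  have "\<bar>x \<bullet> y\<bar> \<le> norm x * norm y" by (rule Cauchy_Schwarz_ineq2)
  also have "\<dots> \<le> (norm x)\<^sup>2 + (norm y)\<^sup>2"
  proof -
    have "2 * (norm x * norm y) \<le> (norm x)\<^sup>2 + (norm y)\<^sup>2"
      using sum_squares_bound[of "norm x" "norm y"] by (simp only: mult.assoc)
    moreover have "0 \<le> norm x * norm y" by simp
    ultimately show ?thesis by linarith
  qed
  finally show ?thesis .
qed

lemma square_integrable_zero [simp]: "square_integrable M (\<lambda>_. 0)"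
  by (simp add: square_integrable_def)

lemma square_integrable_measurable: "square_integrable M f \<Longrightarrow> f \<in> borel_measurable M"
  by (simp add: square_integrable_def)

lemma square_integrable_add:
  assumes "square_integrable M f" "square_integrable M g"
  shows "square_integrable M (\<lambda>x. f x + g x)"
  unfolding square_integrable_def
proof
  note [measurable] = assms[THEN square_integrable_measurable]
  show "(\<lambda>x. f x + g x) \<in> borel_measurable M" by measurable
  have "integrable M (\<lambda>x. 2 * (norm (f x))\<^sup>2 + 2 * (norm (g x))\<^sup>2)"
    using assms by (auto simp: square_integrable_def)
  then show "integrable M (\<lambda>x. (norm (f x + g x))\<^sup>2)"
    by (rule Bochner_Integration.integrable_bound) (auto intro!: order.trans[OF norm_add_sq_le])
qed

lemma square_integrable_scaleR:
  assumes "square_integrable M f" shows "square_integrable M (\<lambda>x. c *\<^sub>R f x)"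
  using assms by (auto simp: square_integrable_def power_mult_distrib)

lemma square_integrable_diff:
  assumes "square_integrable M f" "square_integrable M g"
  shows "square_integrable M (\<lambda>x. f x - g x)"
  using square_integrable_add[OF assms(1) square_integrable_scaleR[OF assms(2), of "-1"]] by simp

lemma square_integrable_inner:
  assumes "square_integrable M f" "square_integrable M g"
  shows "integrable M (\<lambda>x. f x \<bullet> g x)"
proof -
  note [measurable] = assms[THEN square_integrable_measurable]
  have "integrable M (\<lambda>x. (norm (f x))\<^sup>2 + (norm (g x))\<^sup>2)"
    using assms by (auto simp: square_integrable_def)
  then show ?thesis
    by (rule Bochner_Integration.integrable_bound) (auto intro!: order.trans[OF abs_inner_le_sq])
qed

lemma square_integrable_AE:
  assumes "square_integrable M f" "AE x in M. f x = g x" "g \<in> borel_measurable M"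
  shows "square_integrable M g"
  using assms unfolding square_integrable_def
  by (auto intro: integrable_cong_AE_imp)

lemma sqnorm_cong_AE:
  assumes "f \<in> borel_measurable M" "g \<in> borel_measurable M" "AE x in M. f x = g x"
  shows "sqnorm M f = sqnorm M g"
  unfolding sqnorm_def by (rule integral_cong_AE) (use assms in auto)

lemma sqnorm_scaleR: "sqnorm M (\<lambda>x. c *\<^sub>R f x) = c\<^sup>2 * sqnorm M f"
  by (simp add: sqnorm_def power_mult_distrib)

lemma sqnorm_minus_commute: "sqnorm M (\<lambda>x. f x - g x) = sqnorm M (\<lambda>x. g x - f x)"
  by (simp add: sqnorm_def norm_minus_commute)

lemma sqnorm_add:
  assumes "square_integrable M f" "square_integrable M g"
  shows "sqnorm M (\<lambda>x. f x + g x) = sqnorm M f + 2 * (LINT x|M. f x \<bullet> g x) + sqnorm M g"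
proof -
  have "sqnorm M (\<lambda>x. f x + g x) = (LINT x|M. (norm (f x))\<^sup>2 + 2 * (f x \<bullet> g x) + (norm (g x))\<^sup>2)"
    unfolding sqnorm_def
    by (rule Bochner_Integration.integral_cong)
       (auto simp: power2_norm_eq_inner inner_simps inner_commute)
  also have "\<dots> = sqnorm M f + 2 * (LINT x|M. f x \<bullet> g x) + sqnorm M g"
    using assms square_integrable_inner[OF assms] unfolding sqnorm_def square_integrable_def by simp
  finally show ?thesis .
qed

lemma sqnorm_diff:
  assumes "square_integrable M f" "square_integrable M g"
  shows "sqnorm M (\<lambda>x. f x - g x) = sqnorm M f - 2 * (LINT x|M. f x \<bullet> g x) + sqnorm M g"
  using sqnorm_add[OF assms(1) square_integrable_scaleR[OF assms(2), of "-1"]]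
    sqnorm_scaleR[of M "-1" g] by simp

lemma sqnorm_add_le:
  assumes "square_integrable M f" "square_integrable M g"
  shows "sqnorm M (\<lambda>x. f x + g x) \<le> 2 * sqnorm M f + 2 * sqnorm M g"
proof -
  have "sqnorm M (\<lambda>x. f x + g x) \<le> (LINT x|M. 2 * (norm (f x))\<^sup>2 + 2 * (norm (g x))\<^sup>2)"
    unfolding sqnorm_def
    using assms square_integrable_add[OF assms]
    by (intro integral_mono) (auto simp: square_integrable_def norm_add_sq_le)
  also have "\<dots> = 2 * sqnorm M f + 2 * sqnorm M g"
    using assms unfolding sqnorm_def square_integrable_def by simp
  finally show ?thesis .
qed

lemma sqnorm_diff_le:
  assumes "square_integrable M f" "square_integrable M g"
  shows "sqnorm M (\<lambda>x. f x - g x) \<le> 2 * sqnorm M f + 2 * sqnorm M g"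
  using sqnorm_add_le[OF assms(1) square_integrable_scaleR[OF assms(2), of "-1"]]
    sqnorm_scaleR[of M "-1" g] by simp

lemma sqnorm_triangle_le:
  assumes "square_integrable M f" "square_integrable M g" "square_integrable M h"
  shows "sqnorm M (\<lambda>x. f x - h x) \<le> 2 * sqnorm M (\<lambda>x. f x - g x) + 2 * sqnorm M (\<lambda>x. g x - h x)"
  using sqnorm_add_le[OF square_integrable_diff[OF assms(1,2)] square_integrable_diff[OF assms(2,3)]]
  by simp

text \<open>Nonnegativity of t |-> |f - t g|^2, evaluated at its minimiser t = B / D. If D = 0 the
  expression is affine in t, and an affine function that is nonnegative everywhere is
  constant.\<close>

lemma integral_Cauchy_Schwarz:
  assumes f: "square_integrable M f" and g: "square_integrable M g"
  shows "(LINT x|M. f x \<bullet> g x)\<^sup>2 \<le> sqnorm M f * sqnorm M g"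
proof -
  define A B D where "A = sqnorm M f" and "B = (LINT x|M. f x \<bullet> g x)" and "D = sqnorm M g"
  have quad: "0 \<le> A - 2 * t * B + t\<^sup>2 * D" for t
  proof -
    have "0 \<le> sqnorm M (\<lambda>x. f x - t *\<^sub>R g x)" by simp
    also have "\<dots> = A - 2 * t * B + t\<^sup>2 * D"
      unfolding A_def B_def D_def
      by (subst sqnorm_diff[OF f square_integrable_scaleR[OF g]]) (simp add: sqnorm_scaleR)
    finally show ?thesis .
  qed
  have "D \<ge> 0" by (simp add: D_def)
  show ?thesis
  proof (cases "D = 0")
    case True
    have "B = 0"
    proof (rule ccontr)
      assume "B \<noteq> 0"
      \<comment> \<open>At this t the affine function takes the value -1.\<close>
      then show False using quad[of "(A + 1) / (2 * B)"] True by simp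
    qed
    then show ?thesis unfolding B_def[symmetric] by (simp)
  next
    case False
    then have "D > 0" using \<open>D \<ge> 0\<close> by simp
    have "0 \<le> D * (A - 2 * (B / D) * B + (B / D)\<^sup>2 * D)"
      using quad[of "B / D"] \<open>D > 0\<close> by simp
    also have "\<dots> = A * D - B\<^sup>2"
      using \<open>D > 0\<close> by (simp add: field_simps power2_eq_square)
    finally show ?thesis by (simp add: A_def B_def D_def)
  qed
qed

lemma integral_inner_tendsto:
  assumes f: "\<And>n. square_integrable M (f n)" and g: "square_integrable M g"
    and h: "square_integrable M h" and lim: "(\<lambda>n. sqnorm M (\<lambda>x. f n x - g x)) \<longlonglongrightarrow> 0"
  shows "(\<lambda>n. LINT x|M. f n x \<bullet> h x) \<longlonglongrightarrow> (LINT x|M. g x \<bullet> h x)"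
proof -
  have "(\<lambda>n. sqrt (sqnorm M (\<lambda>x. f n x - g x) * sqnorm M h)) \<longlonglongrightarrow> sqrt (0 * sqnorm M h)"
    by (intro tendsto_intros lim)
  then have lim0: "(\<lambda>n. sqrt (sqnorm M (\<lambda>x. f n x - g x) * sqnorm M h)) \<longlonglongrightarrow> 0" by simp
  have "(\<lambda>n. (LINT x|M. f n x \<bullet> h x) - (LINT x|M. g x \<bullet> h x)) \<longlonglongrightarrow> 0"
  proof (rule Lim_null_comparison[OF _ lim0], intro always_eventually allI)
    fix n
    have "(LINT x|M. f n x \<bullet> h x) - (LINT x|M. g x \<bullet> h x) = (LINT x|M. (f n x - g x) \<bullet> h x)"
      by (subst Bochner_Integration.integral_diff[symmetric])
         (auto simp: inner_simps intro: square_integrable_inner f g h)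
    then have "((LINT x|M. f n x \<bullet> h x) - (LINT x|M. g x \<bullet> h x))\<^sup>2
        \<le> sqnorm M (\<lambda>x. f n x - g x) * sqnorm M h"
      using integral_Cauchy_Schwarz[OF square_integrable_diff[OF f g] h] by simp
    then show "norm ((LINT x|M. f n x \<bullet> h x) - (LINT x|M. g x \<bullet> h x))
        \<le> sqrt (sqnorm M (\<lambda>x. f n x - g x) * sqnorm M h)"
      by (simp add: real_le_rsqrt)
  qed
  then show ?thesis by (simp add: LIM_zero_iff)
qed

lemma sqnorm_tendsto:
  assumes f: "\<And>n. square_integrable M (f n)" and g: "square_integrable M g"
    and lim: "(\<lambda>n. sqnorm M (\<lambda>x. f n x - g x)) \<longlonglongrightarrow> 0"
  shows "(\<lambda>n. sqnorm M (f n)) \<longlonglongrightarrow> sqnorm M g"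
proof -
  have eq: "sqnorm M (f n) = sqnorm M (\<lambda>x. f n x - g x) + 2 * (LINT x|M. f n x \<bullet> g x) - sqnorm M g" for n
    using sqnorm_diff[OF f g, of n] by simp
  have "(\<lambda>n. sqnorm M (\<lambda>x. f n x - g x) + 2 * (LINT x|M. f n x \<bullet> g x) - sqnorm M g)
      \<longlonglongrightarrow> 0 + 2 * (LINT x|M. g x \<bullet> g x) - sqnorm M g"
    by (intro tendsto_intros lim integral_inner_tendsto f g)
  moreover have "(LINT x|M. g x \<bullet> g x) = sqnorm M g"
    by (simp add: sqnorm_def power2_norm_eq_inner)
  ultimately show ?thesis by (simp add: eq)
qed

text \<open>Fatou's lemma with bounds that may vary and converge. Integrability of the limit is part
  of the conclusion; it serves both the completeness of L^2 and the extension of inequalities beyond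
  test functions.\<close>

lemma Fatou_bound:
  fixes H :: "'a \<Rightarrow> real"
  assumes h: "\<And>k. integrable M (h k)" "\<And>k x. 0 \<le> h k x" and H: "H \<in> borel_measurable M"
    and lim: "AE x in M. (\<lambda>k. h k x) \<longlonglongrightarrow> H x" and bd: "\<And>k. (LINT x|M. h k x) \<le> B k"
    and B: "B \<longlonglongrightarrow> B0"
  shows "integrable M H \<and> (LINT x|M. H x) \<le> B0"
proof -
  have [measurable]: "h k \<in> borel_measurable M" for k using h by auto
  \<comment> \<open>\<open>ennreal\<close> truncates at 0, so the last comparison can return to the
    reals only for a nonnegative bound.\<close>
  have B0: "B0 \<ge> 0"
    by (rule LIMSEQ_le_const[OF B]) (use bd h in \<open>auto intro!: exI[of _ 0] intro: order.trans[OF _ bd] integral_nonneg\<close>)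
  have pos: "AE x in M. 0 \<le> H x"
    using lim by eventually_elim (rule LIMSEQ_le_const, auto simp: h)
  have "(\<integral>\<^sup>+x. ennreal (H x) \<partial>M) = (\<integral>\<^sup>+x. liminf (\<lambda>k. ennreal (h k x)) \<partial>M)"
    using lim by (intro nn_integral_cong_AE, eventually_elim)
      (auto intro!: lim_imp_Liminf[symmetric] tendsto_ennrealI)
  also have "\<dots> \<le> liminf (\<lambda>k. \<integral>\<^sup>+x. ennreal (h k x) \<partial>M)"
    by (rule nn_integral_liminf) auto
  also have "\<dots> = liminf (\<lambda>k. ennreal (LINT x|M. h k x))"
    using h by (subst nn_integral_eq_integral) auto
  also have "\<dots> \<le> liminf (\<lambda>k. ennreal (B k))"
    by (intro Liminf_mono always_eventually allI ennreal_leI bd)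
  also have "\<dots> = ennreal B0"
    by (rule lim_imp_Liminf) (auto intro: tendsto_ennrealI B)
  finally have *: "(\<integral>\<^sup>+x. ennreal (H x) \<partial>M) \<le> ennreal B0" .
  have int: "integrable M H"
    using * H pos by (intro integrableI_nonneg) (auto simp: le_less_trans)
  have "ennreal (LINT x|M. H x) \<le> ennreal B0"
    using * nn_integral_eq_integral[OF int pos] by simp
  then show ?thesis using int B0 by simp
qed

section \<open>Completeness of L^2 over a finite measure\<close>

lemma (in finite_measure) square_integrable_integrable:
  assumes "square_integrable M f" shows "integrable M f"
proof -
  have *: "integrable M (\<lambda>x. 1 + (norm (f x))\<^sup>2)"
    using assms by (auto simp: square_integrable_def)
  have "norm (f x) \<le> norm (1 + (norm (f x))\<^sup>2)" for x
  proof -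
    have "2 * norm (f x) \<le> 1 + (norm (f x))\<^sup>2"
      using sum_squares_bound[of 1 "norm (f x)"] by simp
    moreover have "norm (1 + (norm (f x))\<^sup>2) = 1 + (norm (f x))\<^sup>2" by simp
    ultimately show ?thesis using norm_ge_zero[of "f x"] by linarith
  qed
  then show ?thesis
    using assms by (intro Bochner_Integration.integrable_bound[OF *]) (auto simp: square_integrable_def)
qed

lemma subseq_fast_Cauchy:
  fixes d :: "nat \<Rightarrow> nat \<Rightarrow> real"
  assumes "\<And>e. e > 0 \<Longrightarrow> \<exists>N. \<forall>m\<ge>N. \<forall>n\<ge>N. d m n < e" and "\<And>k. \<eta> k > 0"
  shows "\<exists>r. strict_mono r \<and> (\<forall>k. d (r (Suc k)) (r k) < \<eta> k)"
proof -
  have "\<exists>N. \<forall>k. \<forall>m\<ge>N k. \<forall>n\<ge>N k. d m n < \<eta> k"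
    by (rule choice) (use assms in blast)
  then obtain N where N: "\<And>k m n. m \<ge> N k \<Longrightarrow> n \<ge> N k \<Longrightarrow> d m n < \<eta> k" by blast
  \<comment> \<open>The maximum keeps \<open>r\<close> strictly increasing and past the Cauchy
    threshold of the new index.\<close>
  define r where "r = rec_nat (N 0) (\<lambda>k rk. max (Suc rk) (N (Suc k)))"
  have r: "r (Suc k) = max (Suc (r k)) (N (Suc k))" "r 0 = N 0" for k by (simp_all add: r_def)
  have ge: "r k \<ge> N k" for k by (cases k) (auto simp: r)
  have mono: "strict_mono r" by (rule strict_monoI_Suc) (simp add: r)
  have "d (r (Suc k)) (r k) < \<eta> k" for k
    by (rule N) (use ge[of k] r(1)[of k] in auto)
  then show ?thesis using mono by blast
qed

text \<open>Squared increments below 4^(-k) have L^1 norm of order 2^(-k) on a finite measure. The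
  increments thus have an integrable sum, which is finite almost everywhere, and the telescoping
  series converges absolutely at such points.\<close>

lemma (in finite_measure) AE_convergent_fast:
  fixes f :: "nat \<Rightarrow> 'a \<Rightarrow> 'b::euclidean_space"
  assumes f: "\<And>n. square_integrable M (f n)"
    and fast: "\<And>k. sqnorm M (\<lambda>x. f (Suc k) x - f k x) < (1/4)^k"
  shows "AE x in M. convergent (\<lambda>k. f k x)"
proof -
  define D where "D = (\<lambda>k x. norm (f (Suc k) x - f k x))"
  have sqD: "square_integrable M (\<lambda>x. f (Suc k) x - f k x)" for k
    by (intro square_integrable_diff f)
  have intD: "integrable M (D k)" for k
    unfolding D_def by (intro integrable_norm square_integrable_integrable sqD)
  note [measurable] = borel_measurable_integrable[OF intD]
  have bD: "(LINT x|M. D k x) \<le> (1 + measure M (space M)) * (1/2)^k" for k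
  proof -
    \<comment> \<open>Young's inequality with weight 2^k, balanced so that both terms integrate to
      order 2^(-k).\<close>
    have "(LINT x|M. D k x) \<le> (LINT x|M. 2^k * (norm (f (Suc k) x - f k x))\<^sup>2 + (1/2)^k)"
    proof (rule integral_mono[OF intD])
      show "integrable M (\<lambda>x. 2^k * (norm (f (Suc k) x - f k x))\<^sup>2 + (1/2)^k)"
        using sqD[of k] by (auto simp: square_integrable_def)
      fix x
      define c :: real where "c = 2^k"
      have c: "c > 0" "(1/2)^k = 1 / c" by (auto simp: c_def power_divide)
      have "c * (D k x)\<^sup>2 + 1 / c - D k x = ((c * D k x - 1/2)\<^sup>2 + 3/4) / c"
        using c by (simp add: field_simps power2_eq_square)
      also have "\<dots> \<ge> 0" using c by simp
      finally show "D k x \<le> 2^k * (norm (f (Suc k) x - f k x))\<^sup>2 + (1/2)^k"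
        using c by (simp add: D_def c_def)
    qed
    also have "\<dots> = 2^k * sqnorm M (\<lambda>x. f (Suc k) x - f k x) + (1/2)^k * measure M (space M)"
      using sqD[of k] by (simp add: sqnorm_def square_integrable_def)
    also have "\<dots> \<le> 2^k * (1/4)^k + (1/2)^k * measure M (space M)"
      using fast[of k] by simp
    also have "2^k * (1/4)^k = (1/2::real)^k" by (simp flip: power_mult_distrib)
    finally show ?thesis by (simp add: algebra_simps)
  qed
  have "(\<integral>\<^sup>+x. (\<Sum>k. ennreal (D k x)) \<partial>M) = (\<Sum>k. \<integral>\<^sup>+x. ennreal (D k x) \<partial>M)"
    by (rule nn_integral_suminf) auto
  also have "\<dots> = (\<Sum>k. ennreal (LINT x|M. D k x))"
    by (subst nn_integral_eq_integral[OF intD]) (auto simp: D_def)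
  also have "\<dots> \<noteq> \<infinity>"
  proof -
    have "summable (\<lambda>k. LINT x|M. D k x)"
      by (rule summable_comparison_test'[of "\<lambda>k. (1 + measure M (space M)) * (1/2)^k"])
         (use bD in \<open>auto simp: D_def intro!: summable_mult summable_geometric\<close>)
    moreover have "0 \<le> (LINT x|M. D k x)" for k by (simp add: D_def)
    ultimately show ?thesis unfolding infinity_ennreal_def by (rule ennreal_suminf_neq_top)
  qed
  finally have "AE x in M. (\<Sum>k. ennreal (D k x)) \<noteq> \<infinity>"
    by (intro nn_integral_noteq_infinite) auto
  then show ?thesis
  proof eventually_elim
    fix x assume "(\<Sum>k. ennreal (D k x)) \<noteq> \<infinity>"
    then have "summable (\<lambda>k. D k x)"
      by (intro summable_suminf_not_top) (auto simp: D_def)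
    then have "summable (\<lambda>k. f (Suc k) x - f k x)"
      unfolding D_def by (rule summable_norm_cancel)
    then have "(\<lambda>n. \<Sum>k<n. f (Suc k) x - f k x) \<longlonglongrightarrow> (\<Sum>k. f (Suc k) x - f k x)"
      by (rule summable_LIMSEQ)
    moreover have "(\<Sum>k<n. f (Suc k) x - f k x) = f n x - f 0 x" for n
      using sum_lessThan_telescope[of "\<lambda>k. f k x" n] by blast
    ultimately have "(\<lambda>n. f n x - f 0 x) \<longlonglongrightarrow> (\<Sum>k. f (Suc k) x - f k x)"
      by (simp only:)
    then have "(\<lambda>n. (f n x - f 0 x) + f 0 x) \<longlonglongrightarrow> (\<Sum>k. f (Suc k) x - f k x) + f 0 x"
      by (intro tendsto_intros)
    then show "convergent (\<lambda>k. f k x)" by (auto simp: convergent_def)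
  qed
qed

text \<open>The limit is taken pointwise along a fast subsequence. Fatou's lemma, applied with one
  index fixed and the other running through that subsequence, bounds the distance of the fixed
  member to the limit and so controls the whole sequence.\<close>

theorem (in finite_measure) square_integrable_complete:
  fixes f :: "nat \<Rightarrow> 'a \<Rightarrow> 'b::euclidean_space"
  assumes f: "\<And>n. square_integrable M (f n)"
    and Cauchy: "\<And>e. e > 0 \<Longrightarrow> \<exists>N. \<forall>m\<ge>N. \<forall>n\<ge>N. sqnorm M (\<lambda>x. f m x - f n x) < e"
  shows "\<exists>g. square_integrable M g \<and> (\<lambda>n. sqnorm M (\<lambda>x. f n x - g x)) \<longlonglongrightarrow> 0"
proof -
  obtain r where r: "strict_mono r"
      and fast: "\<And>k. sqnorm M (\<lambda>x. f (r (Suc k)) x - f (r k) x) < (1/4)^k"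
    using subseq_fast_Cauchy[of "\<lambda>m n. sqnorm M (\<lambda>x. f m x - f n x)" "\<lambda>k. (1/4)^k", OF Cauchy]
    by auto
  have conv: "AE x in M. convergent (\<lambda>k. f (r k) x)"
    by (rule AE_convergent_fast) (use f fast in auto)
  have [measurable]: "f n \<in> borel_measurable M" for n using f by (auto simp: square_integrable_def)
  define g where "g = (\<lambda>x. lim (\<lambda>k. f (r k) x))"
  have [measurable]: "g \<in> borel_measurable M" unfolding g_def by measurable
  \<comment> \<open>The shift by \<open>K\<close> allows a bound that is only available from some
    index on.\<close>
  have bound: "integrable M (\<lambda>x. (norm (f n x - g x))\<^sup>2) \<and> sqnorm M (\<lambda>x. f n x - g x) \<le> e"
    if e: "\<And>k. k \<ge> K \<Longrightarrow> sqnorm M (\<lambda>x. f n x - f (r k) x) \<le> e" for n K e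
    unfolding sqnorm_def
  proof (rule Fatou_bound[where h="\<lambda>k x. (norm (f n x - f (r (k + K)) x))\<^sup>2" and B="\<lambda>_. e"])
    show "integrable M (\<lambda>x. (norm (f n x - f (r (k + K)) x))\<^sup>2)" for k
      using square_integrable_diff[OF f f] by (auto simp: square_integrable_def)
    show "AE x in M. (\<lambda>k. (norm (f n x - f (r (k + K)) x))\<^sup>2) \<longlonglongrightarrow> (norm (f n x - g x))\<^sup>2"
      using conv
    proof eventually_elim
      fix x assume "convergent (\<lambda>k. f (r k) x)"
      then have "(\<lambda>k. f (r k) x) \<longlonglongrightarrow> g x" by (simp add: g_def convergent_LIMSEQ_iff)
      then have "(\<lambda>k. f (r (k + K)) x) \<longlonglongrightarrow> g x" by (rule LIMSEQ_ignore_initial_segment)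
      then show "(\<lambda>k. (norm (f n x - f (r (k + K)) x))\<^sup>2) \<longlonglongrightarrow> (norm (f n x - g x))\<^sup>2"
        by (intro tendsto_intros)
    qed
    show "(LINT x|M. (norm (f n x - f (r (k + K)) x))\<^sup>2) \<le> e" for k
      using e[of "k + K"] by (simp add: sqnorm_def)
  qed auto
  have lim: "\<exists>N. \<forall>n\<ge>N. integrable M (\<lambda>x. (norm (f n x - g x))\<^sup>2) \<and> sqnorm M (\<lambda>x. f n x - g x) \<le> e"
    if e0: "e > 0" for e
  proof -
    obtain N where N: "\<And>m n. m \<ge> N \<Longrightarrow> n \<ge> N \<Longrightarrow> sqnorm M (\<lambda>x. f m x - f n x) < e"
      using Cauchy[OF e0] by blast
    have "sqnorm M (\<lambda>x. f n x - f (r k) x) \<le> e" if "n \<ge> N" "k \<ge> N" for n k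
      using N[of n "r k"] that seq_suble[OF r, of k] by simp
    then show ?thesis using bound[of N] by blast
  qed
  obtain N where "integrable M (\<lambda>x. (norm (f N x - g x))\<^sup>2)" using lim[of 1] by auto
  then have "square_integrable M (\<lambda>x. f N x - g x)" by (simp add: square_integrable_def)
  from square_integrable_diff[OF f[of N] this] have "square_integrable M g" by simp
  moreover have "(\<lambda>n. sqnorm M (\<lambda>x. f n x - g x)) \<longlonglongrightarrow> 0"
  proof (rule LIMSEQ_I)
    fix e :: real assume "e > 0"
    then obtain N where "\<forall>n\<ge>N. sqnorm M (\<lambda>x. f n x - g x) \<le> e / 2" using lim[of "e/2"] by auto
    then show "\<exists>N. \<forall>n\<ge>N. norm (sqnorm M (\<lambda>x. f n x - g x) - 0) < e"
      using \<open>e > 0\<close> by (intro exI[of _ N]) fastforce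
  qed
  ultimately show ?thesis by blast
qed

text \<open>Cauchy--Schwarz against the constant 1 turns L^2 convergence into L^1 convergence, which
  has an almost everywhere convergent subsequence.\<close>

lemma (in finite_measure) AE_subseq_of_sqnorm:
  fixes f :: "nat \<Rightarrow> 'a \<Rightarrow> 'b::euclidean_space"
  assumes f: "\<And>n. square_integrable M (f n)" and g: "square_integrable M g"
    and lim: "(\<lambda>n. sqnorm M (\<lambda>x. f n x - g x)) \<longlonglongrightarrow> 0"
  shows "\<exists>r. strict_mono r \<and> (AE x in M. (\<lambda>k. f (r k) x) \<longlonglongrightarrow> g x)"
proof -
  have int: "integrable M (\<lambda>x. f n x - g x)" for n
    by (intro square_integrable_integrable square_integrable_diff f g)
  have "(\<lambda>n. sqrt (sqnorm M (\<lambda>x. f n x - g x) * measure M (space M))) \<longlonglongrightarrow> sqrt (0 * measure M (space M))"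
    by (intro tendsto_intros lim)
  then have lim0: "(\<lambda>n. sqrt (sqnorm M (\<lambda>x. f n x - g x) * measure M (space M))) \<longlonglongrightarrow> 0" by simp
  have "(\<lambda>n. LINT x|M. norm (f n x - g x)) \<longlonglongrightarrow> 0"
  proof (rule Lim_null_comparison[OF _ lim0], intro always_eventually allI)
    fix n
    have "square_integrable M (\<lambda>x. norm (f n x - g x))" "square_integrable M (\<lambda>x. 1::real)"
      using square_integrable_diff[OF f g, of n] by (auto simp: square_integrable_def)
    from integral_Cauchy_Schwarz[OF this]
    show "norm (LINT x|M. norm (f n x - g x)) \<le> sqrt (sqnorm M (\<lambda>x. f n x - g x) * measure M (space M))"
      by (intro real_le_rsqrt) (simp add: sqnorm_def)
  qed
  then obtain r where r: "strict_mono r" "AE x in M. (\<lambda>k. f (r k) x - g x) \<longlonglongrightarrow> 0"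
    using tendsto_L1_AE_subseq[of M "\<lambda>n x. f n x - g x", OF int] by blast
  have "AE x in M. (\<lambda>k. f (r k) x) \<longlonglongrightarrow> g x"
    using r(2) by eventually_elim (simp add: LIM_zero_iff)
  with r(1) show ?thesis by blast
qed

section \<open>Test functions\<close>

lemma Ck_on_Suc_D: "Ck_on (Suc n) f UNIV \<Longrightarrow> Ck_on n f UNIV"
proof (induction n arbitrary: f)
  case 0
  then show ?case
    by (auto simp: continuous_on_eq_continuous_at intro: differentiable_imp_continuous_within)
next
  case (Suc n)
  then show ?case by (metis Ck_on.simps(2))
qed

lemma Ck_on_SucI:
  assumes d: "\<And>x. (f has_derivative f' x) (at x)" and c: "\<And>v. v \<in> Basis \<Longrightarrow> Ck_on n (\<lambda>x. f' x v) UNIV"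
  shows "Ck_on (Suc n) f UNIV"
proof -
  have "frechet_derivative f (at x) = f' x" for x
    using frechet_derivative_at[OF d] by simp
  then show ?thesis using d c by (auto simp: differentiable_def)
qed

lemma Ck_on_has_derivative:
  "Ck_on (Suc n) f UNIV \<Longrightarrow> (f has_derivative frechet_derivative f (at x)) (at x)"
  by (simp add: frechet_derivative_works)

lemma Ck_on_add: "Ck_on n f UNIV \<Longrightarrow> Ck_on n g UNIV \<Longrightarrow> Ck_on n (\<lambda>x. f x + g x) UNIV"
proof (induction n arbitrary: f g)
  case 0
  then show ?case by (auto intro: continuous_intros)
next
  case (Suc n)
  show ?case
    by (rule Ck_on_SucI[OF has_derivative_add[OF Ck_on_has_derivative[OF Suc.prems(1)] Ck_on_has_derivative[OF Suc.prems(2)]]])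
       (use Suc in auto)
qed

lemma Ck_on_const: "Ck_on n (\<lambda>x. c) UNIV"
proof (induction n arbitrary: c)
  case (Suc n)
  show ?case by (rule Ck_on_SucI[OF has_derivative_const]) (rule Suc)
qed simp

lemma Ck_on_mult: "Ck_on n f UNIV \<Longrightarrow> Ck_on n g UNIV \<Longrightarrow> Ck_on n (\<lambda>x. f x * g x) UNIV"
proof (induction n arbitrary: f g)
  case 0
  then show ?case by (auto intro: continuous_intros)
next
  case (Suc n)
  show ?case
    by (rule Ck_on_SucI[OF has_derivative_mult[OF Ck_on_has_derivative[OF Suc.prems(1)] Ck_on_has_derivative[OF Suc.prems(2)]]])
       (use Suc Ck_on_Suc_D in \<open>auto intro!: Ck_on_add Suc.IH\<close>)
qed

text \<open>The sequence \<open>D\<close> of successive derivatives is quantified over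
  \<open>k\<close> in the induction: each partial derivative is a constant multiple of the next
  member composed with the same affine map.\<close>

lemma Ck_on_chain:
  fixes w :: "'a::euclidean_space"
  assumes D: "\<And>k t. (D k has_real_derivative D (Suc k) t) (at t)"
  shows "Ck_on n (\<lambda>x. D k (a * (x \<bullet> w) + c)) UNIV"
proof (induction n arbitrary: k)
  case 0
  have "continuous_on UNIV (D k)"
    using D by (auto simp: continuous_on_eq_continuous_at intro: DERIV_isCont)
  then have "continuous_on UNIV (\<lambda>x. D k (a * (x \<bullet> w) + c))"
    by (rule continuous_on_compose2) (auto intro!: continuous_intros)
  then show ?case by simp
next
  case (Suc n)
  have "((\<lambda>x. D k (a * (x \<bullet> w) + c)) has_derivative (\<lambda>v. (a * (v \<bullet> w)) * D (Suc k) (a * (x \<bullet> w) + c))) (at x)" for x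
    by (rule DERIV_compose_FDERIV[OF D]) (auto intro!: derivative_eq_intros)
  then show ?case
    by (rule Ck_on_SucI) (intro Ck_on_mult Ck_on_const Suc)
qed

lemma smooth_on_add: "smooth_on f UNIV \<Longrightarrow> smooth_on g UNIV \<Longrightarrow> smooth_on (\<lambda>x. f x + g x) UNIV"
  by (simp add: smooth_on_def Ck_on_add)

lemma smooth_on_mult: "smooth_on f UNIV \<Longrightarrow> smooth_on g UNIV \<Longrightarrow> smooth_on (\<lambda>x. f x * g x) UNIV"
  by (simp add: smooth_on_def Ck_on_mult)

lemma smooth_on_const: "smooth_on (\<lambda>x. c) UNIV"
  by (simp add: smooth_on_def Ck_on_const)

lemma smooth_on_prod:
  "finite I \<Longrightarrow> (\<And>i. i \<in> I \<Longrightarrow> smooth_on (f i) UNIV) \<Longrightarrow> smooth_on (\<lambda>x. \<Prod>i\<in>I. f i x) UNIV"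
  by (induction I rule: finite_induct) (auto intro: smooth_on_const smooth_on_mult)

lemma smooth_on_has_derivative:
  "smooth_on f UNIV \<Longrightarrow> (f has_derivative frechet_derivative f (at x)) (at x)"
  by (auto simp: smooth_on_def intro: Ck_on_has_derivative)

lemma smooth_on_continuous: "smooth_on f UNIV \<Longrightarrow> continuous_on UNIV f"
  unfolding smooth_on_def using Ck_on.simps(1) by blast

lemma smooth_on_partial:
  "smooth_on f UNIV \<Longrightarrow> v \<in> Basis \<Longrightarrow> smooth_on (\<lambda>x. frechet_derivative f (at x) v) UNIV"
  unfolding smooth_on_def using Ck_on.simps(2) by blast

section \<open>Flat functions and smooth cut-offs\<close>

definition expinv :: "real poly \<Rightarrow> real \<Rightarrow> real" where
  "expinv p t = (if t > 0 then poly p (1 / t) * exp (- (1 / t)) else 0)"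

text \<open>With s = 1/t this is the decay of p(s) exp(-s) at infinity; on the left of 0 the
  function vanishes.\<close>

lemma expinv_tendsto_0: "(expinv p \<longlongrightarrow> 0) (at 0)"
proof -
  have "((\<lambda>s. \<Sum>i\<le>degree p. coeff p i * (s ^ i / exp s)) \<longlongrightarrow> (\<Sum>i\<le>degree p. coeff p i * 0)) at_top"
    by (intro tendsto_intros tendsto_power_div_exp_0)
  moreover have "(\<lambda>s. \<Sum>i\<le>degree p. coeff p i * (s ^ i / exp s)) = (\<lambda>s. poly p s * exp (- s))"
    by (auto simp: poly_altdef sum_distrib_right exp_minus sum_divide_distrib field_simps)
  ultimately have "((\<lambda>s. poly p s * exp (- s)) \<longlongrightarrow> 0) at_top" by simp
  then have "((\<lambda>t. poly p (inverse t) * exp (- inverse t)) \<longlongrightarrow> 0) (at_right 0)"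
    by (rule filterlim_compose) (rule filterlim_inverse_at_top_right)
  then have "(expinv p \<longlongrightarrow> 0) (at_right 0)"
    by (rule Lim_transform_eventually)
       (auto simp: expinv_def eventually_at_right_field inverse_eq_divide intro!: exI[of _ 1])
  moreover have "(expinv p \<longlongrightarrow> 0) (at_left 0)"
    by (rule Lim_transform_eventually[OF tendsto_const])
       (auto simp: expinv_def eventually_at_left_field intro!: exI[of _ "-1"])
  ultimately show ?thesis by (rule filterlim_split_at[rotated])
qed

text \<open>The class of functions p(1/t) exp(-1/t), extended by 0, is closed under differentiation:
  the chain rule contributes t^(-2), which is s^2 in s = 1/t, and the two factors contribute p - p'.
  Iterating gives derivatives of every order.\<close>

lemma expinv_deriv:
  "(expinv p has_real_derivative expinv (monom 1 2 * (p - pderiv p)) t) (at t)"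
proof -
  consider "t > 0" | "t < 0" | "t = 0" by linarith
  then show ?thesis
  proof cases
    case 1
    have "((\<lambda>t. poly p (1 / t) * exp (- (1 / t))) has_real_derivative
        expinv (monom 1 2 * (p - pderiv p)) t) (at t)"
      using 1 by (auto intro!: derivative_eq_intros simp: expinv_def poly_monom power2_eq_square field_simps)
    moreover have "\<forall>\<^sub>F s in nhds t. expinv p s = poly p (1 / s) * exp (- (1 / s))"
      using 1 eventually_nhds_in_open[of "{0<..}" t]
      by (auto elim!: eventually_mono simp: expinv_def)
    ultimately show ?thesis by (subst DERIV_cong_ev[OF refl _ refl])
  next
    case 2
    have "((\<lambda>t. 0) has_real_derivative expinv (monom 1 2 * (p - pderiv p)) t) (at t)"
      using 2 by (auto simp: expinv_def)
    moreover have "\<forall>\<^sub>F s in nhds t. expinv p s = 0"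
      using 2 eventually_nhds_in_open[of "{..<0}" t]
      by (auto elim!: eventually_mono simp: expinv_def)
    ultimately show ?thesis by (subst DERIV_cong_ev[OF refl _ refl])
  next
    case 3
    \<comment> \<open>The difference quotient at 0 again belongs to the class, since division by t
      multiplies the polynomial by s.\<close>
    have "(\<lambda>s. expinv p s / s) = expinv (pCons 0 p)"
      by (auto simp: expinv_def)
    then have "((\<lambda>s. (expinv p s - expinv p 0) / (s - 0)) \<longlongrightarrow> 0) (at 0)"
      using expinv_tendsto_0[of "pCons 0 p"] by (simp add: expinv_def)
    then show ?thesis
      using 3 by (simp add: has_field_derivative_iff expinv_def)
  qed
qed

lemma smooth_on_expinv: "smooth_on (\<lambda>x::'a::euclidean_space. expinv p (a * (x \<bullet> w) + c)) UNIV"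
proof -
  define D where "D = (\<lambda>k. expinv (((\<lambda>p. monom 1 2 * (p - pderiv p)) ^^ k) p))"
  have "(D k has_real_derivative D (Suc k) t) (at t)" for k t
    unfolding D_def by (simp add: expinv_deriv)
  from Ck_on_chain[of D, OF this, of _ 0 a w c] show ?thesis
    by (simp add: smooth_on_def D_def)
qed

text \<open>Each factor is a one-sided profile exp(-1/(n d)), where d is the signed distance to a
  face of the box. Letting n grow flattens it to 1 inside, so these smooth functions approximate the
  indicator of the open box from below.\<close>

definition box_bump :: "'a::euclidean_space \<Rightarrow> 'a \<Rightarrow> nat \<Rightarrow> 'a \<Rightarrow> real" where
  "box_bump a b n x = (\<Prod>w\<in>Basis. expinv 1 (real n * (x \<bullet> w) + - (real n * (a \<bullet> w))) *
     expinv 1 ((- real n) * (x \<bullet> w) + real n * (b \<bullet> w)))"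

lemma expinv_1_bounds: "0 \<le> expinv 1 t" "expinv 1 t \<le> 1"
  by (auto simp: expinv_def)

lemma smooth_on_box_bump: "smooth_on (box_bump a b n) UNIV"
  unfolding box_bump_def[abs_def]
  by (intro smooth_on_prod smooth_on_mult smooth_on_expinv finite_Basis)

lemma box_bump_bounds: "0 \<le> box_bump a b n x" "box_bump a b n x \<le> 1"
  unfolding box_bump_def
  by (auto intro!: prod_nonneg prod_le_1 mult_nonneg_nonneg mult_le_one expinv_1_bounds)

lemma box_bump_eq_0: "x \<notin> box a b \<Longrightarrow> box_bump a b n x = 0"
proof -
  assume "x \<notin> box a b"
  then obtain w where w: "w \<in> Basis" "x \<bullet> w \<le> a \<bullet> w \<or> b \<bullet> w \<le> x \<bullet> w"
    by (auto simp: mem_box not_less)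
  then have "real n * (x \<bullet> w) \<le> real n * (a \<bullet> w) \<or> real n * (b \<bullet> w) \<le> real n * (x \<bullet> w)"
    by (auto intro: mult_left_mono)
  then have "expinv 1 (real n * (x \<bullet> w) + - (real n * (a \<bullet> w))) *
     expinv 1 ((- real n) * (x \<bullet> w) + real n * (b \<bullet> w)) = 0"
    by (auto simp: expinv_def)
  then show ?thesis
    unfolding box_bump_def using w(1) by (intro prod_zero) auto
qed

lemma expinv_1_tendsto:
  assumes "d > 0" shows "(\<lambda>n. expinv 1 (real n * d)) \<longlonglongrightarrow> 1"
proof -
  have "(\<lambda>n. exp (- (inverse (real n) * (1 / d)))) \<longlonglongrightarrow> exp (- (0 * (1 / d)))"
    by (intro tendsto_intros lim_inverse_n)
  then have "(\<lambda>n. exp (- (inverse (real n) * (1 / d)))) \<longlonglongrightarrow> 1" by simp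
  then show ?thesis
    by (rule Lim_transform_eventually)
       (use assms in \<open>auto simp: expinv_def field_simps eventually_sequentially intro!: exI[of _ 1]\<close>)
qed

lemma box_bump_tendsto: "(\<lambda>n. box_bump a b n x) \<longlonglongrightarrow> indicator (box a b) x"
proof (cases "x \<in> box a b")
  case True
  have "(\<lambda>n. \<Prod>w\<in>Basis. expinv 1 (real n * (x \<bullet> w - a \<bullet> w)) * expinv 1 (real n * (b \<bullet> w - x \<bullet> w)))
      \<longlonglongrightarrow> (\<Prod>w\<in>(Basis::'a set). 1 * 1)"
    using True by (intro tendsto_intros expinv_1_tendsto) (auto simp: mem_box)
  then show ?thesis using True by (simp add: box_bump_def algebra_simps)
next
  case False
  then show ?thesis by (simp add: box_bump_eq_0)
qed

section \<open>Test functions and their classical gradients\<close>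

lemma test_functionsI:
  assumes "smooth_on \<psi> UNIV" "compact K" "K \<subseteq> \<Omega>" "\<And>x. x \<notin> K \<Longrightarrow> \<psi> x = 0"
  shows "\<psi> \<in> test_functions \<Omega>"
proof -
  have "closure {x. \<psi> x \<noteq> 0} \<subseteq> K"
    using assms by (intro closure_minimal) (auto intro: compact_imp_closed)
  moreover have "compact (closure {x. \<psi> x \<noteq> 0})"
    using calculation \<open>compact K\<close> by (meson bounded_subset closed_closure compact_eq_bounded_closed)
  ultimately show ?thesis using assms by (auto simp: test_functions_def)
qed

lemma test_functionsE:
  assumes "\<psi> \<in> test_functions \<Omega>"
  obtains K where "compact K" "K \<subseteq> \<Omega>" "\<And>x. x \<notin> K \<Longrightarrow> \<psi> x = 0"
proof
  show "\<psi> x = 0" if "x \<notin> closure {x. \<psi> x \<noteq> 0}" for x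
    using that closure_subset[of "{x. \<psi> x \<noteq> 0}"] by auto
qed (use assms in \<open>auto simp: test_functions_def\<close>)

lemma test_functions_compact_support:
  "\<psi> \<in> test_functions \<Omega> \<Longrightarrow> \<exists>K. compact K \<and> (\<forall>x. x \<notin> K \<longrightarrow> \<psi> x = 0)"
  by (metis test_functionsE)

lemma test_functions_smooth: "\<psi> \<in> test_functions \<Omega> \<Longrightarrow> smooth_on \<psi> UNIV"
  by (simp add: test_functions_def)

lemma test_functions_mono: "\<psi> \<in> test_functions \<Omega> \<Longrightarrow> \<Omega> \<subseteq> \<Omega>' \<Longrightarrow> \<psi> \<in> test_functions \<Omega>'"
  by (auto simp: test_functions_def)

lemma test_functions_lin:
  assumes "\<psi> \<in> test_functions \<Omega>" "\<eta> \<in> test_functions \<Omega>"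
  shows "(\<lambda>x. a * \<psi> x + c * \<eta> x) \<in> test_functions \<Omega>"
proof -
  obtain K where K: "compact K" "K \<subseteq> \<Omega>" "\<And>x. x \<notin> K \<Longrightarrow> \<psi> x = 0" using test_functionsE[OF assms(1)] by blast
  obtain L where L: "compact L" "L \<subseteq> \<Omega>" "\<And>x. x \<notin> L \<Longrightarrow> \<eta> x = 0" using test_functionsE[OF assms(2)] by blast
  show ?thesis
    by (rule test_functionsI[where K="K \<union> L"])
       (use K L assms[THEN test_functions_smooth] in \<open>auto intro!: smooth_on_add smooth_on_mult smooth_on_const\<close>)
qed

lemma test_functions_mult:
  assumes "\<psi> \<in> test_functions \<Omega>" "\<eta> \<in> test_functions \<Omega>'"
  shows "(\<lambda>x. \<psi> x * \<eta> x) \<in> test_functions \<Omega>"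
proof -
  obtain K where K: "compact K" "K \<subseteq> \<Omega>" "\<And>x. x \<notin> K \<Longrightarrow> \<psi> x = 0" using test_functionsE[OF assms(1)] by blast
  show ?thesis
    by (rule test_functionsI[where K="K"])
       (use K assms[THEN test_functions_smooth] in \<open>auto intro!: smooth_on_mult\<close>)
qed

lemma test_functions_box_bump:
  assumes "cbox a b \<subseteq> \<Omega>" shows "box_bump a b n \<in> test_functions \<Omega>"
  by (rule test_functionsI[where K="cbox a b"])
     (use assms in \<open>auto intro!: smooth_on_box_bump box_bump_eq_0 simp: box_subset_cbox[THEN subsetD]\<close>)

text \<open>The classical gradient in the coordinates in which \<open>has_weak_gradient\<close>
  tests. Unlike \<open>wgrad\<close> it is determined at every point, and it is continuous for
  smooth arguments.\<close>

definition cgrad :: "(real^3 \<Rightarrow> real) \<Rightarrow> real^3 \<Rightarrow> real^3" where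
  "cgrad \<psi> x = (\<chi> i. frechet_derivative \<psi> (at x) (axis i 1))"

lemma cgrad_nth [simp]: "cgrad \<psi> x $ i = frechet_derivative \<psi> (at x) (axis i 1)"
  by (simp add: cgrad_def)

lemma axis_1_Basis: "axis i (1::real) \<in> Basis"
  by (auto simp: Basis_vec_def)

lemma frechet_derivative_cgrad:
  assumes "smooth_on \<psi> UNIV"
  shows "frechet_derivative \<psi> (at x) v = cgrad \<psi> x \<bullet> v"
proof -
  let ?D = "frechet_derivative \<psi> (at x)"
  have "linear ?D"
    using smooth_on_has_derivative[OF assms] has_derivative_linear by blast
  then have "?D (\<Sum>i\<in>UNIV. (v $ i) *\<^sub>R axis i 1) = (\<Sum>i\<in>UNIV. (v $ i) *\<^sub>R ?D (axis i 1))"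
    by (simp add: linear_sum linear_scale)
  moreover have "(\<Sum>i\<in>UNIV. (v $ i) *\<^sub>R axis i 1) = v"
    using basis_expansion[of v] by (simp add: scalar_mult_eq_scaleR)
  ultimately show ?thesis by (simp add: inner_vec_def mult.commute)
qed

lemma cgrad_has_derivative:
  assumes "smooth_on \<psi> UNIV"
  shows "(\<psi> has_derivative (\<lambda>v. cgrad \<psi> x \<bullet> v)) (at x)"
proof -
  have "frechet_derivative \<psi> (at x) = (\<lambda>v. cgrad \<psi> x \<bullet> v)"
    by (rule ext) (rule frechet_derivative_cgrad[OF assms])
  then show ?thesis using smooth_on_has_derivative[OF assms, of x] by (simp only:)
qed

lemma cgrad_eqI:
  assumes "(\<psi> has_derivative (\<lambda>v. g \<bullet> v)) (at x)" shows "cgrad \<psi> x = g"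
  using frechet_derivative_at[OF assms, symmetric] by (simp add: vec_eq_iff inner_axis)

lemma cgrad_lin:
  assumes "smooth_on \<psi> UNIV" "smooth_on \<eta> UNIV"
  shows "cgrad (\<lambda>x. a * \<psi> x + c * \<eta> x) x = a *\<^sub>R cgrad \<psi> x + c *\<^sub>R cgrad \<eta> x"
  by (rule cgrad_eqI)
     (auto intro!: derivative_eq_intros cgrad_has_derivative assms simp: inner_simps)

lemma cgrad_mult:
  assumes "smooth_on \<psi> UNIV" "smooth_on \<eta> UNIV"
  shows "cgrad (\<lambda>x. \<psi> x * \<eta> x) x = \<psi> x *\<^sub>R cgrad \<eta> x + \<eta> x *\<^sub>R cgrad \<psi> x"
  by (rule cgrad_eqI)
     (auto intro!: derivative_eq_intros cgrad_has_derivative assms simp: inner_simps)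

lemma continuous_on_cgrad: "smooth_on \<psi> UNIV \<Longrightarrow> continuous_on UNIV (cgrad \<psi>)"
  unfolding cgrad_def[abs_def]
  by (intro continuous_on_vec_lambda smooth_on_continuous smooth_on_partial axis_1_Basis)

lemma cgrad_eq_0:
  assumes "compact K" "\<And>x. x \<notin> K \<Longrightarrow> \<psi> x = 0" "x \<notin> K" shows "cgrad \<psi> x = 0"
proof (rule cgrad_eqI)
  have "((\<lambda>_. 0) has_derivative (\<lambda>v. 0 \<bullet> v)) (at x)" by simp
  then show "(\<psi> has_derivative (\<lambda>v. 0 \<bullet> v)) (at x)"
    by (rule has_derivative_transform_within_open[OF _ open_Compl[OF compact_imp_closed[OF assms(1)]]])
       (use assms in \<open>auto simp: compact_imp_closed open_Compl\<close>)
qed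

lemma test_functions_partial:
  assumes "\<psi> \<in> test_functions \<Omega>"
  shows "(\<lambda>x. cgrad \<psi> x $ i) \<in> test_functions \<Omega>"
proof -
  obtain K where K: "compact K" "K \<subseteq> \<Omega>" "\<And>x. x \<notin> K \<Longrightarrow> \<psi> x = 0" using test_functionsE[OF assms] by blast
  show ?thesis
  proof (rule test_functionsI[where K=K])
    show "smooth_on (\<lambda>x. cgrad \<psi> x $ i) UNIV"
      using smooth_on_partial[OF test_functions_smooth[OF assms] axis_1_Basis[of i]] by simp
    show "cgrad \<psi> x $ i = 0" if "x \<notin> K" for x
    proof -
      have "cgrad \<psi> x = 0" by (rule cgrad_eq_0[of K]) (use K that in auto)
      then show ?thesis by (simp only: zero_index)
    qed
  qed (use K in auto)
qed

section \<open>Integrals and translations of test functions\<close>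

lemma integrable_compact_support:
  fixes f :: "'a::euclidean_space \<Rightarrow> 'b::euclidean_space"
  assumes f: "continuous_on UNIV f" and K: "compact K" "\<And>x. x \<notin> K \<Longrightarrow> f x = 0"
  shows "integrable lborel f"
proof -
  have "integrable lborel (\<lambda>x. indicator K x *\<^sub>R f x)"
    by (rule borel_integrable_compact) (use f K in \<open>auto intro: continuous_on_subset\<close>)
  moreover have "(\<lambda>x. indicator K x *\<^sub>R f x) = f" using K by (auto simp: indicator_def)
  ultimately show ?thesis by simp
qed

text \<open>Moves an integral from the restricted, completed measure of the statement to
  \<open>lborel\<close>, where translation invariance and Fubini's theorem apply.\<close>

lemma lebesgue_on_eq_lborel:
  fixes f :: "'a::euclidean_space \<Rightarrow> 'b::euclidean_space"
  assumes f: "f \<in> borel_measurable borel" and S: "S \<in> sets lebesgue" "\<And>x. x \<notin> S \<Longrightarrow> f x = 0"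
  shows "integral\<^sup>L (lebesgue_on S) f = integral\<^sup>L lborel f"
    and "integrable (lebesgue_on S) f \<longleftrightarrow> integrable lborel f"
proof -
  have e: "(\<lambda>x. indicator S x *\<^sub>R f x) = f" using S by (auto simp: indicator_def)
  show "integral\<^sup>L (lebesgue_on S) f = integral\<^sup>L lborel f"
    using S f by (subst integral_restrict_space) (auto simp: e integral_completion)
  show "integrable (lebesgue_on S) f \<longleftrightarrow> integrable lborel f"
    using S f by (subst integrable_restrict_space) (auto simp: e integrable_completion)
qed

lemma lborel_integral_translate:
  fixes f :: "'a::euclidean_space \<Rightarrow> 'b::euclidean_space"
  assumes "f \<in> borel_measurable borel"
  shows "(LINT x|lborel. f (x + c)) = (LINT x|lborel. f x)"
proof -
  have "(LINT x|lborel. f x) = (LINT x|distr lborel borel ((+) c). f x)"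
    by (simp add: lborel_distr_plus)
  also have "\<dots> = (LINT x|lborel. f (c + x))"
    using assms by (subst integral_distr) auto
  finally show ?thesis by (simp add: add.commute)
qed

lemma test_functions_difference_bound:
  assumes \<psi>: "\<psi> \<in> test_functions UNIV"
  obtains B where "B \<ge> 0" "\<And>x y. \<bar>\<psi> x - \<psi> y\<bar> \<le> B * norm (x - y)"
proof -
  obtain K where K: "compact K" "\<And>x. x \<notin> K \<Longrightarrow> \<psi> x = 0"
    using test_functions_compact_support[OF \<psi>] by blast
  note s = test_functions_smooth[OF \<psi>]
  have "compact (cgrad \<psi> ` K)"
    using K continuous_on_cgrad[OF s] by (intro compact_continuous_image) (auto intro: continuous_on_subset)
  then obtain B where B: "B > 0" "\<And>x. x \<in> K \<Longrightarrow> norm (cgrad \<psi> x) \<le> B"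
    by (metis bounded_pos compact_imp_bounded imageI)
  have B': "norm (cgrad \<psi> x) \<le> B" for x
    using B K cgrad_eq_0[of K \<psi> x] by (cases "x \<in> K") auto
  have "norm (\<psi> x - \<psi> y) \<le> B * norm (x - y)" for x y
  proof (rule differentiable_bound[of UNIV \<psi> "\<lambda>x v. cgrad \<psi> x \<bullet> v"])
    show "(\<psi> has_derivative (\<lambda>v. cgrad \<psi> x \<bullet> v)) (at x within UNIV)" for x
      using cgrad_has_derivative[OF s] by simp
    show "onorm (\<lambda>v. cgrad \<psi> x \<bullet> v) \<le> B" for x
      using B B'[of x] by (intro onorm_bound)
        (auto intro!: order.trans[OF Cauchy_Schwarz_ineq2] mult_right_mono)
  qed auto
  then show ?thesis using that[of B] B(1) by auto
qed

text \<open>Dominated convergence. The shifts have length at most |v|, so all quotients vanish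
  outside one ball \<open>L\<close>, and the Lipschitz constant of \<open>\<psi>\<close> bounds them
  uniformly.\<close>

lemma difference_quotient:
  fixes v :: "real^3"
  assumes \<psi>: "\<psi> \<in> test_functions UNIV"
  defines "q \<equiv> \<lambda>n x. real (Suc n) * (\<psi> (x + (1 / real (Suc n)) *\<^sub>R v) - \<psi> x)"
  shows "(\<lambda>n. LINT x|lborel. q n x) \<longlonglongrightarrow> (LINT x|lborel. cgrad \<psi> x \<bullet> v)"
    and "(\<lambda>n. LINT x|lborel. (q n x)\<^sup>2) \<longlonglongrightarrow> (LINT x|lborel. (cgrad \<psi> x \<bullet> v)\<^sup>2)"
    and "\<And>n. integrable lborel (q n)"
    and "\<And>n. integrable lborel (\<lambda>x. (q n x)\<^sup>2)"
proof -
  obtain K where K: "compact K" "\<And>x. x \<notin> K \<Longrightarrow> \<psi> x = 0"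
    using test_functions_compact_support[OF \<psi>] by blast
  note s = test_functions_smooth[OF \<psi>]
  obtain B where B: "B \<ge> 0" "\<And>x y. \<bar>\<psi> x - \<psi> y\<bar> \<le> B * norm (x - y)"
    using test_functions_difference_bound[OF \<psi>] by blast
  obtain R where R: "\<And>x. x \<in> K \<Longrightarrow> norm x \<le> R"
    using K by (meson bounded_iff compact_imp_bounded)
  define L where "L = cball (0::real^3) (R + norm v)"
  have L: "compact L" by (simp add: L_def)
  have psiL: "\<psi> (x + c *\<^sub>R v) = 0" if "x \<notin> L" "0 \<le> c" "c \<le> 1" for x c
  proof (rule K)
    show "x + c *\<^sub>R v \<notin> K"
    proof
      assume "x + c *\<^sub>R v \<in> K"
      then have "norm (x + c *\<^sub>R v) \<le> R" by (rule R)
      moreover have "norm x \<le> norm (x + c *\<^sub>R v) + norm (c *\<^sub>R v)"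
        using norm_triangle_sub[of x "x + c *\<^sub>R v"] by simp
      moreover have "norm (c *\<^sub>R v) \<le> norm v"
        using that mult_right_mono[of c 1 "norm v"] by simp
      ultimately show False using that by (simp add: L_def)
    qed
  qed
  have q0: "q n x = 0" if "x \<notin> L" for n x
    using psiL[OF that, of "1 / real (Suc n)"] psiL[OF that, of 0] by (simp add: q_def)
  have qb: "\<bar>q n x\<bar> \<le> B * norm v" for n x
  proof -
    have "\<bar>q n x\<bar> = real (Suc n) * \<bar>\<psi> (x + (1 / real (Suc n)) *\<^sub>R v) - \<psi> x\<bar>"
      by (simp add: q_def abs_mult del: of_nat_Suc)
    also have "\<dots> \<le> real (Suc n) * (B * norm ((x + (1 / real (Suc n)) *\<^sub>R v) - x))"
      by (intro mult_left_mono B) auto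
    also have "\<dots> = B * norm v" by (simp add: field_simps del: of_nat_Suc)
    finally show ?thesis .
  qed
  have cont: "continuous_on UNIV (q n)" for n
    unfolding q_def
    by (intro continuous_intros continuous_on_compose2[OF smooth_on_continuous[OF s]]) auto
  then have [measurable]: "q n \<in> borel_measurable borel" for n
    by (simp add: borel_measurable_continuous_onI)
  have [measurable]: "cgrad \<psi> \<in> borel_measurable borel"
    by (rule borel_measurable_continuous_onI[OF continuous_on_cgrad[OF s]])
  show int: "integrable lborel (q n)" for n
    by (rule integrable_compact_support[OF cont L q0])
  show int2: "integrable lborel (\<lambda>x. (q n x)\<^sup>2)" for n
    by (rule integrable_compact_support[OF _ L]) (auto intro!: continuous_intros cont simp: q0)
  have lim: "(\<lambda>n. q n x) \<longlonglongrightarrow> cgrad \<psi> x \<bullet> v" for x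
  proof -
    have d: "((\<lambda>t. \<psi> (x + t *\<^sub>R v)) has_real_derivative cgrad \<psi> x \<bullet> v) (at 0)"
    proof -
      have a: "((\<lambda>t. x + t *\<^sub>R v) has_derivative (\<lambda>t. t *\<^sub>R v)) (at 0)"
        by (auto intro!: derivative_eq_intros)
      have b: "(\<psi> has_derivative (\<lambda>v. cgrad \<psi> x \<bullet> v)) (at (x + 0 *\<^sub>R v))"
        using cgrad_has_derivative[OF s, of x] by simp
      show ?thesis
        unfolding has_field_derivative_def
        using has_derivative_compose[OF a b] by (rule has_derivative_eq_rhs) (auto simp: mult.commute)
    qed
    then have "((\<lambda>t. (\<psi> (x + t *\<^sub>R v) - \<psi> x) / t) \<longlongrightarrow> cgrad \<psi> x \<bullet> v) (at 0)"
      by (simp add: has_field_derivative_iff)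
    moreover have "filterlim (\<lambda>n. 1 / real (Suc n)) (at 0) sequentially"
      unfolding filterlim_at using LIMSEQ_inverse_real_of_nat by (simp add: inverse_eq_divide del: of_nat_Suc)
    ultimately have "(\<lambda>n. (\<psi> (x + (1 / real (Suc n)) *\<^sub>R v) - \<psi> x) / (1 / real (Suc n))) \<longlonglongrightarrow> cgrad \<psi> x \<bullet> v"
      by (rule filterlim_compose)
    then show ?thesis by (simp add: q_def mult.commute)
  qed
  have intL: "integrable lborel (\<lambda>x. c * indicator L x)" for c :: real
    using L by (intro integrable_mult_right integrable_real_indicator)
      (use emeasure_lborel_cball_finite[of "0::real^3" "R + norm v"] in \<open>auto simp: L_def\<close>)
  show "(\<lambda>n. LINT x|lborel. q n x) \<longlonglongrightarrow> (LINT x|lborel. cgrad \<psi> x \<bullet> v)"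
  proof (rule integral_dominated_convergence[where w="\<lambda>x. (B * norm v) * indicator L x"])
    show "AE x in lborel. norm (q n x) \<le> (B * norm v) * indicator L x" for n
      using qb q0 by (auto simp: indicator_def)
  qed (use lim intL in auto)
  show "(\<lambda>n. LINT x|lborel. (q n x)\<^sup>2) \<longlonglongrightarrow> (LINT x|lborel. (cgrad \<psi> x \<bullet> v)\<^sup>2)"
  proof (rule integral_dominated_convergence[where w="\<lambda>x. (B * norm v)\<^sup>2 * indicator L x"])
    show "AE x in lborel. norm ((q n x)\<^sup>2) \<le> (B * norm v)\<^sup>2 * indicator L x" for n
      using power_mono[OF qb abs_ge_zero, of _ _ 2] q0 by (auto simp: indicator_def)
  qed (use lim intL in \<open>auto intro!: tendsto_intros\<close>)
qed

lemma test_functions_integrable: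
  assumes "\<psi> \<in> test_functions \<Omega>" shows "integrable lborel \<psi>"
  using test_functionsE[OF assms] integrable_compact_support smooth_on_continuous test_functions_smooth[OF assms]
  by metis

text \<open>By translation invariance every difference quotient has integral 0. This takes the place
  of the divergence theorem and is the source of integration by parts.\<close>

lemma integral_cgrad_eq_0:
  assumes \<psi>: "\<psi> \<in> test_functions UNIV"
  shows "(LINT x|lborel. cgrad \<psi> x \<bullet> v) = 0"
proof -
  have [measurable]: "\<psi> \<in> borel_measurable borel"
    by (rule borel_measurable_continuous_onI[OF smooth_on_continuous[OF test_functions_smooth[OF \<psi>]]])
  have int: "integrable lborel (\<lambda>x. \<psi> (x + c))" for c
  proof -
    have "integrable (distr lborel borel ((+) c)) \<psi>"
      using test_functions_integrable[OF \<psi>] by (simp add: lborel_distr_plus)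
    then show ?thesis by (subst (asm) integrable_distr_eq) (auto simp: add.commute)
  qed
  have "(LINT x|lborel. real (Suc n) * (\<psi> (x + (1 / real (Suc n)) *\<^sub>R v) - \<psi> x)) = 0" for n
    using int[of 0] int[of "(1 / real (Suc n)) *\<^sub>R v"]
    by (simp add: lborel_integral_translate del: of_nat_Suc)
  then show ?thesis
    using difference_quotient(1)[OF \<psi>, of v] by (simp add: LIMSEQ_const_iff del: of_nat_Suc)
qed

lemma test_functions_by_parts:
  assumes \<psi>: "\<psi> \<in> test_functions \<Omega>" and \<eta>: "\<eta> \<in> test_functions UNIV"
  shows "(LINT x|lborel. \<eta> x * cgrad \<psi> x $ i) = - (LINT x|lborel. cgrad \<eta> x $ i * \<psi> x)"
proof -
  note s = test_functions_smooth[OF \<psi>] test_functions_smooth[OF \<eta>]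
  have \<psi>': "\<psi> \<in> test_functions UNIV" using \<psi> test_functions_mono by blast
  have "(LINT x|lborel. cgrad (\<lambda>x. \<psi> x * \<eta> x) x \<bullet> axis i 1) = 0"
    by (rule integral_cgrad_eq_0[OF test_functions_mult[OF \<psi>' \<eta>]])
  moreover have "cgrad (\<lambda>x. \<psi> x * \<eta> x) x \<bullet> axis i 1 = cgrad \<eta> x $ i * \<psi> x + \<eta> x * cgrad \<psi> x $ i" for x
    unfolding cgrad_mult[OF s] by (simp add: inner_simps inner_axis mult.commute)
  moreover have "integrable lborel (\<lambda>x. cgrad \<eta> x $ i * \<psi> x)" "integrable lborel (\<lambda>x. \<eta> x * cgrad \<psi> x $ i)"
    by (rule test_functions_integrable test_functions_mult test_functions_partial \<psi>' \<eta>)+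
  ultimately show ?thesis by simp
qed

text \<open>Telescoping over \<open>n\<close> equal steps reduces the estimate to difference quotients, so that no
  integration along segments is needed.\<close>

lemma integral_translation_le:
  assumes \<psi>: "\<psi> \<in> test_functions UNIV"
  shows "(LINT x|lborel. (\<psi> (x + z) - \<psi> x)\<^sup>2) \<le> (LINT x|lborel. (cgrad \<psi> x \<bullet> z)\<^sup>2)"
proof -
  have [measurable]: "\<psi> \<in> borel_measurable borel"
    by (rule borel_measurable_continuous_onI[OF smooth_on_continuous[OF test_functions_smooth[OF \<psi>]]])
  define q where "q = (\<lambda>n x. real (Suc n) * (\<psi> (x + (1 / real (Suc n)) *\<^sub>R z) - \<psi> x))"
  have "(LINT x|lborel. (\<psi> (x + z) - \<psi> x)\<^sup>2) \<le> (LINT x|lborel. (q n x)\<^sup>2)" for n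
  proof -
    define N where "N = Suc n"
    define \<delta> where "\<delta> = 1 / real N"
    define d where "d = (\<lambda>x. (\<psi> (x + \<delta> *\<^sub>R z) - \<psi> x)\<^sup>2)"
    have [measurable]: "d \<in> borel_measurable borel" unfolding d_def by measurable
    have N: "real N > 0" "real N * \<delta> = 1" by (auto simp: N_def \<delta>_def)
    have qd: "(q n x)\<^sup>2 = (real N)\<^sup>2 * d x" for x
      by (simp add: q_def d_def N_def \<delta>_def power_mult_distrib)
    have "integrable lborel (\<lambda>x. (real N)\<^sup>2 * d x)"
      using difference_quotient(4)[OF \<psi>, of n z] unfolding qd[symmetric] q_def .
    then have id: "integrable lborel d" using N by simp
    have idt: "integrable lborel (\<lambda>x. d (x + c))" for c
    proof -
      have "integrable (distr lborel borel ((+) c)) d" using id by (simp add: lborel_distr_plus)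
      then show ?thesis by (subst (asm) integrable_distr_eq) (auto simp: add.commute)
    qed
    have "(\<psi> (x + z) - \<psi> x)\<^sup>2 \<le> real N * (\<Sum>i<N. d (x + (real i * \<delta>) *\<^sub>R z))" for x
    proof -
      define a where "a = (\<lambda>i. \<psi> (x + (real i * \<delta>) *\<^sub>R z))"
      have "\<psi> (x + z) - \<psi> x = a N - a 0" using N by (simp add: a_def)
      also have "\<dots> = (\<Sum>i<N. (a (Suc i) - a i) * 1)" by (simp add: sum_lessThan_telescope)
      \<comment> \<open>Cauchy--Schwarz against the constant 1 costs a factor N; the sum over the
        translates gives another N after integration, and together they make up the square of the
        quotient \<open>q n\<close>.\<close>
      finally have "(\<psi> (x + z) - \<psi> x)\<^sup>2 \<le> (\<Sum>i<N. (a (Suc i) - a i)\<^sup>2) * (\<Sum>i<N. 1\<^sup>2)"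
        using Cauchy_Schwarz_ineq_sum[of "\<lambda>i. a (Suc i) - a i" "\<lambda>_. 1" "{..<N}"] by simp
      moreover have "(a (Suc i) - a i)\<^sup>2 = d (x + (real i * \<delta>) *\<^sub>R z)" for i
        by (simp add: a_def d_def algebra_simps)
      ultimately show ?thesis by (simp add: mult.commute)
    qed
    then have "(LINT x|lborel. (\<psi> (x + z) - \<psi> x)\<^sup>2) \<le> (LINT x|lborel. real N * (\<Sum>i<N. d (x + (real i * \<delta>) *\<^sub>R z)))"
      by (intro integral_mono' Bochner_Integration.integrable_sum integrable_mult_right idt)
         (auto intro!: mult_nonneg_nonneg sum_nonneg simp: d_def)
    also have "\<dots> = real N * (\<Sum>i<N. LINT x|lborel. d x)"
      by (simp add: Bochner_Integration.integral_sum idt lborel_integral_translate)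
    also have "\<dots> = (LINT x|lborel. (q n x)\<^sup>2)"
      unfolding qd by (simp add: power2_eq_square)
    finally show ?thesis .
  qed
  then show ?thesis
    using difference_quotient(2)[OF \<psi>, of z] unfolding q_def by (intro LIMSEQ_le_const) auto
qed

section \<open>Uniqueness of weak gradients\<close>

lemma sigma_finite_lebesgue: "sigma_finite_measure (lebesgue :: 'a::euclidean_space measure)"
proof
  obtain A :: "'a set set" where "countable A" "A \<subseteq> sets lborel" "\<Union>A = space lborel"
      "\<forall>a\<in>A. emeasure lborel a \<noteq> \<infinity>"
    using lborel.sigma_finite_countable by blast
  then show "\<exists>A. countable A \<and> A \<subseteq> sets (lebesgue :: 'a measure) \<and> \<Union>A = space lebesgue \<and>
      (\<forall>a\<in>A. emeasure lebesgue a \<noteq> \<infinity>)"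
    by (intro exI[of _ A]) (auto simp: subset_eq)
qed

text \<open>Boxes are stable under intersection and generate the Borel sets, so vanishing integrals
  spread from boxes to Borel sets, and to Lebesgue sets up to a null set. Support in one box makes
  the total integral vanish, which the complement step needs.\<close>

lemma AE_zero_of_boxes:
  fixes f :: "'a::euclidean_space \<Rightarrow> real"
  assumes f: "integrable lebesgue f" and supp: "\<And>x. x \<notin> box a b \<Longrightarrow> f x = 0"
    and boxes: "\<And>c d. (LINT x:box c d|lebesgue. f x) = 0"
  shows "AE x in lebesgue. f x = 0"
proof (rule sigma_finite_measure.density_zero[OF sigma_finite_lebesgue f])
  have si: "set_integrable lebesgue A f" if "A \<in> sets lebesgue" for A
    unfolding set_integrable_def using that f by (rule integrable_mult_indicator)
  have borel: "(LINT x:A|lebesgue. f x) = 0" if A: "A \<in> sets borel" for A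
  proof -
    have "Int_stable (range (\<lambda>(a, b). box a b :: 'a set))"
      by (auto simp: Int_stable_def box_Int_box)
    moreover have "range (\<lambda>(a, b). box a b :: 'a set) \<subseteq> Pow UNIV" by auto
    moreover have "A \<in> sigma_sets UNIV (range (\<lambda>(a, b). box a b))"
      using A unfolding borel_eq_box by simp
    ultimately show ?thesis
    proof (induction rule: sigma_sets_induct_disjoint)
      case (basic A) then show ?case using boxes by auto
    next
      case empty show ?case by (simp add: set_lebesgue_integral_def)
    next
      case (compl A)
      then have A: "A \<in> sets lebesgue" by (simp add: borel_eq_box)
      have "(LINT x:UNIV|lebesgue. f x) = (LINT x:box a b|lebesgue. f x)"
        unfolding set_lebesgue_integral_def
        by (rule Bochner_Integration.integral_cong) (auto simp: indicator_def supp)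
      then have "(LINT x:UNIV|lebesgue. f x) = 0" by (simp add: boxes)
      moreover have "(LINT x:UNIV - A|lebesgue. f x) = (LINT x:UNIV|lebesgue. f x) - (LINT x:A|lebesgue. f x)"
        using set_integral_Un[of A "UNIV - A" lebesgue f] si[OF A] si[of "UNIV - A"] sets.compl_sets[OF A]
        by simp
      ultimately show ?case using compl by simp
    next
      case (union A)
      have A: "A i \<in> sets lebesgue" for i
      proof -
        have "A i \<in> sigma_sets UNIV (range (\<lambda>(a, b). box a b))" using union(2) by blast
        then show ?thesis by (simp add: borel_eq_box)
      qed
      have "(LINT x:(\<Union>i. A i)|lebesgue. f x) = (\<Sum>i. LINT x:A i|lebesgue. f x)"
        by (rule lebesgue_integral_countable_add)
           (use A union(1) si in \<open>auto simp: disjoint_family_on_def\<close>)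
      then show ?case using union by simp
    qed
  qed
  fix A :: "'a set" assume "A \<in> sets lebesgue"
  then obtain B N where B: "B \<in> sets borel" "negligible N" "B \<union> N = A"
    by (rule sets_lebesgue_almost_borel)
  then have "AE x in lebesgue. x \<notin> N"
    by (simp add: negligible_iff_null_sets AE_not_in)
  then have "(LINT x:A|lebesgue. f x) = (LINT x:B|lebesgue. f x)"
    unfolding set_lebesgue_integral_def
  proof (intro integral_cong_AE)
    show "AE x in lebesgue. indicator A x *\<^sub>R f x = indicator B x *\<^sub>R f x"
      if "AE x in lebesgue. x \<notin> N"
      using that by eventually_elim (use B(3) in \<open>auto simp: indicator_def\<close>)
  qed (use si[of A] si[of B] B(1) \<open>A \<in> sets lebesgue\<close> in
      \<open>auto simp: set_integrable_def simp del: real_scaleR_def intro!: borel_measurable_integrable\<close>)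
  then show "(LINT x:A|lebesgue. f x) = 0" using borel[OF B(1)] by simp
qed

lemma integrable_lebesgue_on_mult_test:
  fixes g :: "real^3 \<Rightarrow> 'b::euclidean_space"
  assumes \<Omega>: "\<Omega> \<in> sets lebesgue" and g: "\<And>K. compact K \<Longrightarrow> K \<subseteq> \<Omega> \<Longrightarrow> integrable (lebesgue_on K) g"
    and \<psi>: "continuous_on UNIV \<psi>" "compact K" "K \<subseteq> \<Omega>" "\<And>x. x \<notin> K \<Longrightarrow> \<psi> x = 0"
  shows "integrable (lebesgue_on \<Omega>) (\<lambda>x. \<psi> x *\<^sub>R g x)"
proof -
  have Ks: "K \<in> sets lebesgue" using \<psi>(2) by (simp add: lmeasurable_compact fmeasurableD)
  have "compact (\<psi> ` K)" using \<psi> by (intro compact_continuous_image) (auto intro: continuous_on_subset)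
  then obtain B where B: "\<And>x. x \<in> K \<Longrightarrow> norm (\<psi> x) \<le> B"
    by (meson bounded_iff compact_imp_bounded imageI)
  \<comment> \<open>An upper bound for norms over \<open>K\<close> is known to be nonnegative only
    if \<open>K\<close> has a point.\<close>
  have "B \<ge> 0 \<or> K = {}" using B norm_ge_zero order_trans by blast
  have "\<psi> \<in> borel_measurable borel" using \<psi>(1) by (rule borel_measurable_continuous_onI)
  then have m: "\<psi> \<in> borel_measurable (lebesgue_on S)" for S
    by (simp add: measurable_completion measurable_restrict_space1)
  have gK: "integrable (lebesgue_on K) g" using g \<psi> by blast
  then have "integrable (lebesgue_on K) (\<lambda>x. B *\<^sub>R g x)" by simp
  then have "integrable (lebesgue_on K) (\<lambda>x. \<psi> x *\<^sub>R g x)"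
    by (rule Bochner_Integration.integrable_bound)
       (use m gK \<open>B \<ge> 0 \<or> K = {}\<close> B in \<open>auto intro!: AE_I2 mult_right_mono borel_measurable_scaleR\<close>)
  then have "integrable lebesgue (\<lambda>x. indicator K x *\<^sub>R \<psi> x *\<^sub>R g x)"
    using Ks by (simp add: integrable_restrict_space)
  also have "(\<lambda>x. indicator K x *\<^sub>R \<psi> x *\<^sub>R g x) = (\<lambda>x. indicator \<Omega> x *\<^sub>R \<psi> x *\<^sub>R g x)"
    using \<psi>(3,4) by (auto simp: indicator_def fun_eq_iff)
  finally show ?thesis using \<Omega> by (simp add: integrable_restrict_space)
qed

text \<open>A product of two box bumps is an admissible test function and tends to the indicator of
  the intersection of the two boxes, so the integral of g over every such intersection is 0. This
  settles each closed box inside the domain, and countably many of them exhaust it.\<close>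

lemma fundamental_lemma:
  fixes g :: "real^3 \<Rightarrow> real"
  assumes \<Omega>: "open \<Omega>" and g: "\<And>K. compact K \<Longrightarrow> K \<subseteq> \<Omega> \<Longrightarrow> integrable (lebesgue_on K) g"
    and zero: "\<And>\<psi>. \<psi> \<in> test_functions \<Omega> \<Longrightarrow> (LINT x|lebesgue_on \<Omega>. g x * \<psi> x) = 0"
  shows "AE x in lebesgue_on \<Omega>. g x = 0"
proof -
  have \<Omega>s: "\<Omega> \<in> sets lebesgue" using \<Omega> by auto
  have box0: "AE x in lebesgue. x \<in> cbox a b \<longrightarrow> g x = 0" if ab: "cbox a b \<subseteq> \<Omega>" for a b
  proof -
    define h where "h = (\<lambda>x. indicator (cbox a b) x * g x)"
    define f where "f = (\<lambda>x. indicator (box a b) x * g x)"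
    have "integrable (lebesgue_on (cbox a b)) g" using g ab by auto
    then have h: "integrable lebesgue h" unfolding h_def by (simp add: integrable_restrict_space)
    have "integrable lebesgue (\<lambda>x. indicator (box a b) x *\<^sub>R h x)"
      using h by (intro integrable_mult_indicator) auto
    also have "(\<lambda>x. indicator (box a b) x *\<^sub>R h x) = f"
      using box_subset_cbox[of a b] by (auto simp: f_def h_def indicator_def fun_eq_iff)
    finally have f: "integrable lebesgue f" .
    have "AE x in lebesgue. f x = 0"
    proof (rule AE_zero_of_boxes[OF f, of a b])
      show "f x = 0" if "x \<notin> box a b" for x using that by (simp add: f_def)
      fix c d :: "real^3"
      \<comment> \<open>The first factor keeps the support inside the domain; the second one may use
        an arbitrary box.\<close>
      define \<psi> where "\<psi> = (\<lambda>n x. box_bump a b n x * box_bump c d n x)"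
      have \<psi>: "\<psi> n \<in> test_functions \<Omega>" for n
        unfolding \<psi>_def
        by (rule test_functions_mult[OF test_functions_box_bump[OF ab] test_functions_box_bump[of c d UNIV]]) simp
      have b: "\<bar>\<psi> n x\<bar> \<le> 1" for n x
        unfolding \<psi>_def abs_mult using box_bump_bounds[of a b n x] box_bump_bounds[of c d n x]
        by (auto intro: mult_le_one)
      have m[measurable]: "\<psi> n \<in> borel_measurable lebesgue" for n
        using borel_measurable_continuous_onI[OF smooth_on_continuous[OF test_functions_smooth[OF \<psi>]]]
        by (simp add: measurable_completion)
      have z: "(LINT x|lebesgue. h x * \<psi> n x) = 0" for n
      proof -
        have "(LINT x|lebesgue_on \<Omega>. g x * \<psi> n x) = (LINT x|lebesgue. indicator \<Omega> x *\<^sub>R (g x * \<psi> n x))"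
          using \<Omega>s by (simp add: integral_restrict_space)
        also have "\<dots> = (LINT x|lebesgue. h x * \<psi> n x)"
        proof (rule Bochner_Integration.integral_cong[OF refl])
          fix x
          show "indicator \<Omega> x *\<^sub>R (g x * \<psi> n x) = h x * \<psi> n x"
            using ab box_subset_cbox[of a b]
            by (cases "x \<in> box a b") (auto simp: h_def indicator_def \<psi>_def box_bump_eq_0)
        qed
        finally show ?thesis using zero[OF \<psi>] by simp
      qed
      have [measurable]: "h \<in> borel_measurable lebesgue" "f \<in> borel_measurable lebesgue" using h f by auto
      have "(\<lambda>n. LINT x|lebesgue. h x * \<psi> n x) \<longlonglongrightarrow> (LINT x|lebesgue. indicator (box c d) x *\<^sub>R f x)"
      proof (rule integral_dominated_convergence[where w="\<lambda>x. norm (h x)"])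
        show "AE x in lebesgue. (\<lambda>n. h x * \<psi> n x) \<longlonglongrightarrow> indicator (box c d) x *\<^sub>R f x"
        proof (rule AE_I2)
          fix x
          have "(\<lambda>n. h x * \<psi> n x) \<longlonglongrightarrow> h x * (indicator (box a b) x * indicator (box c d) x)"
            unfolding \<psi>_def by (intro tendsto_intros box_bump_tendsto)
          also have "h x * (indicator (box a b) x * indicator (box c d) x) = indicator (box c d) x *\<^sub>R f x"
            using box_subset_cbox[of a b] by (auto simp: h_def f_def indicator_def)
          finally show "(\<lambda>n. h x * \<psi> n x) \<longlonglongrightarrow> indicator (box c d) x *\<^sub>R f x" .
        qed
        show "AE x in lebesgue. norm (h x * \<psi> n x) \<le> norm (h x)" for n
          using b by (auto simp: abs_mult intro!: mult_left_le)
        show "integrable lebesgue (\<lambda>x. norm (h x))" using h by simp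
        show "(\<lambda>x. indicator (box c d) x *\<^sub>R f x) \<in> borel_measurable lebesgue"
          by (intro borel_measurable_scaleR borel_measurable_indicator) auto
      qed auto
      then show "(LINT x:box c d|lebesgue. f x) = 0"
        by (simp add: z LIMSEQ_const_iff set_lebesgue_integral_def)
    qed
    \<comment> \<open>The bumps say nothing on the faces of the box, which form a null set.\<close>
    moreover have "AE x in lebesgue. x \<notin> cbox a b - box a b"
      using negligible_frontier_interval[of a b] by (intro AE_not_in) (simp add: negligible_iff_null_sets)
    ultimately show ?thesis by eventually_elim (auto simp: f_def)
  qed
  obtain \<D> where \<D>: "countable \<D>" "\<D> \<subseteq> Pow \<Omega>" "\<And>X. X \<in> \<D> \<Longrightarrow> \<exists>a b. X = cbox a b" "\<Union>\<D> = \<Omega>"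
    using open_countable_Union_open_cbox[OF \<Omega>] by blast
  have "AE x in lebesgue. \<forall>X\<in>\<D>. x \<in> X \<longrightarrow> g x = 0"
    unfolding AE_ball_countable[OF \<D>(1)]
  proof
    fix X assume "X \<in> \<D>"
    then obtain a b where "X = cbox a b" "cbox a b \<subseteq> \<Omega>" using \<D>(2,3) by blast
    then show "AE x in lebesgue. x \<in> X \<longrightarrow> g x = 0" using box0[of a b] by simp
  qed
  then have "AE x in lebesgue. x \<in> \<Omega> \<longrightarrow> g x = 0"
    by eventually_elim (use \<D>(4) in auto)
  then show ?thesis using \<Omega>s by (simp add: AE_restrict_space_iff)
qed

lemma continuous_on_test:
  "\<psi> \<in> test_functions \<Omega> \<Longrightarrow> continuous_on UNIV \<psi>"
  by (intro smooth_on_continuous test_functions_smooth)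

lemma integrable_mult_test:
  assumes "\<Omega> \<in> sets lebesgue" "\<And>K. compact K \<Longrightarrow> K \<subseteq> \<Omega> \<Longrightarrow> integrable (lebesgue_on K) g"
    and "\<psi> \<in> test_functions \<Omega>"
  shows "integrable (lebesgue_on \<Omega>) (\<lambda>x. g x * \<psi> x :: real)"
proof -
  obtain K where K: "compact K" "K \<subseteq> \<Omega>" "\<And>x. x \<notin> K \<Longrightarrow> \<psi> x = 0" using test_functionsE[OF assms(3)] by blast
  show ?thesis
    using integrable_lebesgue_on_mult_test[OF assms(1,2) continuous_on_test[OF assms(3)] K]
    by (simp add: mult.commute)
qed

lemma has_weak_gradient_integrable:
  "has_weak_gradient \<Omega> u g \<Longrightarrow> compact K \<Longrightarrow> K \<subseteq> \<Omega> \<Longrightarrow> integrable (lebesgue_on K) u"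
  "has_weak_gradient \<Omega> u g \<Longrightarrow> compact K \<Longrightarrow> K \<subseteq> \<Omega> \<Longrightarrow> integrable (lebesgue_on K) (\<lambda>x. g x $ i)"
  by (auto simp: has_weak_gradient_def intro!: integrable_component[unfolded cart_eq_inner_axis] simp: cart_eq_inner_axis)

lemma has_weak_gradientD:
  "has_weak_gradient \<Omega> u g \<Longrightarrow> \<psi> \<in> test_functions \<Omega> \<Longrightarrow>
    (LINT x|lebesgue_on \<Omega>. u x * cgrad \<psi> x $ i) = - (LINT x|lebesgue_on \<Omega>. g x $ i * \<psi> x)"
  by (simp add: has_weak_gradient_def)

lemma has_weak_gradient_unique:
  assumes \<Omega>: "open \<Omega>" and g: "has_weak_gradient \<Omega> u g" and h: "has_weak_gradient \<Omega> u h"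
  shows "AE x in lebesgue_on \<Omega>. g x = h x"
proof -
  have \<Omega>s: "\<Omega> \<in> sets lebesgue" using \<Omega> by auto
  have "AE x in lebesgue_on \<Omega>. g x $ i - h x $ i = 0" for i
  proof (rule fundamental_lemma[OF \<Omega>])
    show "integrable (lebesgue_on K) (\<lambda>x. g x $ i - h x $ i)" if "compact K" "K \<subseteq> \<Omega>" for K
      using has_weak_gradient_integrable(2)[OF g that, of i] has_weak_gradient_integrable(2)[OF h that, of i] by simp
    fix \<psi> assume \<psi>: "\<psi> \<in> test_functions \<Omega>"
    have "(LINT x|lebesgue_on \<Omega>. g x $ i * \<psi> x - h x $ i * \<psi> x) = 0"
      by (subst Bochner_Integration.integral_diff)
         (use has_weak_gradientD[OF g \<psi>, of i] has_weak_gradientD[OF h \<psi>, of i] in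
          \<open>auto intro!: integrable_mult_test[OF \<Omega>s _ \<psi>] has_weak_gradient_integrable(2)[OF g] has_weak_gradient_integrable(2)[OF h]\<close>)
    then show "(LINT x|lebesgue_on \<Omega>. (g x $ i - h x $ i) * \<psi> x) = 0"
      by (simp add: left_diff_distrib)
  qed
  then have "AE x in lebesgue_on \<Omega>. \<forall>i\<in>UNIV. g x $ i - h x $ i = 0"
    by (subst AE_ball_countable) auto
  then show ?thesis by eventually_elim (simp add: vec_eq_iff)
qed

lemma has_weak_gradient_wgrad: "has_weak_gradient \<Omega> u g \<Longrightarrow> has_weak_gradient \<Omega> u (wgrad \<Omega> u)"
  unfolding wgrad_def by (rule someI[of "has_weak_gradient \<Omega> u"])

lemma wgrad_AE: "open \<Omega> \<Longrightarrow> has_weak_gradient \<Omega> u g \<Longrightarrow> AE x in lebesgue_on \<Omega>. wgrad \<Omega> u x = g x"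
  by (rule has_weak_gradient_unique[OF _ has_weak_gradient_wgrad])

lemma has_weak_gradient_lin:
  assumes \<Omega>: "open \<Omega>" and u: "has_weak_gradient \<Omega> u g" and v: "has_weak_gradient \<Omega> v h"
  shows "has_weak_gradient \<Omega> (\<lambda>x. a * u x + c * v x) (\<lambda>x. a *\<^sub>R g x + c *\<^sub>R h x)"
  unfolding has_weak_gradient_def
proof (intro conjI allI impI ballI)
  have \<Omega>s: "\<Omega> \<in> sets lebesgue" using \<Omega> by auto
  fix K assume "compact K \<and> K \<subseteq> \<Omega>"
  then show "integrable (lebesgue_on K) (\<lambda>x. a * u x + c * v x)"
    "integrable (lebesgue_on K) (\<lambda>x. a *\<^sub>R g x + c *\<^sub>R h x)"
    using u v by (auto simp: has_weak_gradient_def)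
next
  have \<Omega>s: "\<Omega> \<in> sets lebesgue" using \<Omega> by auto
  fix \<psi> i assume \<psi>: "\<psi> \<in> test_functions \<Omega>"
  have "(LINT x|lebesgue_on \<Omega>. a * (u x * cgrad \<psi> x $ i) + c * (v x * cgrad \<psi> x $ i)) =
      a * (LINT x|lebesgue_on \<Omega>. u x * cgrad \<psi> x $ i) + c * (LINT x|lebesgue_on \<Omega>. v x * cgrad \<psi> x $ i)"
    using integrable_mult_test[OF \<Omega>s has_weak_gradient_integrable(1)[OF u] test_functions_partial[OF \<psi>, of i]]
      integrable_mult_test[OF \<Omega>s has_weak_gradient_integrable(1)[OF v] test_functions_partial[OF \<psi>, of i]]
    by simp
  moreover have "(LINT x|lebesgue_on \<Omega>. a * (g x $ i * \<psi> x) + c * (h x $ i * \<psi> x)) =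
      a * (LINT x|lebesgue_on \<Omega>. g x $ i * \<psi> x) + c * (LINT x|lebesgue_on \<Omega>. h x $ i * \<psi> x)"
    using integrable_mult_test[OF \<Omega>s has_weak_gradient_integrable(2)[OF u] \<psi>, of i]
      integrable_mult_test[OF \<Omega>s has_weak_gradient_integrable(2)[OF v] \<psi>, of i]
    by simp
  ultimately show "(LINT x|lebesgue_on \<Omega>. (a * u x + c * v x) * frechet_derivative \<psi> (at x) (axis i 1)) =
      - (LINT x|lebesgue_on \<Omega>. (a *\<^sub>R g x + c *\<^sub>R h x) $ i * \<psi> x)"
    using has_weak_gradientD[OF u \<psi>, of i] has_weak_gradientD[OF v \<psi>, of i]
    by (simp add: algebra_simps)
qed

lemma borel_cgrad: "smooth_on \<psi> UNIV \<Longrightarrow> cgrad \<psi> \<in> borel_measurable borel"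
  by (rule borel_measurable_continuous_onI[OF continuous_on_cgrad])

lemma borel_smooth: "smooth_on \<psi> UNIV \<Longrightarrow> \<psi> \<in> borel_measurable borel"
  by (rule borel_measurable_continuous_onI[OF smooth_on_continuous])

lemma integrable_lborel_lebesgue_on:
  fixes f :: "'a::euclidean_space \<Rightarrow> 'b::euclidean_space"
  assumes "integrable lborel f" "S \<in> sets lebesgue"
  shows "integrable (lebesgue_on S) f"
proof -
  have "integrable lebesgue f" using assms by (simp add: integrable_completion)
  then show ?thesis using assms(2) by (simp add: integrable_restrict_space integrable_mult_indicator)
qed

lemma integrable_cgrad:
  assumes "\<psi> \<in> test_functions \<Omega>" shows "integrable lborel (cgrad \<psi>)"
proof -
  obtain K where K: "compact K" "\<forall>x. x \<notin> K \<longrightarrow> \<psi> x = 0" using test_functions_compact_support[OF assms] by blast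
  show ?thesis
    by (rule integrable_compact_support[OF continuous_on_cgrad[OF test_functions_smooth[OF assms]] K(1)])
       (rule cgrad_eq_0[of K], use K in auto)
qed

text \<open>The function \<open>\<psi>\<close> need not vanish near the boundary of the domain: the
  boundary term is killed by the test function it is paired with.\<close>

lemma has_weak_gradient_test:
  assumes \<psi>: "\<psi> \<in> test_functions UNIV" and \<Omega>: "open \<Omega>"
  shows "has_weak_gradient \<Omega> \<psi> (cgrad \<psi>)"
  unfolding has_weak_gradient_def
proof (intro conjI allI impI ballI)
  fix K assume "compact K \<and> K \<subseteq> \<Omega>"
  then have "K \<in> sets lebesgue" by (simp add: lmeasurable_compact fmeasurableD)
  then show "integrable (lebesgue_on K) \<psi>" "integrable (lebesgue_on K) (cgrad \<psi>)"
    by (auto intro!: integrable_lborel_lebesgue_on test_functions_integrable[OF \<psi>] integrable_cgrad[OF \<psi>])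
next
  have \<Omega>s: "\<Omega> \<in> sets lebesgue" using \<Omega> by auto
  fix \<eta> i assume \<eta>: "\<eta> \<in> test_functions \<Omega>"
  note [measurable] = borel_smooth[OF test_functions_smooth[OF \<psi>]] borel_smooth[OF test_functions_smooth[OF \<eta>]]
    borel_smooth[OF test_functions_smooth[OF test_functions_partial[OF \<psi>]]]
    borel_smooth[OF test_functions_smooth[OF test_functions_partial[OF \<eta>]]]
  obtain K where K: "compact K" "K \<subseteq> \<Omega>" "\<And>x. x \<notin> K \<Longrightarrow> \<eta> x = 0" using test_functionsE[OF \<eta>] by blast
  have 0: "\<eta> x = 0" "cgrad \<eta> x = 0" if "x \<notin> \<Omega>" for x
    using K that cgrad_eq_0[of K \<eta> x] by auto
  have "(LINT x|lebesgue_on \<Omega>. \<psi> x * cgrad \<eta> x $ i) = (LINT x|lborel. \<psi> x * cgrad \<eta> x $ i)"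
    using 0 by (intro lebesgue_on_eq_lborel(1) \<Omega>s borel_measurable_times) (auto simp del: cgrad_nth)
  moreover have "(LINT x|lebesgue_on \<Omega>. cgrad \<psi> x $ i * \<eta> x) = (LINT x|lborel. cgrad \<psi> x $ i * \<eta> x)"
    using 0 by (intro lebesgue_on_eq_lborel(1) \<Omega>s borel_measurable_times) (auto simp del: cgrad_nth)
  ultimately show "(LINT x|lebesgue_on \<Omega>. \<psi> x * frechet_derivative \<eta> (at x) (axis i 1)) =
      - (LINT x|lebesgue_on \<Omega>. cgrad \<psi> x $ i * \<eta> x)"
    using test_functions_by_parts[OF \<eta> \<psi>, of i] by simp
qed

section \<open>Functions with zero boundary values on a bounded open set\<close>

lemma integrable_lebesgue_on_subset:
  fixes f :: "'a::euclidean_space \<Rightarrow> 'b::euclidean_space"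
  assumes "integrable (lebesgue_on S) f" "K \<subseteq> S" "S \<in> sets lebesgue" "K \<in> sets lebesgue"
  shows "integrable (lebesgue_on K) f"
proof -
  have "integrable lebesgue (\<lambda>x. indicator K x *\<^sub>R (indicator S x *\<^sub>R f x))"
    by (rule integrable_mult_indicator) (use assms in \<open>auto simp: integrable_restrict_space\<close>)
  also have "(\<lambda>x. indicator K x *\<^sub>R (indicator S x *\<^sub>R f x)) = (\<lambda>x. indicator K x *\<^sub>R f x)"
    using assms(2) by (auto simp: indicator_def fun_eq_iff)
  finally show ?thesis using assms by (simp add: integrable_restrict_space)
qed

text \<open>Lebesgue measure is complete. Hence a chosen representative such as \<open>wgrad\<close>
  inherits measurability from any known gradient.\<close>

lemma borel_measurable_lebesgue_on_AE:
  fixes f :: "'a::euclidean_space \<Rightarrow> 'b::euclidean_space"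
  assumes "f \<in> borel_measurable (lebesgue_on S)" "AE x in lebesgue_on S. f x = g x" "S \<in> sets lebesgue"
  shows "g \<in> borel_measurable (lebesgue_on S)"
proof (rule borel_measurable_if_D, rule borel_measurable_AE)
  show "(\<lambda>x. if x \<in> S then f x else 0) \<in> borel_measurable lebesgue"
    using assms by (intro borel_measurable_if_I) auto
  have "AE x in lebesgue. x \<in> S \<longrightarrow> f x = g x"
    using assms by (simp add: AE_restrict_space_iff)
  then show "AE x in lebesgue. (if x \<in> S then f x else 0) = (if x \<in> S then g x else 0)"
    by eventually_elim auto
qed

lemma square_integrable_test:
  assumes "\<psi> \<in> test_functions \<Omega>'" "\<Omega> \<in> sets lebesgue"
  shows "square_integrable (lebesgue_on \<Omega>) \<psi>"
proof -
  have [measurable]: "\<psi> \<in> borel_measurable borel" using assms borel_smooth test_functions_smooth by blast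
  have \<psi>: "\<psi> \<in> test_functions UNIV" using assms(1) test_functions_mono by blast
  have "integrable (lebesgue_on \<Omega>) (\<lambda>x. \<psi> x * \<psi> x)"
    by (rule integrable_lborel_lebesgue_on[OF test_functions_integrable[OF test_functions_mult[OF \<psi> \<psi>]] assms(2)])
  then show ?thesis
    by (simp add: square_integrable_def power2_eq_square measurable_completion measurable_restrict_space1)
qed

lemma integrable_cgrad_power:
  assumes "\<psi> \<in> test_functions \<Omega>'" "\<Omega> \<in> sets lebesgue" "n > 0"
  shows "integrable (lebesgue_on \<Omega>) (\<lambda>x. (norm (cgrad \<psi> x))^n)"
proof (rule integrable_lborel_lebesgue_on[OF _ assms(2)])
  obtain K where K: "compact K" "\<forall>x. x \<notin> K \<longrightarrow> \<psi> x = 0" using test_functions_compact_support[OF assms(1)] by blast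
  show "integrable lborel (\<lambda>x. (norm (cgrad \<psi> x))^n)"
  proof (rule integrable_compact_support[OF _ K(1)])
    show "continuous_on UNIV (\<lambda>x. (norm (cgrad \<psi> x))^n)"
      by (intro continuous_intros continuous_on_cgrad test_functions_smooth[OF assms(1)])
    show "(norm (cgrad \<psi> x))^n = 0" if "x \<notin> K" for x
      using cgrad_eq_0[of K \<psi> x] K that assms(3) by simp
  qed
qed

lemma borel_measurable_cgrad:
  "\<psi> \<in> test_functions \<Omega>' \<Longrightarrow> cgrad \<psi> \<in> borel_measurable (lebesgue_on \<Omega>)"
  by (intro measurable_restrict_space1 measurable_completion)
     (simp add: borel_cgrad test_functions_smooth)

lemma square_integrable_cgrad:
  assumes "\<psi> \<in> test_functions \<Omega>'" "\<Omega> \<in> sets lebesgue"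
  shows "square_integrable (lebesgue_on \<Omega>) (cgrad \<psi>)"
  using integrable_cgrad_power[OF assms, of 2] borel_measurable_cgrad[OF assms(1)]
  by (simp add: square_integrable_def)

text \<open>Openness is what makes weak gradients unique; boundedness makes the measure finite and
  the covering grids finite.\<close>

locale bounded_open_set =
  fixes \<Omega> :: "(real^3) set"
  assumes open_Omega: "open \<Omega>" and bounded_Omega: "bounded \<Omega>"
begin

abbreviation "M \<equiv> lebesgue_on \<Omega>"

lemma Omega_sets: "\<Omega> \<in> sets lebesgue"
  using open_Omega by auto

sublocale finite_measure M
  by (intro finite_measure_lebesgue_on lmeasurable_open open_Omega bounded_Omega)

text \<open>Membership in the closure, in L^2 x L^2, of the graph of the gradient on test functions:
  \<open>u\<close> lies in H^1_0 and \<open>G\<close> represents its gradient. Naming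
  \<open>G\<close> avoids the choice hidden in \<open>wgrad\<close> and makes limits and linear
  combinations of gradients explicit.\<close>

definition grad_pair :: "(real^3 \<Rightarrow> real) \<Rightarrow> (real^3 \<Rightarrow> real^3) \<Rightarrow> bool" where
  "grad_pair u G \<longleftrightarrow> square_integrable M u \<and> square_integrable M G \<and>
     (\<exists>\<psi>. (\<forall>n::nat. \<psi> n \<in> test_functions \<Omega>) \<and> (\<lambda>n. sqnorm M (\<lambda>x. \<psi> n x - u x)) \<longlonglongrightarrow> 0 \<and>
        (\<lambda>n. sqnorm M (\<lambda>x. cgrad (\<psi> n) x - G x)) \<longlonglongrightarrow> 0)"

lemma grad_pair_square_integrable:
  assumes "grad_pair u G" shows "square_integrable M u" "square_integrable M G"
  using assms by (auto simp: grad_pair_def)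

lemma grad_pairE:
  assumes "grad_pair u G"
  obtains \<psi> where "\<And>n::nat. \<psi> n \<in> test_functions \<Omega>" "(\<lambda>n. sqnorm M (\<lambda>x. \<psi> n x - u x)) \<longlonglongrightarrow> 0"
    "(\<lambda>n. sqnorm M (\<lambda>x. cgrad (\<psi> n) x - G x)) \<longlonglongrightarrow> 0"
  using assms by (auto simp: grad_pair_def)

lemma test_square_integrable:
  assumes "\<psi> \<in> test_functions \<Omega>'"
  shows "square_integrable M \<psi>" "square_integrable M (cgrad \<psi>)"
  using square_integrable_test[OF assms Omega_sets] square_integrable_cgrad[OF assms Omega_sets] by auto

lemma grad_pair_test:
  assumes "\<psi> \<in> test_functions \<Omega>" shows "grad_pair \<psi> (cgrad \<psi>)"
  unfolding grad_pair_def using assms test_square_integrable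
  by (auto intro!: exI[of _ "\<lambda>_. \<psi>"] simp: sqnorm_def)

lemma grad_pair_lin:
  assumes u: "grad_pair u G" and v: "grad_pair v H"
  shows "grad_pair (\<lambda>x. a * u x + c * v x) (\<lambda>x. a *\<^sub>R G x + c *\<^sub>R H x)"
proof -
  obtain \<psi> where \<psi>: "\<And>n. \<psi> n \<in> test_functions \<Omega>" "(\<lambda>n. sqnorm M (\<lambda>x. \<psi> n x - u x)) \<longlonglongrightarrow> 0"
    "(\<lambda>n. sqnorm M (\<lambda>x. cgrad (\<psi> n) x - G x)) \<longlonglongrightarrow> 0" using grad_pairE[OF u] by blast
  obtain \<eta> where \<eta>: "\<And>n. \<eta> n \<in> test_functions \<Omega>" "(\<lambda>n. sqnorm M (\<lambda>x. \<eta> n x - v x)) \<longlonglongrightarrow> 0"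
    "(\<lambda>n. sqnorm M (\<lambda>x. cgrad (\<eta> n) x - H x)) \<longlonglongrightarrow> 0" using grad_pairE[OF v] by blast
  note si = grad_pair_square_integrable[OF u] grad_pair_square_integrable[OF v]
  define \<theta> where "\<theta> = (\<lambda>n x. a * \<psi> n x + c * \<eta> n x)"
  have \<theta>: "\<theta> n \<in> test_functions \<Omega>" for n
    unfolding \<theta>_def by (intro test_functions_lin \<psi> \<eta>)
  have c\<theta>: "cgrad (\<theta> n) x = a *\<^sub>R cgrad (\<psi> n) x + c *\<^sub>R cgrad (\<eta> n) x" for n x
    unfolding \<theta>_def by (intro cgrad_lin test_functions_smooth[OF \<psi>(1)] test_functions_smooth[OF \<eta>(1)])
  have conv: "(\<lambda>n. sqnorm M (\<lambda>x. (a *\<^sub>R f n x + c *\<^sub>R g n x) - (a *\<^sub>R f0 x + c *\<^sub>R g0 x))) \<longlonglongrightarrow> 0"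
    if f: "\<And>n. square_integrable M (f n)" "square_integrable M f0" "(\<lambda>n. sqnorm M (\<lambda>x. f n x - f0 x)) \<longlonglongrightarrow> 0"
      and g: "\<And>n. square_integrable M (g n)" "square_integrable M g0" "(\<lambda>n. sqnorm M (\<lambda>x. g n x - g0 x)) \<longlonglongrightarrow> 0"
    for f g and f0 g0 :: "real^3 \<Rightarrow> 'b::euclidean_space"
  proof (rule tendsto_sandwich[OF always_eventually always_eventually tendsto_const])
    have "(\<lambda>n. 2 * (a\<^sup>2 * sqnorm M (\<lambda>x. f n x - f0 x)) + 2 * (c\<^sup>2 * sqnorm M (\<lambda>x. g n x - g0 x)))
        \<longlonglongrightarrow> 2 * (a\<^sup>2 * 0) + 2 * (c\<^sup>2 * 0)"
      by (intro tendsto_intros f g)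
    then show "(\<lambda>n. 2 * (a\<^sup>2 * sqnorm M (\<lambda>x. f n x - f0 x)) + 2 * (c\<^sup>2 * sqnorm M (\<lambda>x. g n x - g0 x))) \<longlonglongrightarrow> 0"
      by simp
    show "\<forall>n. sqnorm M (\<lambda>x. (a *\<^sub>R f n x + c *\<^sub>R g n x) - (a *\<^sub>R f0 x + c *\<^sub>R g0 x))
        \<le> 2 * (a\<^sup>2 * sqnorm M (\<lambda>x. f n x - f0 x)) + 2 * (c\<^sup>2 * sqnorm M (\<lambda>x. g n x - g0 x))"
    proof
      fix n
      have "(\<lambda>x. (a *\<^sub>R f n x + c *\<^sub>R g n x) - (a *\<^sub>R f0 x + c *\<^sub>R g0 x)) =
          (\<lambda>x. a *\<^sub>R (f n x - f0 x) + c *\<^sub>R (g n x - g0 x))"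
        by (simp add: algebra_simps)
      then show "sqnorm M (\<lambda>x. (a *\<^sub>R f n x + c *\<^sub>R g n x) - (a *\<^sub>R f0 x + c *\<^sub>R g0 x))
          \<le> 2 * (a\<^sup>2 * sqnorm M (\<lambda>x. f n x - f0 x)) + 2 * (c\<^sup>2 * sqnorm M (\<lambda>x. g n x - g0 x))"
        using sqnorm_add_le[OF square_integrable_scaleR[OF square_integrable_diff[OF f(1,2)], of a]
          square_integrable_scaleR[OF square_integrable_diff[OF g(1,2)], of c], of n n]
        by (simp only: sqnorm_scaleR)
    qed
  qed simp
  have "square_integrable M (\<lambda>x. a *\<^sub>R u x + c *\<^sub>R v x)" "square_integrable M (\<lambda>x. a *\<^sub>R G x + c *\<^sub>R H x)"
    by (intro square_integrable_add square_integrable_scaleR si)+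
  moreover have "(\<lambda>n. sqnorm M (\<lambda>x. \<theta> n x - (a *\<^sub>R u x + c *\<^sub>R v x))) \<longlonglongrightarrow> 0"
    using conv[OF test_square_integrable(1)[OF \<psi>(1)] si(1) \<psi>(2) test_square_integrable(1)[OF \<eta>(1)] si(3) \<eta>(2)]
    by (simp add: \<theta>_def)
  moreover have "(\<lambda>n. sqnorm M (\<lambda>x. cgrad (\<theta> n) x - (a *\<^sub>R G x + c *\<^sub>R H x))) \<longlonglongrightarrow> 0"
    using conv[OF test_square_integrable(2)[OF \<psi>(1)] si(2) \<psi>(3) test_square_integrable(2)[OF \<eta>(1)] si(4) \<eta>(3)]
    by (simp add: c\<theta>)
  ultimately show ?thesis unfolding grad_pair_def using \<theta> by (auto intro!: exI[of _ \<theta>])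
qed

lemma grad_pair_diff:
  assumes "grad_pair u G" "grad_pair v H"
  shows "grad_pair (\<lambda>x. u x - v x) (\<lambda>x. G x - H x)"
  using grad_pair_lin[OF assms, of 1 "-1"] by simp

lemma grad_pair_cong_AE:
  assumes u: "grad_pair u G" and AE: "AE x in M. G x = H x"
  shows "grad_pair u H"
proof -
  obtain \<psi> where \<psi>: "\<And>n. \<psi> n \<in> test_functions \<Omega>" "(\<lambda>n. sqnorm M (\<lambda>x. \<psi> n x - u x)) \<longlonglongrightarrow> 0"
    "(\<lambda>n. sqnorm M (\<lambda>x. cgrad (\<psi> n) x - G x)) \<longlonglongrightarrow> 0" using grad_pairE[OF u] by blast
  note si = grad_pair_square_integrable[OF u]
  have H: "H \<in> borel_measurable M"
    by (rule borel_measurable_lebesgue_on_AE[OF square_integrable_measurable[OF si(2)] AE Omega_sets])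
  have "sqnorm M (\<lambda>x. cgrad (\<psi> n) x - G x) = sqnorm M (\<lambda>x. cgrad (\<psi> n) x - H x)" for n
    by (rule sqnorm_cong_AE)
       (use AE H si(2) borel_measurable_cgrad[OF \<psi>(1)] in \<open>auto simp: square_integrable_def\<close>)
  then show ?thesis
    unfolding grad_pair_def using \<psi> si square_integrable_AE[OF si(2) AE H] by auto
qed

text \<open>Integration by parts holds for the approximating test functions, and both sides are L^2
  pairings with a fixed smooth function, so it survives the limit.\<close>

lemma grad_pair_weak_gradient:
  assumes u: "grad_pair u G" shows "has_weak_gradient \<Omega> u G"
  unfolding has_weak_gradient_def
proof (intro conjI allI impI ballI)
  note si = grad_pair_square_integrable[OF u]
  fix K assume K: "compact K \<and> K \<subseteq> \<Omega>"
  then have "K \<in> sets lebesgue" by (simp add: lmeasurable_compact fmeasurableD)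
  then show "integrable (lebesgue_on K) u" "integrable (lebesgue_on K) G"
    using K by (auto intro!: integrable_lebesgue_on_subset[OF _ _ Omega_sets] square_integrable_integrable si)
next
  note si = grad_pair_square_integrable[OF u]
  obtain \<psi> where \<psi>: "\<And>n. \<psi> n \<in> test_functions \<Omega>" "(\<lambda>n. sqnorm M (\<lambda>x. \<psi> n x - u x)) \<longlonglongrightarrow> 0"
    "(\<lambda>n. sqnorm M (\<lambda>x. cgrad (\<psi> n) x - G x)) \<longlonglongrightarrow> 0" using grad_pairE[OF u] by blast
  fix \<eta> and i :: 3 assume \<eta>: "\<eta> \<in> test_functions \<Omega>"
  have s\<eta>: "square_integrable M (\<lambda>x. \<eta> x *\<^sub>R axis i (1::real))"
    using test_square_integrable(1)[OF \<eta>]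
    by (auto simp: square_integrable_def power_mult_distrib)
  have "(\<lambda>n. LINT x|M. \<psi> n x * cgrad \<eta> x $ i) \<longlonglongrightarrow> (LINT x|M. u x * cgrad \<eta> x $ i)"
    using integral_inner_tendsto[OF test_square_integrable(1)[OF \<psi>(1)] si(1)
      test_square_integrable(1)[OF test_functions_partial[OF \<eta>, of i]] \<psi>(2)]
    by (simp only: inner_real_def)
  moreover have "(\<lambda>n. - (LINT x|M. cgrad (\<psi> n) x $ i * \<eta> x)) \<longlonglongrightarrow> - (LINT x|M. G x $ i * \<eta> x)"
    using tendsto_minus[OF integral_inner_tendsto[OF test_square_integrable(2)[OF \<psi>(1)] si(2) s\<eta> \<psi>(3)]]
    by (simp add: inner_axis mult.commute)
  moreover have "(LINT x|M. \<psi> n x * cgrad \<eta> x $ i) = - (LINT x|M. cgrad (\<psi> n) x $ i * \<eta> x)" for n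
    by (rule has_weak_gradientD[OF has_weak_gradient_test[OF _ open_Omega] \<eta>])
       (rule test_functions_mono[OF \<psi>(1)], simp)
  ultimately have "(LINT x|M. u x * cgrad \<eta> x $ i) = - (LINT x|M. G x $ i * \<eta> x)"
    using LIMSEQ_unique by force
  then show "(LINT x|M. u x * frechet_derivative \<eta> (at x) (axis i 1)) = - (LINT x|M. G x $ i * \<eta> x)"
    by simp
qed

lemma grad_pair_wgrad_AE: "grad_pair u G \<Longrightarrow> AE x in M. wgrad \<Omega> u x = G x"
  by (rule wgrad_AE[OF open_Omega grad_pair_weak_gradient])

lemma grad_pair_wgrad: 
  assumes "grad_pair u G" shows "grad_pair u (wgrad \<Omega> u)"
proof (rule grad_pair_cong_AE[OF assms])
  show "AE x in M. G x = wgrad \<Omega> u x"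
    using grad_pair_wgrad_AE[OF assms] by eventually_elim simp
qed

lemma square_integrable_Lp: "square_integrable M f \<longleftrightarrow> f \<in> Lp_fun 2 \<Omega>"
  by (simp add: square_integrable_def Lp_fun_def)

text \<open>The definition of \<open>W1_0\<close> measures the chosen gradient of
  \<open>u - \<psi> n\<close>, which agrees with \<open>g - cgrad (\<psi> n)\<close> only almost
  everywhere; uniqueness of weak gradients bridges the two.\<close>

lemma H1_0_imp_grad_pair:
  assumes "u \<in> H1_0 \<Omega>" shows "grad_pair u (wgrad \<Omega> u)"
proof -
  obtain g where u: "square_integrable M u" and g: "has_weak_gradient \<Omega> u g" "square_integrable M g"
    using assms by (auto simp: W1_0_def W1_def square_integrable_Lp)
  obtain \<psi> where \<psi>: "\<And>n. \<psi> n \<in> test_functions \<Omega>"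
      and lim: "(\<lambda>n. (LINT x|M. \<bar>u x - \<psi> n x\<bar> powr 2) + (LINT x|M. norm (wgrad \<Omega> (\<lambda>y. u y - \<psi> n y) x) powr 2)) \<longlonglongrightarrow> 0"
    using assms by (auto simp: W1_0_def)
  have wg: "AE x in M. wgrad \<Omega> (\<lambda>y. u y - \<psi> n y) x = g x - cgrad (\<psi> n) x" for n
  proof -
    have "has_weak_gradient \<Omega> (\<psi> n) (cgrad (\<psi> n))"
      by (rule has_weak_gradient_test[OF _ open_Omega]) (rule test_functions_mono[OF \<psi>], simp)
    from wgrad_AE[OF open_Omega has_weak_gradient_lin[OF open_Omega g(1) this, of 1 "-1"]]
    show ?thesis by simp
  qed
  have "sqnorm M (\<lambda>x. cgrad (\<psi> n) x - g x) = sqnorm M (wgrad \<Omega> (\<lambda>y. u y - \<psi> n y))" for n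
  proof -
    have m: "(\<lambda>x. g x - cgrad (\<psi> n) x) \<in> borel_measurable M"
      using g(2) borel_measurable_cgrad[OF \<psi>] by (auto simp: square_integrable_def)
    have AE: "AE x in M. g x - cgrad (\<psi> n) x = wgrad \<Omega> (\<lambda>y. u y - \<psi> n y) x"
      using wg[of n] by eventually_elim simp
    have "sqnorm M (\<lambda>x. g x - cgrad (\<psi> n) x) = sqnorm M (wgrad \<Omega> (\<lambda>y. u y - \<psi> n y))"
      by (rule sqnorm_cong_AE[OF m borel_measurable_lebesgue_on_AE[OF m AE Omega_sets] AE])
    then show ?thesis by (subst sqnorm_minus_commute)
  qed
  then have lim': "(\<lambda>n. sqnorm M (\<lambda>x. \<psi> n x - u x) + sqnorm M (\<lambda>x. cgrad (\<psi> n) x - g x)) \<longlonglongrightarrow> 0"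
    using lim by (simp add: sqnorm_def abs_minus_commute power2_commute)
  have "(\<lambda>n. sqnorm M (\<lambda>x. \<psi> n x - u x)) \<longlonglongrightarrow> 0"
    by (rule tendsto_sandwich[OF _ _ tendsto_const lim']) auto
  moreover have "(\<lambda>n. sqnorm M (\<lambda>x. cgrad (\<psi> n) x - g x)) \<longlonglongrightarrow> 0"
    by (rule tendsto_sandwich[OF _ _ tendsto_const lim']) auto
  ultimately have "grad_pair u g" using u g \<psi> by (auto simp: grad_pair_def)
  then show ?thesis by (rule grad_pair_wgrad)
qed

lemma grad_pair_imp_H1_0:
  assumes u: "grad_pair u G" shows "u \<in> H1_0 \<Omega>"
proof -
  obtain \<psi> where \<psi>: "\<And>n. \<psi> n \<in> test_functions \<Omega>" "(\<lambda>n. sqnorm M (\<lambda>x. \<psi> n x - u x)) \<longlonglongrightarrow> 0"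
    "(\<lambda>n. sqnorm M (\<lambda>x. cgrad (\<psi> n) x - G x)) \<longlonglongrightarrow> 0" using grad_pairE[OF u] by blast
  note si = grad_pair_square_integrable[OF u]
  have "sqnorm M (wgrad \<Omega> (\<lambda>y. u y - \<psi> n y)) = sqnorm M (\<lambda>x. cgrad (\<psi> n) x - G x)" for n
  proof -
    have p: "grad_pair (\<lambda>y. u y - \<psi> n y) (\<lambda>x. G x - cgrad (\<psi> n) x)"
      by (intro grad_pair_diff u grad_pair_test \<psi>)
    have "sqnorm M (wgrad \<Omega> (\<lambda>y. u y - \<psi> n y)) = sqnorm M (\<lambda>x. G x - cgrad (\<psi> n) x)"
      using grad_pair_square_integrable(2)[OF p] grad_pair_square_integrable(2)[OF grad_pair_wgrad[OF p]]
      by (intro sqnorm_cong_AE grad_pair_wgrad_AE p) (auto simp: square_integrable_def)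
    then show ?thesis by (subst (asm) sqnorm_minus_commute)
  qed
  then have "(\<lambda>n. (LINT x|M. \<bar>u x - \<psi> n x\<bar> powr 2) + (LINT x|M. norm (wgrad \<Omega> (\<lambda>y. u y - \<psi> n y) x) powr 2)) \<longlonglongrightarrow> 0"
    using tendsto_add[OF \<psi>(2,3)] by (simp add: sqnorm_def power2_commute)
  then show ?thesis
    using si grad_pair_weak_gradient[OF u] \<psi>(1) unfolding W1_0_def W1_def by (auto simp: square_integrable_Lp)
qed

lemma H1_0_iff: "u \<in> H1_0 \<Omega> \<longleftrightarrow> grad_pair u (wgrad \<Omega> u)"
  using H1_0_imp_grad_pair grad_pair_imp_H1_0 by blast

text \<open>The constant sequence approximates. Its error is the zero function, but
  \<open>wgrad\<close> of that is only known to vanish almost everywhere.\<close>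

lemma test_in_HH:
  assumes \<psi>: "\<psi> \<in> test_functions \<Omega>" shows "\<psi> \<in> HH \<Omega>"
proof -
  have \<psi>': "\<psi> \<in> test_functions UNIV" using \<psi> test_functions_mono by blast
  have z: "wgrad \<Omega> (\<lambda>y. \<psi> y - \<psi> y) \<in> borel_measurable M" "AE x in M. wgrad \<Omega> (\<lambda>y. \<psi> y - \<psi> y) x = 0"
  proof -
    have p: "grad_pair (\<lambda>y. \<psi> y - \<psi> y) (\<lambda>x. cgrad \<psi> x - cgrad \<psi> x)"
      by (intro grad_pair_diff grad_pair_test \<psi>)
    show "wgrad \<Omega> (\<lambda>y. \<psi> y - \<psi> y) \<in> borel_measurable M"
      using grad_pair_square_integrable(2)[OF grad_pair_wgrad[OF p]] by (simp add: square_integrable_def)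
    show "AE x in M. wgrad \<Omega> (\<lambda>y. \<psi> y - \<psi> y) x = 0"
      using grad_pair_wgrad_AE[OF p] by simp
  qed
  have "(LINT x|M. norm (wgrad \<Omega> (\<lambda>y. \<psi> y - \<psi> y) x) powr 4) = (LINT x|M. 0)"
    by (rule integral_cong_AE) (use z in auto)
  moreover have "\<psi> \<in> Lp_fun 4 \<Omega>"
  proof -
    have "integrable M (\<lambda>x. (\<psi> x * \<psi> x) * (\<psi> x * \<psi> x))"
      by (intro integrable_lborel_lebesgue_on[OF _ Omega_sets] test_functions_integrable[of _ UNIV] test_functions_mult[where \<Omega>'=UNIV] \<psi>')
    moreover have "(\<psi> x * \<psi> x) * (\<psi> x * \<psi> x) = \<bar>\<psi> x\<bar> ^ 4" for x
      by (simp add: power4_eq_xxxx flip: abs_mult)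
    ultimately show ?thesis
      using square_integrable_measurable[OF test_square_integrable(1)[OF \<psi>]] by (simp add: Lp_fun_def)
  qed
  moreover have "cgrad \<psi> \<in> Lp_fun 4 \<Omega>"
    using integrable_cgrad_power[OF \<psi> Omega_sets, of 4] borel_measurable_cgrad[OF \<psi>] by (simp add: Lp_fun_def)
  ultimately have "\<psi> \<in> W1_0 4 \<Omega>"
    using has_weak_gradient_test[OF \<psi>' open_Omega] \<psi> unfolding W1_0_def W1_def
    by (auto intro!: exI[of _ "\<lambda>_. \<psi>"])
  moreover have "\<psi> \<in> H1_0 \<Omega>" using grad_pair_imp_H1_0 grad_pair_test \<psi> by blast
  ultimately show ?thesis by (simp add: HH_def)
qed

lemma grad_pair_approx:
  assumes "grad_pair u G" "e > 0"
  shows "\<exists>\<psi>\<in>test_functions \<Omega>. sqnorm M (\<lambda>x. \<psi> x - u x) < e \<and> sqnorm M (\<lambda>x. cgrad \<psi> x - G x) < e"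
proof -
  obtain \<psi> where \<psi>: "\<And>n. \<psi> n \<in> test_functions \<Omega>" "(\<lambda>n. sqnorm M (\<lambda>x. \<psi> n x - u x)) \<longlonglongrightarrow> 0"
    "(\<lambda>n. sqnorm M (\<lambda>x. cgrad (\<psi> n) x - G x)) \<longlonglongrightarrow> 0" using grad_pairE[OF assms(1)] by blast
  have "\<forall>\<^sub>F n in sequentially. sqnorm M (\<lambda>x. \<psi> n x - u x) < e \<and> sqnorm M (\<lambda>x. cgrad (\<psi> n) x - G x) < e"
    by (intro eventually_conj order_tendstoD(2)[OF \<psi>(2) assms(2)] order_tendstoD(2)[OF \<psi>(3) assms(2)])
  then obtain n where "sqnorm M (\<lambda>x. \<psi> n x - u x) < e \<and> sqnorm M (\<lambda>x. cgrad (\<psi> n) x - G x) < e"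
    using eventually_happens'[OF sequentially_bot] by force
  then show ?thesis using \<psi>(1) by blast
qed

text \<open>A diagonal choice of test functions with error below 1 / (n + 1) shows that the closure
  of the graph is itself closed.\<close>

lemma grad_pair_limit:
  assumes p: "\<And>n::nat. grad_pair (u n) (G n)" and s: "square_integrable M u0" "square_integrable M G0"
    and lim: "(\<lambda>n. sqnorm M (\<lambda>x. u n x - u0 x)) \<longlonglongrightarrow> 0" "(\<lambda>n. sqnorm M (\<lambda>x. G n x - G0 x)) \<longlonglongrightarrow> 0"
  shows "grad_pair u0 G0"
proof -
  have "\<exists>\<psi>. \<forall>n. \<psi> n \<in> test_functions \<Omega> \<and> sqnorm M (\<lambda>x. \<psi> n x - u n x) < inverse (real (Suc n)) \<and>
      sqnorm M (\<lambda>x. cgrad (\<psi> n) x - G n x) < inverse (real (Suc n))"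
  proof (rule choice, rule allI)
    fix n
    show "\<exists>\<psi>. \<psi> \<in> test_functions \<Omega> \<and> sqnorm M (\<lambda>x. \<psi> x - u n x) < inverse (real (Suc n)) \<and>
      sqnorm M (\<lambda>x. cgrad \<psi> x - G n x) < inverse (real (Suc n))"
      using grad_pair_approx[OF p, of "inverse (real (Suc n))" n] by auto
  qed
  then obtain \<psi> where \<psi>: "\<And>n. \<psi> n \<in> test_functions \<Omega>"
    "\<And>n. sqnorm M (\<lambda>x. \<psi> n x - u n x) < inverse (real (Suc n))"
    "\<And>n. sqnorm M (\<lambda>x. cgrad (\<psi> n) x - G n x) < inverse (real (Suc n))" by blast
  have conv: "(\<lambda>n. sqnorm M (\<lambda>x. f n x - f0 x)) \<longlonglongrightarrow> 0"
    if f: "\<And>n. square_integrable M (f n)" "\<And>n. square_integrable M (g n)" "square_integrable M f0"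
      "\<And>n. sqnorm M (\<lambda>x. f n x - g n x) < inverse (real (Suc n))" "(\<lambda>n. sqnorm M (\<lambda>x. g n x - f0 x)) \<longlonglongrightarrow> 0"
    for f g and f0 :: "real^3 \<Rightarrow> 'b::euclidean_space"
  proof (rule tendsto_sandwich[OF always_eventually always_eventually tendsto_const])
    have "(\<lambda>n. 2 * inverse (real (Suc n)) + 2 * sqnorm M (\<lambda>x. g n x - f0 x)) \<longlonglongrightarrow> 2 * 0 + 2 * 0"
      by (intro tendsto_intros f LIMSEQ_inverse_real_of_nat)
    then show "(\<lambda>n. 2 * inverse (real (Suc n)) + 2 * sqnorm M (\<lambda>x. g n x - f0 x)) \<longlonglongrightarrow> 0" by simp
    show "\<forall>n. sqnorm M (\<lambda>x. f n x - f0 x) \<le> 2 * inverse (real (Suc n)) + 2 * sqnorm M (\<lambda>x. g n x - f0 x)"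
    proof
      fix n
      show "sqnorm M (\<lambda>x. f n x - f0 x) \<le> 2 * inverse (real (Suc n)) + 2 * sqnorm M (\<lambda>x. g n x - f0 x)"
        using sqnorm_triangle_le[OF f(1)[of n] f(2)[of n] f(3)] f(4)[of n] by linarith
    qed
  qed simp
  show ?thesis
    unfolding grad_pair_def using s \<psi>(1)
      conv[OF test_square_integrable(1)[OF \<psi>(1)] grad_pair_square_integrable(1)[OF p] s(1) \<psi>(2) lim(1)]
      conv[OF test_square_integrable(2)[OF \<psi>(1)] grad_pair_square_integrable(2)[OF p] s(2) \<psi>(3) lim(2)]
    by blast
qed

definition laplacian :: "(real^3 \<Rightarrow> real) \<Rightarrow> real^3 \<Rightarrow> real" where
  "laplacian \<eta> x = (\<Sum>i\<in>UNIV. cgrad (\<lambda>y. cgrad \<eta> y $ i) x $ i)"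

lemma square_integrable_laplacian:
  assumes "\<eta> \<in> test_functions \<Omega>" shows "square_integrable M (laplacian \<eta>)"
proof -
  have "square_integrable M (\<lambda>x. \<Sum>i\<in>I. cgrad (\<lambda>y. cgrad \<eta> y $ i) x $ i)" if "finite I" for I
    using that
  proof (induction I rule: finite_induct)
    case (insert i I)
    then show ?case
      by (simp del: cgrad_nth) (intro square_integrable_add test_square_integrable(1)[OF test_functions_partial[OF test_functions_partial[OF assms]]])
  qed simp
  then show ?thesis unfolding laplacian_def[abs_def] by simp
qed

text \<open>Moving the derivative of \<open>u\<close> onto the test function as well leaves a
  pairing with \<open>u\<close> itself, so L^2 convergence of functions identifies the weak limit of
  their gradients.\<close>

lemma integral_grad_test:
  assumes u: "grad_pair u G" and \<eta>: "\<eta> \<in> test_functions \<Omega>"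
  shows "(LINT x|M. G x \<bullet> cgrad \<eta> x) = - (LINT x|M. u x * laplacian \<eta> x)"
proof -
  note si = grad_pair_square_integrable[OF u]
  have p: "(\<lambda>y. cgrad \<eta> y $ i) \<in> test_functions \<Omega>" for i by (rule test_functions_partial[OF \<eta>])
  have i1: "integrable M (\<lambda>x. G x $ i * cgrad \<eta> x $ i)" for i
    by (rule integrable_mult_test[OF Omega_sets has_weak_gradient_integrable(2)[OF grad_pair_weak_gradient[OF u]] p])
  have i2: "integrable M (\<lambda>x. u x * cgrad (\<lambda>y. cgrad \<eta> y $ i) x $ i)" for i
    by (rule integrable_mult_test[OF Omega_sets has_weak_gradient_integrable(1)[OF grad_pair_weak_gradient[OF u]] test_functions_partial[OF p]])
  have "(LINT x|M. G x \<bullet> cgrad \<eta> x) = (\<Sum>i\<in>UNIV. LINT x|M. G x $ i * cgrad \<eta> x $ i)"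
    unfolding inner_vec_def using i1 by (subst Bochner_Integration.integral_sum[symmetric]) auto
  also have "\<dots> = (\<Sum>i\<in>UNIV. - (LINT x|M. u x * cgrad (\<lambda>y. cgrad \<eta> y $ i) x $ i))"
    using has_weak_gradientD[OF grad_pair_weak_gradient[OF u] p] by (simp del: cgrad_nth)
  also have "\<dots> = - (LINT x|M. u x * laplacian \<eta> x)"
    unfolding laplacian_def sum_distrib_left sum_negf
    using i2 by (subst Bochner_Integration.integral_sum) auto
  finally show ?thesis .
qed

end

section \<open>Weak limits\<close>

text \<open>Midpoints are the only convex combinations that the parallelogram law uses. Function and
  gradient are generated together, so that each element of the hull still is a gradient
  pair.\<close>

inductive mid_closure ::
    "(('x \<Rightarrow> real) \<times> ('x \<Rightarrow> 'b::real_vector)) set \<Rightarrow> ('x \<Rightarrow> real) \<Rightarrow> ('x \<Rightarrow> 'b) \<Rightarrow> bool" for S where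
  base: "(v, H) \<in> S \<Longrightarrow> mid_closure S v H"
| mid: "mid_closure S v H \<Longrightarrow> mid_closure S v' H' \<Longrightarrow>
    mid_closure S (\<lambda>x. (1/2) * v x + (1/2) * v' x) (\<lambda>x. (1/2) *\<^sub>R H x + (1/2) *\<^sub>R H' x)"

lemma mid_closure_mono:
  assumes "mid_closure S v H" "S \<subseteq> S'" shows "mid_closure S' v H"
  using assms(1)
proof (induction rule: mid_closure.induct)
  case (base v H)
  then show ?case using assms(2) by (auto intro: mid_closure.base)
next
  case (mid v H v' H')
  show ?case by (rule mid_closure.mid[OF mid.IH])
qed

lemma sqnorm_midpoint_le:
  assumes "square_integrable M f" "square_integrable M g"
  shows "sqnorm M (\<lambda>x. (1/2) *\<^sub>R f x + (1/2) *\<^sub>R g x) \<le> (sqnorm M f + sqnorm M g) / 2"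
  using sqnorm_add_le[OF square_integrable_scaleR[OF assms(1), of "1/2"] square_integrable_scaleR[OF assms(2), of "1/2"]]
  by (simp only: sqnorm_scaleR) (simp add: power2_eq_square)

lemma sqnorm_parallelogram:
  assumes "square_integrable M f" "square_integrable M g"
  shows "sqnorm M (\<lambda>x. f x - g x) = 2 * sqnorm M f + 2 * sqnorm M g - 4 * sqnorm M (\<lambda>x. (1/2) *\<^sub>R f x + (1/2) *\<^sub>R g x)"
proof -
  have "sqnorm M (\<lambda>x. (1/2) *\<^sub>R f x + (1/2) *\<^sub>R g x) = (1/4) * sqnorm M (\<lambda>x. f x + g x)"
    using sqnorm_scaleR[of M "1/2" "\<lambda>x. f x + g x"] by (simp add: scaleR_add_right power2_eq_square)
  then show ?thesis using sqnorm_diff[OF assms] sqnorm_add[OF assms] by simp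
qed

context bounded_open_set
begin

lemma mid_closure_grad_pair:
  assumes "mid_closure S v H" "\<And>v H. (v, H) \<in> S \<Longrightarrow> grad_pair v H"
  shows "grad_pair v H"
  using assms(1)
proof (induction rule: mid_closure.induct)
  case (base v H)
  then show ?case by (rule assms(2))
next
  case (mid v H v' H')
  show ?case by (rule grad_pair_lin[OF mid.IH])
qed

text \<open>Balls in L^2 are stable under midpoints, so the hull of a tail stays as close to
  \<open>u0\<close> as the tail itself.\<close>

lemma mid_closure_sqnorm_le:
  assumes "mid_closure S v H" "\<And>v H. (v, H) \<in> S \<Longrightarrow> grad_pair v H"
    and u0: "square_integrable M u0" and le: "\<And>v H. (v, H) \<in> S \<Longrightarrow> sqnorm M (\<lambda>x. v x - u0 x) \<le> d"
  shows "sqnorm M (\<lambda>x. v x - u0 x) \<le> d"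
  using assms(1)
proof (induction rule: mid_closure.induct)
  case (base v H)
  then show ?case by (rule le)
next
  case (mid v H v' H')
  have s: "square_integrable M (\<lambda>x. v x - u0 x)" "square_integrable M (\<lambda>x. v' x - u0 x)"
    using mid_closure_grad_pair[OF mid.hyps(1) assms(2)] mid_closure_grad_pair[OF mid.hyps(2) assms(2)]
    by (auto intro!: square_integrable_diff u0 intro: grad_pair_square_integrable)
  have "(\<lambda>x. (1/2) * v x + (1/2) * v' x - u0 x) = (\<lambda>x. (1/2) *\<^sub>R (v x - u0 x) + (1/2) *\<^sub>R (v' x - u0 x))"
    by (auto simp: field_simps)
  then have "sqnorm M (\<lambda>x. (1/2) * v x + (1/2) * v' x - u0 x) \<le> (sqnorm M (\<lambda>x. v x - u0 x) + sqnorm M (\<lambda>x. v' x - u0 x)) / 2"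
    using sqnorm_midpoint_le[OF s] by (simp only:)
  also have "\<dots> \<le> d" using mid.IH by simp
  finally show ?case .
qed

text \<open>Elements of almost minimal gradient norm in the midpoint-closed hulls of the tails are a
  Cauchy sequence by the parallelogram law; this replaces weak compactness and Mazur's lemma.\<close>

lemma grad_pair_tail_limit:
  assumes p: "\<And>n::nat. grad_pair (u n) (G n)" and bd: "\<And>n. sqnorm M (G n) \<le> B"
    and u0: "square_integrable M u0" and lim: "(\<lambda>n. sqnorm M (\<lambda>x. u n x - u0 x)) \<longlonglongrightarrow> 0"
  shows "\<exists>G0. grad_pair u0 G0"
proof -
  define S where "S = (\<lambda>N. {(u n, G n) | n. n \<ge> N})"
  have Sp: "grad_pair v H" if "(v, H) \<in> S N" for v H N using that p by (auto simp: S_def)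
  have mono: "mid_closure (S N) v H" if "mid_closure (S N') v H" "N \<le> N'" for N N' v H
    using that(1) by (rule mid_closure_mono) (use that(2) in \<open>auto simp: S_def\<close>)
  define V where "V = (\<lambda>N. {sqnorm M H | v H. mid_closure (S N) v H})"
  \<comment> \<open>The infima over shrinking hulls increase and are bounded by \<open>B\<close>;
    their convergence supplies the Cauchy modulus.\<close>
  define c where "c = (\<lambda>N. Inf (V N))"
  have bdd: "bdd_below (V N)" for N by (rule bdd_belowI[of _ 0]) (auto simp: V_def)
  have inV: "sqnorm M H \<in> V N" if "mid_closure (S N) v H" for v H N using that by (auto simp: V_def)
  have base: "mid_closure (S N) (u N) (G N)" for N by (rule mid_closure.base) (auto simp: S_def)
  have ne: "V N \<noteq> {}" for N using inV[OF base] by blast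
  have c_le: "c N \<le> sqnorm M H" if "mid_closure (S N) v H" for v H N
    unfolding c_def by (rule cInf_lower[OF inV[OF that] bdd])
  have cB: "c N \<le> B" for N using c_le[OF base] bd by (rule order.trans)
  have "incseq c"
  proof (rule incseq_SucI)
    fix N
    show "c N \<le> c (Suc N)"
      unfolding c_def
    proof (rule cInf_superset_mono[OF ne bdd])
      show "V (Suc N) \<subseteq> V N" using mono[of "Suc N" _ _ N] by (auto simp: V_def)
    qed
  qed
  then obtain cs where cs: "c \<longlonglongrightarrow> cs" "\<And>N. c N \<le> cs"
    using incseq_convergent[of c B] cB by metis
  have "\<exists>w. \<forall>N. mid_closure (S N) (fst (w N)) (snd (w N)) \<and> sqnorm M (snd (w N)) < c N + inverse (real (Suc N))"
  proof (rule choice, rule allI)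
    fix N
    have "Inf (V N) < c N + inverse (real (Suc N))" by (simp add: c_def)
    then obtain y where "y \<in> V N" "y < c N + inverse (real (Suc N))"
      using cInf_lessD[OF ne] by blast
    then obtain v H where "mid_closure (S N) v H" "sqnorm M H < c N + inverse (real (Suc N))"
      by (auto simp: V_def)
    then show "\<exists>w. mid_closure (S N) (fst w) (snd w) \<and> sqnorm M (snd w) < c N + inverse (real (Suc N))"
      by (intro exI[of _ "(v, H)"]) auto
  qed
  then obtain w where w: "\<And>N. mid_closure (S N) (fst (w N)) (snd (w N))"
      and wc: "\<And>N. sqnorm M (snd (w N)) < c N + inverse (real (Suc N))" by blast
  have wp: "grad_pair (fst (w N)) (snd (w N))" for N
    by (rule mid_closure_grad_pair[OF w Sp])
  note ws = grad_pair_square_integrable[OF wp]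
  have "\<exists>G0. square_integrable M G0 \<and> (\<lambda>n. sqnorm M (\<lambda>x. snd (w n) x - G0 x)) \<longlonglongrightarrow> 0"
  proof (rule square_integrable_complete[OF ws(2)])
    fix e :: real assume e: "e > 0"
    have "(\<lambda>N. 4 * (cs - c N) + 4 * inverse (real (Suc N))) \<longlonglongrightarrow> 4 * (cs - cs) + 4 * 0"
      by (intro tendsto_intros cs LIMSEQ_inverse_real_of_nat)
    then have "\<forall>\<^sub>F N in sequentially. 4 * (cs - c N) + 4 * inverse (real (Suc N)) < e"
      using e by (intro order_tendstoD(2)) auto
    then obtain N where N: "4 * (cs - c N) + 4 * inverse (real (Suc N)) < e"
      using eventually_happens'[OF sequentially_bot] by force
    \<comment> \<open>\<open>P\<close> is the squared norm of the midpoint, hence at least c N,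
      while both end points have squared norm below cs + 1 / (N + 1). The parallelogram law leaves
      less than 4 (cs - c N) + 4 / (N + 1).\<close>
    have arith: "A < e'" if "cN \<le> P" "A = 2 * a + 2 * b - 4 * P" "im \<le> iN" "i' \<le> iN" "a < cm + im" "b < cn + i'"
      "cm \<le> cl" "cn \<le> cl" "4 * (cl - cN) + 4 * iN < e'" for A a b P cN cm cn cl im i' iN e' :: real
    proof -
      have "a < cl + iN" "b < cl + iN" using that by linarith+
      then show ?thesis using that(1,2,9) by argo
    qed
    have "sqnorm M (\<lambda>x. snd (w m) x - snd (w n) x) < e" if mn: "m \<ge> N" "n \<ge> N" for m n
    proof -
      define P where "P = sqnorm M (\<lambda>x. (1/2) *\<^sub>R snd (w m) x + (1/2) *\<^sub>R snd (w n) x)"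
      have "c N \<le> P"
        unfolding P_def by (rule c_le[OF mid_closure.mid[OF mono[OF w mn(1)] mono[OF w mn(2)]]])
      moreover have "sqnorm M (\<lambda>x. snd (w m) x - snd (w n) x) = 2 * sqnorm M (snd (w m)) + 2 * sqnorm M (snd (w n)) - 4 * P"
        unfolding P_def by (rule sqnorm_parallelogram[OF ws(2) ws(2)])
      moreover have "inverse (real (Suc m)) \<le> inverse (real (Suc N))" "inverse (real (Suc n)) \<le> inverse (real (Suc N))"
        using mn by (auto intro!: le_imp_inverse_le)
      ultimately show ?thesis
        using wc[of m] wc[of n] cs(2)[of m] cs(2)[of n] N by (rule arith)
    qed
    then show "\<exists>N. \<forall>m\<ge>N. \<forall>n\<ge>N. sqnorm M (\<lambda>x. snd (w m) x - snd (w n) x) < e" by blast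
  qed
  then obtain G0 where G0: "square_integrable M G0" "(\<lambda>n. sqnorm M (\<lambda>x. snd (w n) x - G0 x)) \<longlonglongrightarrow> 0" by blast
  have "(\<lambda>n. sqnorm M (\<lambda>x. fst (w n) x - u0 x)) \<longlonglongrightarrow> 0"
  proof (rule LIMSEQ_I)
    fix e :: real assume e: "e > 0"
    then have "\<forall>\<^sub>F n in sequentially. sqnorm M (\<lambda>x. u n x - u0 x) < e / 2"
      by (intro order_tendstoD(2)[OF lim]) auto
    then obtain N where N: "\<And>n. n \<ge> N \<Longrightarrow> sqnorm M (\<lambda>x. u n x - u0 x) < e / 2"
      by (auto simp: eventually_sequentially)
    have "sqnorm M (\<lambda>x. fst (w n) x - u0 x) \<le> e / 2" if "n \<ge> N" for n
      by (rule mid_closure_sqnorm_le[OF w Sp u0]) (use that N in \<open>auto simp: S_def intro!: less_imp_le\<close>)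
    then show "\<exists>N. \<forall>n\<ge>N. norm (sqnorm M (\<lambda>x. fst (w n) x - u0 x) - 0) < e"
      using e by (intro exI[of _ N]) fastforce
  qed
  from grad_pair_limit[OF wp u0 G0(1) this G0(2)] show ?thesis by blast
qed

text \<open>Against the gradient of a test function the pairing is an integral of \<open>u n\<close>
  with a Laplacian and converges; bounded gradients and the density of test functions extend this to
  all \<open>H\<close>.\<close>

lemma grad_weak_convergence:
  assumes p: "\<And>n::nat. grad_pair (u n) (G n)" and bd: "\<And>n. sqnorm M (G n) \<le> B"
    and u0: "grad_pair u0 G0" and lim: "(\<lambda>n. sqnorm M (\<lambda>x. u n x - u0 x)) \<longlonglongrightarrow> 0"
    and v: "grad_pair v H"
  shows "(\<lambda>n. LINT x|M. G n x \<bullet> H x) \<longlonglongrightarrow> (LINT x|M. G0 x \<bullet> H x)"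
proof -
  note s = grad_pair_square_integrable[OF p] grad_pair_square_integrable[OF u0] grad_pair_square_integrable[OF v]
  define K where "K = 2 * B + 2 * sqnorm M G0 + 1"
  have "B \<ge> 0" using bd[of 0] sqnorm_nonneg order.trans by blast
  then have K: "K > 0" by (simp add: K_def add_nonneg_pos)
  have sD: "square_integrable M (\<lambda>x. G n x - G0 x)" for n by (intro square_integrable_diff s)
  have KD: "sqnorm M (\<lambda>x. G n x - G0 x) \<le> K" for n
    using sqnorm_diff_le[OF s(2)[of n] s(4)] bd[of n] by (simp add: K_def)
  have "(\<lambda>n. LINT x|M. (G n x - G0 x) \<bullet> H x) \<longlonglongrightarrow> 0"
  proof (rule LIMSEQ_I)
    fix e :: real assume e: "e > 0"
    \<comment> \<open>Cauchy--Schwarz bounds the approximation error by the square root of K d,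
      which is e / 2.\<close>
    define d where "d = (e / 2)\<^sup>2 / K"
    have d: "d > 0" using e K by (simp add: d_def)
    obtain \<eta> where \<eta>: "\<eta> \<in> test_functions \<Omega>" "sqnorm M (\<lambda>x. cgrad \<eta> x - H x) < d"
      using grad_pair_approx[OF v d] by blast
    note s\<eta> = test_square_integrable(2)[OF \<eta>(1)]
    have "(\<lambda>n. LINT x|M. u n x * laplacian \<eta> x) \<longlonglongrightarrow> (LINT x|M. u0 x * laplacian \<eta> x)"
      using integral_inner_tendsto[OF s(1) s(3) square_integrable_laplacian[OF \<eta>(1)] lim]
      by (simp only: inner_real_def)
    then have "(\<lambda>n. (LINT x|M. u0 x * laplacian \<eta> x) - (LINT x|M. u n x * laplacian \<eta> x)) \<longlonglongrightarrow> 0"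
      using tendsto_diff[OF tendsto_const[of "LINT x|M. u0 x * laplacian \<eta> x"]] by fastforce
    then have "\<forall>\<^sub>F n in sequentially. norm ((LINT x|M. u0 x * laplacian \<eta> x) - (LINT x|M. u n x * laplacian \<eta> x)) < e / 2"
      using e by (intro order_tendstoD(2)[OF tendsto_norm_zero]) simp_all
    then obtain N where N: "\<And>n. n \<ge> N \<Longrightarrow> \<bar>(LINT x|M. u0 x * laplacian \<eta> x) - (LINT x|M. u n x * laplacian \<eta> x)\<bar> < e / 2"
      by (auto simp: eventually_sequentially)
    have "\<bar>LINT x|M. (G n x - G0 x) \<bullet> H x\<bar> < e" if n: "n \<ge> N" for n
    proof -
      have sH: "square_integrable M (\<lambda>x. H x - cgrad \<eta> x)" by (intro square_integrable_diff s s\<eta>)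
      have "(LINT x|M. (G n x - G0 x) \<bullet> H x) =
          (LINT x|M. (G n x - G0 x) \<bullet> cgrad \<eta> x) + (LINT x|M. (G n x - G0 x) \<bullet> (H x - cgrad \<eta> x))"
        using square_integrable_inner[OF sD s\<eta>] square_integrable_inner[OF sD sH]
        by (subst Bochner_Integration.integral_add[symmetric]) (auto simp: inner_simps)
      moreover have "(LINT x|M. (G n x - G0 x) \<bullet> cgrad \<eta> x) =
          (LINT x|M. u0 x * laplacian \<eta> x) - (LINT x|M. u n x * laplacian \<eta> x)"
        using integral_grad_test[OF p \<eta>(1), of n] integral_grad_test[OF u0 \<eta>(1)]
          square_integrable_inner[OF s(2) s\<eta>, of n] square_integrable_inner[OF s(4) s\<eta>]
        by (simp add: inner_diff_left)
      moreover have "\<bar>LINT x|M. (G n x - G0 x) \<bullet> (H x - cgrad \<eta> x)\<bar> < e / 2"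
      proof (rule power_less_imp_less_base[of _ 2])
        have "\<bar>LINT x|M. (G n x - G0 x) \<bullet> (H x - cgrad \<eta> x)\<bar>\<^sup>2
            \<le> sqnorm M (\<lambda>x. G n x - G0 x) * sqnorm M (\<lambda>x. H x - cgrad \<eta> x)"
          using integral_Cauchy_Schwarz[OF sD[of n] sH] by simp
        also have "\<dots> \<le> K * sqnorm M (\<lambda>x. H x - cgrad \<eta> x)"
          by (intro mult_right_mono KD sqnorm_nonneg)
        also have "\<dots> < K * d"
          using \<eta>(2) K by (subst sqnorm_minus_commute) simp
        also have "\<dots> = (e / 2)\<^sup>2" using K by (simp add: d_def)
        finally show "\<bar>LINT x|M. (G n x - G0 x) \<bullet> (H x - cgrad \<eta> x)\<bar>\<^sup>2 < (e / 2)\<^sup>2" .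
      qed (use e in simp)
      ultimately show ?thesis using N[OF n] by linarith
    qed
    then show "\<exists>N. \<forall>n\<ge>N. norm ((LINT x|M. (G n x - G0 x) \<bullet> H x) - 0) < e" by auto
  qed
  moreover have "(LINT x|M. (G n x - G0 x) \<bullet> H x) = (LINT x|M. G n x \<bullet> H x) - (LINT x|M. G0 x \<bullet> H x)" for n
    using square_integrable_inner[OF s(2) s(6), of n] square_integrable_inner[OF s(4) s(6)]
    by (simp add: inner_diff_left)
  ultimately show ?thesis by (simp add: LIM_zero_iff)
qed

end

section \<open>Rellich compactness\<close>

text \<open>Half-open cubes, so that they are pairwise disjoint and still cover the space.\<close>

definition grid_cell :: "real \<Rightarrow> ('a::euclidean_space \<Rightarrow> int) \<Rightarrow> 'a set" where
  "grid_cell h k = {y. \<forall>b\<in>Basis. h * of_int (k b) \<le> y \<bullet> b \<and> y \<bullet> b < h * (of_int (k b) + 1)}"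

text \<open>\<open>PiE\<close> fixes the values off the basis; otherwise one cube would have many
  indices and the index set would be infinite.\<close>

definition grid_index :: "int \<Rightarrow> ('a::euclidean_space \<Rightarrow> int) set" where
  "grid_index N = PiE Basis (\<lambda>_. {-N..N})"

lemma finite_grid_index: "finite (grid_index N)"
  unfolding grid_index_def by (intro finite_PiE) auto

lemma grid_cell_borel [measurable]: "grid_cell h k \<in> sets borel"
proof -
  have "grid_cell h k = {y \<in> space borel. \<forall>b\<in>Basis. h * of_int (k b) \<le> y \<bullet> b \<and> y \<bullet> b < h * (of_int (k b) + 1)}"
    by (simp add: grid_cell_def)
  also have "\<dots> \<in> sets borel" by measurable
  finally show ?thesis .
qed

lemma grid_cell_floor: "h > 0 \<Longrightarrow> y \<in> grid_cell h k \<Longrightarrow> b \<in> Basis \<Longrightarrow> k b = \<lfloor>(y \<bullet> b) / h\<rfloor>"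
  by (auto simp: grid_cell_def field_simps intro!: floor_unique[symmetric])

lemma grid_cell_disjoint:
  assumes "h > 0" "k \<in> grid_index N" "k' \<in> grid_index N" "y \<in> grid_cell h k" "y \<in> grid_cell h k'"
  shows "k = k'"
proof
  fix b
  show "k b = k' b"
  proof (cases "b \<in> Basis")
    case True
    then show ?thesis using grid_cell_floor assms by metis
  next
    case False
    then show ?thesis
      using PiE_arb[OF assms(2)[unfolded grid_index_def]] PiE_arb[OF assms(3)[unfolded grid_index_def]] by simp
  qed
qed

lemma sum_indicator_grid_cell_le:
  assumes "h > 0" shows "(\<Sum>k\<in>grid_index N. indicator (grid_cell h k) y) \<le> (1::ennreal)"
proof (cases "\<exists>k\<in>grid_index N. y \<in> grid_cell h k")
  case True
  then obtain k where k: "k \<in> grid_index N" "y \<in> grid_cell h k" by blast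
  have "indicator (grid_cell h k') y = (0::ennreal)" if "k' \<in> grid_index N - {k}" for k'
    using that grid_cell_disjoint[OF assms _ k(1) _ k(2), of k'] by (simp add: indicator_def) blast
  then have "(\<Sum>k\<in>grid_index N. indicator (grid_cell h k) y :: ennreal) = (\<Sum>k\<in>{k}. indicator (grid_cell h k) y)"
    using k(1) finite_grid_index by (intro sum.mono_neutral_right) auto
  then show ?thesis using k by simp
next
  case False
  then show ?thesis by (simp add: indicator_def)
qed

text \<open>The extra 1 in the bound for \<open>N\<close> absorbs the rounding down at the negative
  end.\<close>

lemma grid_cell_cover:
  assumes h: "h > 0" and x: "norm x \<le> R" and N: "R / h + 1 \<le> of_int N"
  shows "\<exists>k\<in>grid_index N. x \<in> grid_cell h k"
proof
  define k where "k = (\<lambda>b\<in>Basis. \<lfloor>(x \<bullet> b) / h\<rfloor>)"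
  show "x \<in> grid_cell h k"
    unfolding grid_cell_def k_def
  proof (intro CollectI ballI)
    fix b :: 'a assume b: "b \<in> Basis"
    define t where "t = (x \<bullet> b) / h"
    have "h * of_int \<lfloor>t\<rfloor> \<le> h * t" using h by (intro mult_left_mono) auto
    moreover have "h * t < h * (of_int \<lfloor>t\<rfloor> + 1)" using h by (intro mult_strict_left_mono) (linarith, simp)
    moreover have "h * t = x \<bullet> b" using h by (simp add: t_def)
    ultimately show "h * of_int ((\<lambda>b\<in>Basis. \<lfloor>(x \<bullet> b) / h\<rfloor>) b) \<le> x \<bullet> b \<and> x \<bullet> b < h * (of_int ((\<lambda>b\<in>Basis. \<lfloor>(x \<bullet> b) / h\<rfloor>) b) + 1)"
      using b by (simp add: t_def)
  qed
  show "k \<in> grid_index N"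
    unfolding grid_index_def k_def
  proof (rule restrict_PiE_iff[THEN iffD2], rule ballI)
    fix b :: 'a assume b: "b \<in> Basis"
    have "\<bar>x \<bullet> b\<bar> \<le> R" using Basis_le_norm[OF b, of x] x by linarith
    then have "\<bar>(x \<bullet> b) / h\<bar> \<le> R / h" using h by (simp add: divide_right_mono)
    then show "\<lfloor>(x \<bullet> b) / h\<rfloor> \<in> {-N..N}" using N by (auto; linarith)
  qed
qed

lemma grid_cell_measure:
  fixes k :: "'a::euclidean_space \<Rightarrow> int"
  assumes h: "h > 0"
  shows "emeasure lborel (grid_cell h k) < \<infinity>" "h ^ DIM('a) \<le> measure lborel (grid_cell h k)"
proof -
  define a b where "a = (\<Sum>i\<in>Basis. (h * of_int (k i)) *\<^sub>R i)" and "b = (\<Sum>i\<in>Basis. (h * (of_int (k i) + 1)) *\<^sub>R i)"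
  have ab: "a \<bullet> i = h * of_int (k i)" "b \<bullet> i = h * (of_int (k i) + 1)" if "i \<in> Basis" for i
    using that by (auto simp: a_def b_def)
  have s: "box a b \<subseteq> grid_cell h k" "grid_cell h k \<subseteq> cbox a b"
    by (auto simp: grid_cell_def mem_box ab less_imp_le)
  have "emeasure lborel (grid_cell h k) \<le> emeasure lborel (cbox a b)"
    by (intro emeasure_mono s) auto
  also have "\<dots> < \<infinity>" by (rule emeasure_lborel_cbox_finite)
  finally show fin: "emeasure lborel (grid_cell h k) < \<infinity>" .
  have "ennreal (h ^ DIM('a)) = emeasure lborel (box a b)"
    using h by (simp add: emeasure_lborel_box_eq ab inner_diff_left algebra_simps)
  also have "\<dots> \<le> emeasure lborel (grid_cell h k)"
    by (intro emeasure_mono s) auto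
  also have "\<dots> = ennreal (measure lborel (grid_cell h k))"
    using fin by (simp add: emeasure_eq_ennreal_measure)
  finally show "h ^ DIM('a) \<le> measure lborel (grid_cell h k)" by simp
qed

lemma grid_cell_diff:
  assumes "x \<in> grid_cell h k" "y \<in> grid_cell h k"
  shows "y - x \<in> cbox (- (h *\<^sub>R One)) (h *\<^sub>R One)"
proof -
  have "\<bar>(y - x) \<bullet> b\<bar> \<le> h" if "b \<in> Basis" for b
    using assms that by (fastforce simp: grid_cell_def inner_diff_left algebra_simps)
  then show ?thesis by (auto simp: mem_box abs_le_iff) (smt (verit))
qed

section \<open>A Poincare inequality with cell averages\<close>

lemma nn_integral_lborel_translate:
  assumes "f \<in> borel_measurable borel"
  shows "(\<integral>\<^sup>+y. f y \<partial>lborel) = (\<integral>\<^sup>+z. f (x + z :: 'a::euclidean_space) \<partial>lborel)"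
proof -
  have "(\<integral>\<^sup>+y. f y \<partial>lborel) = (\<integral>\<^sup>+y. f y \<partial>distr lborel borel ((+) x))"
    by (simp add: lborel_distr_plus)
  also have "\<dots> = (\<integral>\<^sup>+z. f (x + z) \<partial>lborel)"
    using assms by (subst nn_integral_distr) auto
  finally show ?thesis .
qed

text \<open>The variance identity, obtained by expanding the square. Read in reverse it bounds the
  L^2 norm on a cell by the cell average and by differences of values, which the translation
  estimate controls. It is stated for nonnegative integrals to leave Tonelli's theorem
  available.\<close>

lemma double_integral_cell:
  fixes \<psi> :: "real^3 \<Rightarrow> real"
  assumes \<psi>: "\<psi> \<in> test_functions UNIV" and Q: "Q \<in> sets borel" "emeasure lborel Q < \<infinity>"
  shows "(\<integral>\<^sup>+x. indicator Q x * (\<integral>\<^sup>+y. indicator Q y * ennreal ((\<psi> y - \<psi> x)\<^sup>2) \<partial>lborel) \<partial>lborel) =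
    ennreal (2 * measure lborel Q * (LINT x|lborel. indicator Q x * (\<psi> x)\<^sup>2) - 2 * (LINT x|lborel. indicator Q x * \<psi> x)\<^sup>2)"
proof -
  define q s m where "q = measure lborel Q" and "s = (LINT x|lborel. indicator Q x * (\<psi> x)\<^sup>2)"
    and "m = (LINT x|lborel. indicator Q x * \<psi> x)"
  have [measurable]: "\<psi> \<in> borel_measurable borel" by (rule borel_smooth[OF test_functions_smooth[OF \<psi>]])
  note [measurable] = Q(1)
  have "integrable lborel (\<lambda>x. indicator Q x *\<^sub>R (\<psi> x * \<psi> x))"
    by (rule integrable_mult_indicator) (use Q test_functions_integrable[OF test_functions_mult[OF \<psi> \<psi>]] in auto)
  then have i2: "integrable lborel (\<lambda>x. indicator Q x * (\<psi> x)\<^sup>2)" by (simp add: power2_eq_square)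
  have "integrable lborel (\<lambda>x. indicator Q x *\<^sub>R \<psi> x)"
    by (rule integrable_mult_indicator) (use Q test_functions_integrable[OF \<psi>] in auto)
  then have i1: "integrable lborel (\<lambda>x. indicator Q x * \<psi> x)" by simp
  have i0: "integrable lborel (indicator Q :: _ \<Rightarrow> real)" using Q by simp
  have inner_expand: "indicator Q y * (\<psi> y - c)\<^sup>2 = indicator Q y * (\<psi> y)\<^sup>2 - 2 * c * (indicator Q y * \<psi> y) + c\<^sup>2 * indicator Q y" for y c
    by (simp add: power2_eq_square algebra_simps)
  have q: "(LINT x|lborel. indicator Q x) = q" using Q by (simp add: q_def)
  have inner: "(\<integral>\<^sup>+y. indicator Q y * ennreal ((\<psi> y - c)\<^sup>2) \<partial>lborel) = ennreal (s - 2 * c * m + c\<^sup>2 * q)" for c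
  proof -
    have "(\<integral>\<^sup>+y. indicator Q y * ennreal ((\<psi> y - c)\<^sup>2) \<partial>lborel) = (\<integral>\<^sup>+y. ennreal (indicator Q y * (\<psi> y - c)\<^sup>2) \<partial>lborel)"
      by (intro nn_integral_cong) (auto simp: indicator_def)
    also have "\<dots> = ennreal (LINT y|lborel. indicator Q y * (\<psi> y - c)\<^sup>2)"
    proof (rule nn_integral_eq_integral)
      show "integrable lborel (\<lambda>y. indicator Q y * (\<psi> y - c)\<^sup>2)"
        unfolding inner_expand using i0 i1 i2 by simp
    qed simp
    also have "(LINT y|lborel. indicator Q y * (\<psi> y - c)\<^sup>2) = s - 2 * c * m + c\<^sup>2 * q"
      unfolding inner_expand using i0 i1 i2 q by (simp add: s_def m_def)
    finally show ?thesis .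
  qed
  have nonneg: "0 \<le> s - 2 * c * m + c\<^sup>2 * q" for c
  proof -
    have "(LINT y|lborel. indicator Q y * (\<psi> y - c)\<^sup>2) = s - 2 * c * m + c\<^sup>2 * q"
      unfolding inner_expand using i0 i1 i2 q by (simp add: s_def m_def)
    moreover have "0 \<le> (LINT y|lborel. indicator Q y * (\<psi> y - c)\<^sup>2)" by (intro Bochner_Integration.integral_nonneg) simp
    ultimately show ?thesis by simp
  qed
  have outer_expand: "indicator Q x * (s - 2 * \<psi> x * m + (\<psi> x)\<^sup>2 * q) =
      s * indicator Q x - 2 * m * (indicator Q x * \<psi> x) + q * (indicator Q x * (\<psi> x)\<^sup>2)" for x
    by (simp add: algebra_simps)
  have "(\<integral>\<^sup>+x. indicator Q x * (\<integral>\<^sup>+y. indicator Q y * ennreal ((\<psi> y - \<psi> x)\<^sup>2) \<partial>lborel) \<partial>lborel)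
      = (\<integral>\<^sup>+x. ennreal (indicator Q x * (s - 2 * \<psi> x * m + (\<psi> x)\<^sup>2 * q)) \<partial>lborel)"
    unfolding inner by (intro nn_integral_cong) (auto simp: indicator_def)
  also have "\<dots> = ennreal (LINT x|lborel. indicator Q x * (s - 2 * \<psi> x * m + (\<psi> x)\<^sup>2 * q))"
  proof (rule nn_integral_eq_integral)
    show "integrable lborel (\<lambda>x. indicator Q x * (s - 2 * \<psi> x * m + (\<psi> x)\<^sup>2 * q))"
      unfolding outer_expand using i0 i1 i2 by simp
  qed (use nonneg in auto)
  also have "(LINT x|lborel. indicator Q x * (s - 2 * \<psi> x * m + (\<psi> x)\<^sup>2 * q)) = s * q - 2 * m * m + q * s"
    unfolding outer_expand using i0 i1 i2 q by (simp add: s_def m_def)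
  finally show ?thesis by (simp add: q_def s_def m_def power2_eq_square algebra_simps)
qed

text \<open>Integrating \<open>(\<psi> y - \<psi> x)\<^sup>2\<close> over the square of each cell and substituting \<open>y = x + z\<close> leaves \<open>z\<close> in a
  cube of volume \<open>8 h\<^sup>3\<close> on which \<open>\<bar>z\<bar>\<^sup>2 \<le> 3 h\<^sup>2\<close>; half of the product with \<open>1 / h\<^sup>3\<close> is the constant \<open>12 h\<^sup>2\<close>.\<close>

lemma grid_Poincare:
  fixes \<psi> :: "real^3 \<Rightarrow> real"
  assumes \<psi>: "\<psi> \<in> test_functions UNIV" and h: "h > 0"
    and cover: "\<And>x. \<psi> x \<noteq> 0 \<Longrightarrow> \<exists>k\<in>grid_index N. x \<in> grid_cell h k"
  shows "(LINT x|lborel. (\<psi> x)\<^sup>2) \<le>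
    (\<Sum>k\<in>grid_index N. (LINT x|lborel. indicator (grid_cell h k) x * \<psi> x)\<^sup>2) / h^3
      + 12 * h\<^sup>2 * (LINT x|lborel. (norm (cgrad \<psi> x))\<^sup>2)"
proof -
  define D :: "(real^3) set" where "D = cbox (- (h *\<^sub>R One)) (h *\<^sub>R One)"
  define E where "E = (LINT x|lborel. (norm (cgrad \<psi> x))\<^sup>2)"
  define I where "I = (\<lambda>Q. \<integral>\<^sup>+x. indicator Q x * (\<integral>\<^sup>+y. indicator Q y * ennreal ((\<psi> y - \<psi> x)\<^sup>2) \<partial>lborel) \<partial>lborel)"
  define q s m where "q = (\<lambda>k. measure lborel (grid_cell h k :: (real^3) set))"
    and "s = (\<lambda>k. LINT x|lborel. indicator (grid_cell h k) x * (\<psi> x)\<^sup>2)"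
    and "m = (\<lambda>k. LINT x|lborel. indicator (grid_cell h k) x * \<psi> x)"
  have [measurable]: "\<psi> \<in> borel_measurable borel" by (rule borel_smooth[OF test_functions_smooth[OF \<psi>]])
  have [measurable]: "cgrad \<psi> \<in> borel_measurable borel" by (rule borel_cgrad[OF test_functions_smooth[OF \<psi>]])
  have [measurable]: "D \<in> sets borel" by (simp add: D_def)
  have fin: "finite (grid_index N :: (real^3 \<Rightarrow> int) set)" by (rule finite_grid_index)
  have E: "integrable lborel (\<lambda>x. (norm (cgrad \<psi> x))\<^sup>2)" "E \<ge> 0"
    using integrable_cgrad_power[OF \<psi>, of UNIV 2] by (auto simp: E_def lebesgue_on_UNIV_eq integrable_completion)
  have trans: "(\<integral>\<^sup>+x. ennreal ((\<psi> (x + z) - \<psi> x)\<^sup>2) \<partial>lborel) \<le> ennreal (3 * h\<^sup>2 * E)" if z: "z \<in> D" for z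
  proof -
    have b: "(z \<bullet> i)\<^sup>2 \<le> h\<^sup>2" if "i \<in> Basis" for i
      using z that h by (intro abs_le_square_iff[THEN iffD1]) (auto simp: D_def mem_box abs_le_iff; fastforce)
    have "(norm z)\<^sup>2 = (\<Sum>i\<in>Basis. (z \<bullet> i)\<^sup>2)"
      unfolding power2_norm_eq_inner by (subst euclidean_inner) (simp add: power2_eq_square)
    also have "\<dots> \<le> (\<Sum>i\<in>(Basis::(real^3) set). h\<^sup>2)" by (intro sum_mono b)
    also have "\<dots> = 3 * h\<^sup>2" by simp
    finally have nz: "(norm z)\<^sup>2 \<le> 3 * h\<^sup>2" .
    have dq: "integrable lborel (\<lambda>x. (real (Suc 0) * (\<psi> (x + (1 / real (Suc 0)) *\<^sub>R z) - \<psi> x))\<^sup>2)"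
      by (rule difference_quotient(4)[OF \<psi>])
    then have iq: "integrable lborel (\<lambda>x. (\<psi> (x + z) - \<psi> x)\<^sup>2)" by simp
    have "(LINT x|lborel. (cgrad \<psi> x \<bullet> z)\<^sup>2) \<le> (LINT x|lborel. (norm z)\<^sup>2 * (norm (cgrad \<psi> x))\<^sup>2)"
    proof (rule integral_mono')
      show "(cgrad \<psi> x \<bullet> z)\<^sup>2 \<le> (norm z)\<^sup>2 * (norm (cgrad \<psi> x))\<^sup>2" for x
        using Cauchy_Schwarz_ineq[of "cgrad \<psi> x" z] by (simp add: power2_norm_eq_inner mult.commute)
    qed (use E in auto)
    also have "\<dots> \<le> 3 * h\<^sup>2 * E" using nz E by (simp add: E_def mult_right_mono)
    finally have "(LINT x|lborel. (\<psi> (x + z) - \<psi> x)\<^sup>2) \<le> 3 * h\<^sup>2 * E"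
      using integral_translation_le[OF \<psi>, of z] by linarith
    then show ?thesis using iq by (subst nn_integral_eq_integral) (auto intro: ennreal_leI)
  qed
  have cell: "I (grid_cell h k) \<le> (\<integral>\<^sup>+x. indicator (grid_cell h k) x * (\<integral>\<^sup>+z. indicator D z * ennreal ((\<psi> (x + z) - \<psi> x)\<^sup>2) \<partial>lborel) \<partial>lborel)" for k
    unfolding I_def
  proof (rule nn_integral_mono)
    fix x :: "real^3"
    show "indicator (grid_cell h k) x * (\<integral>\<^sup>+y. indicator (grid_cell h k) y * ennreal ((\<psi> y - \<psi> x)\<^sup>2) \<partial>lborel)
      \<le> indicator (grid_cell h k) x * (\<integral>\<^sup>+z. indicator D z * ennreal ((\<psi> (x + z) - \<psi> x)\<^sup>2) \<partial>lborel)"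
    proof (cases "x \<in> grid_cell h k")
      case True
      have "(\<integral>\<^sup>+y. indicator (grid_cell h k) y * ennreal ((\<psi> y - \<psi> x)\<^sup>2) \<partial>lborel) =
          (\<integral>\<^sup>+z. indicator (grid_cell h k) (x + z) * ennreal ((\<psi> (x + z) - \<psi> x)\<^sup>2) \<partial>lborel)"
        by (rule nn_integral_lborel_translate) measurable
      also have "\<dots> \<le> (\<integral>\<^sup>+z. indicator D z * ennreal ((\<psi> (x + z) - \<psi> x)\<^sup>2) \<partial>lborel)"
        using grid_cell_diff[OF True] by (intro nn_integral_mono mult_right_mono) (force simp: indicator_def D_def)+
      finally show ?thesis by (intro mult_left_mono) auto
    qed simp
  qed
  have "(\<Sum>k\<in>grid_index N. I (grid_cell h k)) \<le>
     (\<Sum>k\<in>grid_index N. \<integral>\<^sup>+x. indicator (grid_cell h k) x * (\<integral>\<^sup>+z. indicator D z * ennreal ((\<psi> (x + z) - \<psi> x)\<^sup>2) \<partial>lborel) \<partial>lborel)"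
    by (intro sum_mono cell)
  also have "\<dots> = (\<integral>\<^sup>+x. (\<Sum>k\<in>grid_index N. indicator (grid_cell h k) x) * (\<integral>\<^sup>+z. indicator D z * ennreal ((\<psi> (x + z) - \<psi> x)\<^sup>2) \<partial>lborel) \<partial>lborel)"
    unfolding sum_distrib_right by (subst nn_integral_sum) auto
  \<comment> \<open>Disjointness of the cells bounds the sum of their indicators by 1, so the cell
    index disappears.\<close>
  also have "\<dots> \<le> (\<integral>\<^sup>+x. 1 * (\<integral>\<^sup>+z. indicator D z * ennreal ((\<psi> (x + z) - \<psi> x)\<^sup>2) \<partial>lborel) \<partial>lborel)"
    by (intro nn_integral_mono mult_right_mono sum_indicator_grid_cell_le h) auto
  also have "\<dots> = (\<integral>\<^sup>+x. \<integral>\<^sup>+z. indicator D z * ennreal ((\<psi> (x + z) - \<psi> x)\<^sup>2) \<partial>lborel \<partial>lborel)" by simp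
  also have "\<dots> = (\<integral>\<^sup>+z. \<integral>\<^sup>+x. indicator D z * ennreal ((\<psi> (x + z) - \<psi> x)\<^sup>2) \<partial>lborel \<partial>lborel)"
    by (rule lborel_pair.Fubini') measurable
  also have "\<dots> \<le> (\<integral>\<^sup>+z. ennreal (3 * h\<^sup>2 * E) * indicator D z \<partial>lborel)"
    using trans by (intro nn_integral_mono) (auto simp: indicator_def)
  also have "\<dots> = ennreal (3 * h\<^sup>2 * E) * emeasure lborel D"
    by (rule nn_integral_cmult_indicator) simp
  also have "emeasure lborel D = ennreal (8 * h^3)"
  proof -
    have "emeasure lborel D = ennreal (\<Prod>b\<in>Basis. (h *\<^sub>R One - - (h *\<^sub>R One)) \<bullet> (b :: real^3))"
      unfolding D_def by (rule emeasure_lborel_cbox) (use h in simp)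
    also have "(\<Prod>b\<in>Basis. (h *\<^sub>R One - - (h *\<^sub>R One)) \<bullet> (b :: real^3)) = (\<Prod>b\<in>(Basis :: (real^3) set). 2 * h)"
      unfolding inner_diff_left inner_minus_left inner_scaleR_left by (rule prod.cong) simp_all
    finally show ?thesis by (simp add: power_mult_distrib)
  qed
  also have "ennreal (3 * h\<^sup>2 * E) * ennreal (8 * h^3) = ennreal (24 * h\<^sup>2 * h^3 * E)"
    using E h by (simp flip: ennreal_mult add: mult_ac)
  finally have main: "(\<Sum>k\<in>grid_index N. I (grid_cell h k)) \<le> ennreal (24 * h\<^sup>2 * h^3 * E)" .
  have Ik: "I (grid_cell h k) = ennreal (2 * q k * s k - 2 * (m k)\<^sup>2)" for k
    unfolding I_def q_def s_def m_def
    by (rule double_integral_cell[OF \<psi> grid_cell_borel grid_cell_measure(1)[OF h]])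
  have sk: "s k \<ge> 0" for k by (auto simp: s_def intro!: Bochner_Integration.integral_nonneg)
  define K where "K = (grid_index N :: (real^3 \<Rightarrow> int) set)"
  \<comment> \<open>\<open>ennreal\<close> truncates negative numbers to 0, so the real counterpart
    of each cell integral is a maximum with 0; it dominates the untruncated term.\<close>
  have "ennreal (\<Sum>k\<in>K. max 0 (2 * q k * s k - 2 * (m k)\<^sup>2)) = (\<Sum>k\<in>K. I (grid_cell h k))"
    unfolding Ik by (subst sum_ennreal[symmetric]) (auto simp: ennreal_max_0)
  also have "\<dots> \<le> ennreal (24 * h\<^sup>2 * h^3 * E)" using main by (simp add: K_def)
  finally have "(\<Sum>k\<in>K. max 0 (2 * q k * s k - 2 * (m k)\<^sup>2)) \<le> 24 * h\<^sup>2 * h^3 * E"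
    using h E by (subst (asm) ennreal_le_iff) auto
  \<comment> \<open>A cell has volume at least h^3, so inserting h^3 for the volume only lowers the
    left-hand side.\<close>
  moreover have "(\<Sum>k\<in>K. 2 * h^3 * s k - 2 * (m k)\<^sup>2) \<le> (\<Sum>k\<in>K. max 0 (2 * q k * s k - 2 * (m k)\<^sup>2))"
  proof (rule sum_mono)
    fix k
    have "h^3 \<le> q k" using grid_cell_measure(2)[OF h, of k] by (simp add: q_def)
    then have "h^3 * s k \<le> q k * s k" by (intro mult_right_mono sk)
    then show "2 * h^3 * s k - 2 * (m k)\<^sup>2 \<le> max 0 (2 * q k * s k - 2 * (m k)\<^sup>2)" by simp
  qed
  ultimately have le: "2 * h^3 * (\<Sum>k\<in>K. s k) - 2 * (\<Sum>k\<in>K. (m k)\<^sup>2) \<le> 24 * h\<^sup>2 * h^3 * E"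
    by (simp add: sum_subtractf sum_distrib_left)
  have i2: "integrable lborel (\<lambda>x. (\<psi> x)\<^sup>2)"
    using test_functions_integrable[OF test_functions_mult[OF \<psi> \<psi>]] by (simp add: power2_eq_square)
  have i2k: "integrable lborel (\<lambda>x. indicator (grid_cell h k) x * (\<psi> x)\<^sup>2)" for k
    using integrable_mult_indicator[OF _ i2, of "grid_cell h k"] by simp
  have "(LINT x|lborel. (\<psi> x)\<^sup>2) \<le> (LINT x|lborel. (\<Sum>k\<in>K. indicator (grid_cell h k) x * (\<psi> x)\<^sup>2))"
  proof (rule integral_mono[OF i2])
    show "integrable lborel (\<lambda>x. \<Sum>k\<in>K. indicator (grid_cell h k) x * (\<psi> x)\<^sup>2)"
      by (intro Bochner_Integration.integrable_sum i2k)
    fix x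
    show "(\<psi> x)\<^sup>2 \<le> (\<Sum>k\<in>K. indicator (grid_cell h k) x * (\<psi> x)\<^sup>2)"
    proof (cases "\<psi> x = 0")
      case False
      then obtain k where k: "k \<in> K" "x \<in> grid_cell h k" using cover unfolding K_def by blast
      have "(\<psi> x)\<^sup>2 = indicator (grid_cell h k) x * (\<psi> x)\<^sup>2" using k by simp
      also have "\<dots> \<le> (\<Sum>k\<in>K. indicator (grid_cell h k) x * (\<psi> x)\<^sup>2)"
        using fin k(1) unfolding K_def by (intro member_le_sum) auto
      finally show ?thesis .
    qed simp
  qed
  also have "\<dots> = (\<Sum>k\<in>K. s k)"
    unfolding s_def by (rule Bochner_Integration.integral_sum[OF i2k])
  finally have "2 * h^3 * (LINT x|lborel. (\<psi> x)\<^sup>2) \<le> 2 * h^3 * (\<Sum>k\<in>K. s k)"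
    using h by (intro mult_left_mono) auto
  moreover have "24 * h\<^sup>2 * h^3 * E = 2 * (h^3 * (12 * h\<^sup>2 * E))" by simp
  ultimately have "h^3 * (LINT x|lborel. (\<psi> x)\<^sup>2) \<le> (\<Sum>k\<in>K. (m k)\<^sup>2) + h^3 * (12 * h\<^sup>2 * E)"
    using le by argo
  also have "\<dots> = h^3 * ((\<Sum>k\<in>K. (m k)\<^sup>2) / h^3 + 12 * h\<^sup>2 * E)"
    using h by (simp add: distrib_left)
  finally show ?thesis
    using h by (simp add: m_def E_def K_def)
qed

section \<open>Compactness from cell averages\<close>

context bounded_open_set
begin

lemma square_integrable_indicator:
  "A \<in> sets borel \<Longrightarrow> square_integrable M (indicator A :: real^3 \<Rightarrow> real)"
proof -
  assume A: "A \<in> sets borel"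
  have m: "(indicator A :: real^3 \<Rightarrow> real) \<in> borel_measurable M"
    using A by (intro measurable_restrict_space1 measurable_completion) simp
  have "integrable M (\<lambda>x. (norm (indicator A x :: real))\<^sup>2)"
    by (rule integrable_const_bound[of _ 1])
       (auto simp: indicator_def simp del: real_norm_def intro!: measurable_compose[OF m[unfolded indicator_def]])
  with m show ?thesis by (simp add: square_integrable_def)
qed

text \<open>The norms and the finitely many cell integrals are continuous under L^2 convergence, so
  the inequality for test functions carries over.\<close>

lemma grid_Poincare_grad_pair:
  assumes u: "grad_pair u G" and h: "h > 0"
    and cover: "\<And>x. x \<in> \<Omega> \<Longrightarrow> \<exists>k\<in>grid_index N. x \<in> grid_cell h k"
  shows "sqnorm M u \<le> (\<Sum>k\<in>grid_index N. (LINT x|M. u x * indicator (grid_cell h k) x)\<^sup>2) / h^3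
      + 12 * h\<^sup>2 * sqnorm M G"
proof -
  obtain \<psi> where \<psi>: "\<And>n. \<psi> n \<in> test_functions \<Omega>" "(\<lambda>n. sqnorm M (\<lambda>x. \<psi> n x - u x)) \<longlonglongrightarrow> 0"
    "(\<lambda>n. sqnorm M (\<lambda>x. cgrad (\<psi> n) x - G x)) \<longlonglongrightarrow> 0" using grad_pairE[OF u] by blast
  note si = grad_pair_square_integrable[OF u]
  have le: "sqnorm M (\<psi> n) \<le> (\<Sum>k\<in>grid_index N. (LINT x|M. \<psi> n x * indicator (grid_cell h k) x)\<^sup>2) / h^3
      + 12 * h\<^sup>2 * sqnorm M (cgrad (\<psi> n))" for n
  proof -
    have \<psi>': "\<psi> n \<in> test_functions UNIV" using \<psi>(1) test_functions_mono by blast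
    have [measurable]: "\<psi> n \<in> borel_measurable borel" "cgrad (\<psi> n) \<in> borel_measurable borel"
      by (auto intro: borel_smooth borel_cgrad test_functions_smooth[OF \<psi>'])
    obtain K where K: "compact K" "K \<subseteq> \<Omega>" "\<And>x. x \<notin> K \<Longrightarrow> \<psi> n x = 0" using test_functionsE[OF \<psi>(1)[of n]] by blast
    have 0: "\<psi> n x = 0" "cgrad (\<psi> n) x = 0" if "x \<notin> \<Omega>" for x
      using K that cgrad_eq_0[of K "\<psi> n" x] by auto
    have e1: "sqnorm M (\<psi> n) = (LINT x|lborel. (\<psi> n x)\<^sup>2)"
      unfolding sqnorm_def by (subst lebesgue_on_eq_lborel(1)[OF _ Omega_sets]) (auto simp: 0)
    have e2: "sqnorm M (cgrad (\<psi> n)) = (LINT x|lborel. (norm (cgrad (\<psi> n) x))\<^sup>2)"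
      unfolding sqnorm_def by (subst lebesgue_on_eq_lborel(1)[OF _ Omega_sets]) (auto simp: 0)
    have e3: "(LINT x|M. \<psi> n x * indicator (grid_cell h k) x) = (LINT x|lborel. indicator (grid_cell h k) x * \<psi> n x)" for k
      by (subst lebesgue_on_eq_lborel(1)[OF _ Omega_sets]) (auto simp: 0 mult.commute)
    show ?thesis
      unfolding e1 e2 e3 by (rule grid_Poincare[OF \<psi>' h]) (use 0 cover in blast)
  qed
  have "(\<lambda>n. sqnorm M (\<psi> n)) \<longlonglongrightarrow> sqnorm M u"
    by (rule sqnorm_tendsto[OF test_square_integrable(1)[OF \<psi>(1)] si(1) \<psi>(2)])
  moreover have "(\<lambda>n. LINT x|M. \<psi> n x * indicator (grid_cell h k) x) \<longlonglongrightarrow> (LINT x|M. u x * indicator (grid_cell h k) x)" for k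
    using integral_inner_tendsto[OF test_square_integrable(1)[OF \<psi>(1)] si(1) square_integrable_indicator[OF grid_cell_borel] \<psi>(2)]
    by (simp only: inner_real_def)
  then have "(\<lambda>n. (\<Sum>k\<in>grid_index N. (LINT x|M. \<psi> n x * indicator (grid_cell h k) x)\<^sup>2) / h^3
      + 12 * h\<^sup>2 * sqnorm M (cgrad (\<psi> n))) \<longlonglongrightarrow>
      (\<Sum>k\<in>grid_index N. (LINT x|M. u x * indicator (grid_cell h k) x)\<^sup>2) / h^3 + 12 * h\<^sup>2 * sqnorm M G"
    using h by (intro tendsto_intros sqnorm_tendsto[OF test_square_integrable(2)[OF \<psi>(1)] si(2) \<psi>(3)]) auto
  ultimately show ?thesis using le by (intro LIMSEQ_le) auto
qed

text \<open>An index range covering the bounded set at mesh 1 / (m + 1), fixed once so that the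
  cells of all meshes form one countable family.\<close>

definition grid_bound :: "nat \<Rightarrow> int" where
  "grid_bound m = (SOME N. \<forall>x\<in>\<Omega>. \<exists>k\<in>grid_index N. x \<in> grid_cell (inverse (real (Suc m))) k)"

lemma grid_bound:
  assumes "x \<in> \<Omega>"
  shows "\<exists>k\<in>grid_index (grid_bound m). x \<in> grid_cell (inverse (real (Suc m))) k"
proof -
  obtain R where R: "\<And>x. x \<in> \<Omega> \<Longrightarrow> norm x \<le> R" using bounded_Omega by (meson bounded_iff)
  have "R / inverse (real (Suc m)) + 1 \<le> of_int \<lceil>R / inverse (real (Suc m)) + 1\<rceil>" by linarith
  then have "\<exists>N. \<forall>x\<in>\<Omega>. \<exists>k\<in>grid_index N. x \<in> grid_cell (inverse (real (Suc m))) k"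
    using grid_cell_cover[OF _ R] by (metis inverse_positive_iff_positive of_nat_0_less_iff zero_less_Suc)
  from someI_ex[OF this] show ?thesis unfolding grid_bound_def using assms by blast
qed

text \<open>The gradient term of the grid inequality is of order h^2 uniformly in n. Once the mesh
  makes it small, only finitely many convergent sequences of numbers are left.\<close>

lemma L2_Cauchy_of_cell_averages:
  assumes p: "\<And>n::nat. grad_pair (u n) (G n)" and bd: "\<And>n. sqnorm M (G n) \<le> B"
    and conv: "\<And>m k. k \<in> grid_index (grid_bound m) \<Longrightarrow>
      \<exists>l. (\<lambda>n. LINT x|M. u n x * indicator (grid_cell (inverse (real (Suc m))) k) x) \<longlonglongrightarrow> l"
    and e: "e > 0"
  shows "\<exists>N. \<forall>m\<ge>N. \<forall>n\<ge>N. sqnorm M (\<lambda>x. u m x - u n x) < e"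
proof -
  note si = grad_pair_square_integrable[OF p]
  \<comment> \<open>The factor 4 B bounds the squared norm of a difference of two gradients.\<close>
  have "(\<lambda>m. 12 * (inverse (real (Suc m)))\<^sup>2 * (4 * B)) \<longlonglongrightarrow> 12 * 0\<^sup>2 * (4 * B)"
    by (intro tendsto_intros LIMSEQ_inverse_real_of_nat)
  then have "\<forall>\<^sub>F m in sequentially. 12 * (inverse (real (Suc m)))\<^sup>2 * (4 * B) < e / 2"
    by (rule order_tendstoD(2)) (use e in simp)
  then obtain j where j: "12 * (inverse (real (Suc j)))\<^sup>2 * (4 * B) < e / 2"
    using eventually_happens'[OF sequentially_bot] by force
  define h where "h = inverse (real (Suc j))"
  define K where "K = (grid_index (grid_bound j) :: (real^3 \<Rightarrow> int) set)"
  define a where "a = (\<lambda>n k. LINT x|M. u n x * indicator (grid_cell h k) x)"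
  have h: "h > 0" by (simp add: h_def)
  have "\<forall>k\<in>K. \<exists>l. (\<lambda>n. a n k) \<longlonglongrightarrow> l" using conv by (auto simp: K_def a_def h_def)
  then obtain l where l: "\<And>k. k \<in> K \<Longrightarrow> (\<lambda>n. a n k) \<longlonglongrightarrow> l k" by metis
  \<comment> \<open>Comparing both cell integrals with their limit separates the two indices; each
    part then gets e / 4.\<close>
  define t where "t = (\<lambda>n. (\<Sum>k\<in>K. 2 * (a n k - l k)\<^sup>2) / h^3)"
  have "t \<longlonglongrightarrow> (\<Sum>k\<in>K. 2 * (l k - l k)\<^sup>2) / h^3"
    unfolding t_def using h by (intro tendsto_intros l) auto
  then have "\<forall>\<^sub>F n in sequentially. t n < e / 4"
    using e by (intro order_tendstoD(2)) auto
  then obtain N where N: "\<And>n. n \<ge> N \<Longrightarrow> t n < e / 4" by (auto simp: eventually_sequentially)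
  have "sqnorm M (\<lambda>x. u m x - u n x) < e" if mn: "m \<ge> N" "n \<ge> N" for m n
  proof -
    have i: "integrable M (\<lambda>x. u n x * indicator (grid_cell h k) x)" for n k
      using square_integrable_inner[OF si(1) square_integrable_indicator[OF grid_cell_borel]] by (simp only: inner_real_def)
    have "(LINT x|M. (u m x - u n x) * indicator (grid_cell h k) x) = a m k - a n k" for k
      unfolding a_def left_diff_distrib by (rule Bochner_Integration.integral_diff[OF i i])
    then have "sqnorm M (\<lambda>x. u m x - u n x) \<le> (\<Sum>k\<in>K. (a m k - a n k)\<^sup>2) / h^3 + 12 * h\<^sup>2 * sqnorm M (\<lambda>x. G m x - G n x)"
      using grid_Poincare_grad_pair[OF grad_pair_diff[OF p p] h, of "grid_bound j" m n] grid_bound[of _ j]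
      by (simp add: K_def h_def)
    also have "(\<Sum>k\<in>K. (a m k - a n k)\<^sup>2) / h^3 \<le> t m + t n"
    proof -
      have "(\<Sum>k\<in>K. (a m k - a n k)\<^sup>2) \<le> (\<Sum>k\<in>K. 2 * (a m k - l k)\<^sup>2 + 2 * (a n k - l k)\<^sup>2)"
      proof (rule sum_mono)
        fix k
        show "(a m k - a n k)\<^sup>2 \<le> 2 * (a m k - l k)\<^sup>2 + 2 * (a n k - l k)\<^sup>2"
          using norm_add_sq_le[of "a m k - l k" "l k - a n k"] by (simp add: power2_commute[of "l k"])
      qed
      then have "(\<Sum>k\<in>K. (a m k - a n k)\<^sup>2) / h^3 \<le> (\<Sum>k\<in>K. 2 * (a m k - l k)\<^sup>2 + 2 * (a n k - l k)\<^sup>2) / h^3"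
        using h by (intro divide_right_mono) auto
      also have "\<dots> = t m + t n" by (simp add: t_def sum.distrib add_divide_distrib)
      finally show ?thesis .
    qed
    also have "12 * h\<^sup>2 * sqnorm M (\<lambda>x. G m x - G n x) \<le> 12 * h\<^sup>2 * (4 * B)"
      using sqnorm_diff_le[OF si(2)[of m] si(2)[of n]] bd[of m] bd[of n] by (intro mult_left_mono) auto
    finally show ?thesis using N[OF mn(1)] N[OF mn(2)] j by (simp add: h_def)
  qed
  then show ?thesis by blast
qed

text \<open>Stated for a countable family with accompanying bounded scalar sequences, so that one
  diagonal extraction serves all functions and multipliers simultaneously.\<close>

theorem Rellich_family:
  assumes J: "countable J"
    and p: "\<And>n j. j \<in> J \<Longrightarrow> grad_pair (u n j) (G n j)"
    and bd: "\<And>n j. j \<in> J \<Longrightarrow> sqnorm M (u n j) \<le> B" "\<And>n j. j \<in> J \<Longrightarrow> sqnorm M (G n j) \<le> B"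
    and r: "\<And>n j. j \<in> J \<Longrightarrow> \<bar>a n j\<bar> \<le> B"
  shows "\<exists>s::nat\<Rightarrow>nat. strict_mono s \<and> (\<forall>j\<in>J. (\<exists>l. (\<lambda>n. a (s n) j) \<longlonglongrightarrow> l) \<and>
    (\<exists>u0 G0. grad_pair u0 G0 \<and> (\<lambda>n. sqnorm M (\<lambda>x. u (s n) j x - u0 x)) \<longlonglongrightarrow> 0 \<and>
      (\<forall>v H. grad_pair v H \<longrightarrow> (\<lambda>n. LINT x|M. G (s n) j x \<bullet> H x) \<longlonglongrightarrow> (LINT x|M. G0 x \<bullet> H x))))"
proof -
  define I where "I = (SIGMA m:UNIV. grid_index (grid_bound m) :: (nat \<times> (real^3 \<Rightarrow> int)) set)"
  define S where "S = J \<times> (insert None (Some ` I))"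
  \<comment> \<open>The index \<open>None\<close> carries the scalar sequence,
    \<open>Some (m, k)\<close> the integral over cell k at mesh 1 / (m + 1).\<close>
  define f where "f = (\<lambda>n (j, i). case i of None \<Rightarrow> a n j
    | Some (m, k) \<Rightarrow> LINT x|M. u n j x * indicator (grid_cell (inverse (real (Suc m))) k) x)"
  have "countable I" unfolding I_def by (intro countable_SIGMA) (auto intro: countable_finite finite_grid_index)
  then have "countable S" unfolding S_def using J by auto
  define \<mu> where "\<mu> = measure M (space M)"
  have "norm (f n x) \<le> B + \<mu>" if "x \<in> S" for n x
  proof -
    obtain j i where ji: "x = (j, i)" by (cases x)
    then have x: "x = (j, i)" "j \<in> J" "i \<in> insert None (Some ` I)" using that by (auto simp: S_def)
    have \<mu>: "\<mu> \<ge> 0" by (simp add: \<mu>_def)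
    have B: "B \<ge> 0" using r[OF x(2), of 0] by linarith
    show ?thesis
    proof (cases i)
      case None
      then show ?thesis using x r[OF x(2), of n] \<mu> by (simp add: f_def)
    next
      case (Some y)
      obtain m k where y: "y = (m, k)" by (cases y)
      define C where "C = grid_cell (inverse (real (Suc m))) k"
      have C: "C \<in> sets borel" by (simp add: C_def)
      note s1 = grad_pair_square_integrable(1)[OF p[OF x(2)], of n]
      note s2 = square_integrable_indicator[OF C]
      have "sqnorm M (indicator C :: _ \<Rightarrow> real) \<le> (LINT x|M. 1)"
        unfolding sqnorm_def using s2 by (intro integral_mono) (auto simp: square_integrable_def indicator_def)
      then have sC: "sqnorm M (indicator C :: _ \<Rightarrow> real) \<le> \<mu>" by (simp add: \<mu>_def)
      have "(LINT x|M. u n j x * indicator C x)\<^sup>2 \<le> sqnorm M (u n j) * sqnorm M (indicator C :: _ \<Rightarrow> real)"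
        using integral_Cauchy_Schwarz[OF s1 s2] by (simp only: inner_real_def)
      also have "\<dots> \<le> B * \<mu>" by (intro mult_mono bd x sC B) auto
      \<comment> \<open>The diagonal argument takes one bound for all indices; B + \<mu> dominates
        the scalars and, through Cauchy--Schwarz, the cell integrals.\<close>
      also have "\<dots> \<le> (B + \<mu>)\<^sup>2"
      proof -
        have "(B + \<mu>)\<^sup>2 = B * \<mu> + (B\<^sup>2 + B * \<mu> + \<mu>\<^sup>2)" by (simp add: power2_eq_square algebra_simps)
        moreover have "0 \<le> B\<^sup>2 + B * \<mu> + \<mu>\<^sup>2" using B \<mu> by simp
        ultimately show ?thesis by linarith
      qed
      finally have "\<bar>LINT x|M. u n j x * indicator C x\<bar> \<le> \<bar>B + \<mu>\<bar>"
        by (simp only: abs_le_square_iff)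
      also have "\<dots> = B + \<mu>" using B \<mu> by simp
      finally have "\<bar>LINT x|M. u n j x * indicator C x\<bar> \<le> B + \<mu>" .
      then show ?thesis using x Some y by (simp add: f_def C_def)
    qed
  qed
  then obtain s where s: "strict_mono s" "\<And>x. x \<in> S \<Longrightarrow> \<exists>l. (\<lambda>n. f (s n) x) \<longlonglongrightarrow> l"
    using function_convergent_subsequence[OF \<open>countable S\<close>, of f "B + \<mu>"] by blast
  have "(\<exists>l. (\<lambda>n. a (s n) j) \<longlonglongrightarrow> l) \<and>
    (\<exists>u0 G0. grad_pair u0 G0 \<and> (\<lambda>n. sqnorm M (\<lambda>x. u (s n) j x - u0 x)) \<longlonglongrightarrow> 0 \<and>
      (\<forall>v H. grad_pair v H \<longrightarrow> (\<lambda>n. LINT x|M. G (s n) j x \<bullet> H x) \<longlonglongrightarrow> (LINT x|M. G0 x \<bullet> H x)))"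
    if j: "j \<in> J" for j
  proof
    have "(j, None) \<in> S" using j by (simp add: S_def)
    from s(2)[OF this] show "\<exists>l. (\<lambda>n. a (s n) j) \<longlonglongrightarrow> l" by (simp add: f_def)
    have conv: "\<exists>l. (\<lambda>n. LINT x|M. u (s n) j x * indicator (grid_cell (inverse (real (Suc m))) k) x) \<longlonglongrightarrow> l"
      if "k \<in> grid_index (grid_bound m)" for m k
    proof -
      have "(j, Some (m, k)) \<in> S" using j that by (auto simp: S_def I_def)
      from s(2)[OF this] show ?thesis by (simp add: f_def)
    qed
    note pj = p[OF j] and bj = bd(2)[OF j]
    have "\<exists>N. \<forall>m\<ge>N. \<forall>n\<ge>N. sqnorm M (\<lambda>x. u (s m) j x - u (s n) j x) < e" if "e > 0" for e
      by (rule L2_Cauchy_of_cell_averages[of "\<lambda>n. u (s n) j" "\<lambda>n. G (s n) j", OF pj bj conv that])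
    from square_integrable_complete[of "\<lambda>n. u (s n) j", OF grad_pair_square_integrable(1)[OF pj] this]
    obtain u0 where u0: "square_integrable M u0" "(\<lambda>n. sqnorm M (\<lambda>x. u (s n) j x - u0 x)) \<longlonglongrightarrow> 0"
      by blast
    obtain G0 where G0: "grad_pair u0 G0"
      using grad_pair_tail_limit[of "\<lambda>n. u (s n) j" "\<lambda>n. G (s n) j", OF pj bj u0] by blast
    have "(\<lambda>n. LINT x|M. G (s n) j x \<bullet> H x) \<longlonglongrightarrow> (LINT x|M. G0 x \<bullet> H x)" if "grad_pair v H" for v H
      by (rule grad_weak_convergence[of "\<lambda>n. u (s n) j" "\<lambda>n. G (s n) j", OF pj bj G0 u0(2) that])
    then show "\<exists>u0 G0. grad_pair u0 G0 \<and> (\<lambda>n. sqnorm M (\<lambda>x. u (s n) j x - u0 x)) \<longlonglongrightarrow> 0 \<and>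
      (\<forall>v H. grad_pair v H \<longrightarrow> (\<lambda>n. LINT x|M. G (s n) j x \<bullet> H x) \<longlonglongrightarrow> (LINT x|M. G0 x \<bullet> H x))"
      using G0 u0(2) by blast
  qed
  then show ?thesis using s(1) by blast
qed

end

section \<open>Sobolev and Gagliardo--Nirenberg inequalities\<close>

lemma integrable_lborel_compose_test:
  fixes F :: "real \<Rightarrow> real"
  assumes \<psi>: "\<psi> \<in> test_functions \<Omega>" and F: "continuous_on UNIV F" "F 0 = 0"
  shows "integrable lborel (\<lambda>x. F (\<psi> x))"
proof -
  obtain K where K: "compact K" "\<forall>x. x \<notin> K \<longrightarrow> \<psi> x = 0" using test_functions_compact_support[OF \<psi>] by blast
  show ?thesis
  proof (rule integrable_compact_support[OF _ K(1)])
    show "continuous_on UNIV (\<lambda>x. F (\<psi> x))"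
      by (rule continuous_on_compose2[OF F(1) smooth_on_continuous[OF test_functions_smooth[OF \<psi>]]]) simp
  qed (use K F in auto)
qed

lemma test_Lp:
  assumes \<psi>: "\<psi> \<in> test_functions \<Omega>" and p: "p > 0"
  shows "\<psi> \<in> Lp_fun p UNIV" "cgrad \<psi> \<in> Lp_fun 2 UNIV"
proof -
  have "continuous_on UNIV (\<lambda>t::real. \<bar>t\<bar> powr p)"
    using p by (intro continuous_on_powr' continuous_intros) auto
  then have "integrable lborel (\<lambda>x. \<bar>\<psi> x\<bar> powr p)"
    by (rule integrable_lborel_compose_test[OF \<psi>]) simp
  then have "integrable (lebesgue_on UNIV) (\<lambda>x. \<bar>\<psi> x\<bar> powr p)" by (rule integrable_lborel_lebesgue_on) simp
  then show "\<psi> \<in> Lp_fun p UNIV"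
    using square_integrable_measurable[OF square_integrable_test[OF \<psi>, of UNIV]] by (simp add: Lp_fun_def)
  show "cgrad \<psi> \<in> Lp_fun 2 UNIV"
    using square_integrable_cgrad[OF \<psi>, of UNIV] by (simp add: Lp_fun_def square_integrable_def)
qed

lemma sqnorm_wgrad_test:
  assumes \<psi>: "\<psi> \<in> test_functions UNIV"
  shows "(LINT x|lebesgue_on UNIV. (norm (wgrad UNIV \<psi> x))\<^sup>2) = sqnorm (lebesgue_on UNIV) (cgrad \<psi>)"
proof -
  have AE: "AE x in lebesgue_on UNIV. cgrad \<psi> x = wgrad UNIV \<psi> x"
    using wgrad_AE[OF open_UNIV has_weak_gradient_test[OF \<psi> open_UNIV]] by eventually_elim simp
  have m: "cgrad \<psi> \<in> borel_measurable (lebesgue_on UNIV)" by (rule borel_measurable_cgrad[OF \<psi>])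
  have "sqnorm (lebesgue_on UNIV) (cgrad \<psi>) = sqnorm (lebesgue_on UNIV) (wgrad UNIV \<psi>)"
    by (rule sqnorm_cong_AE[OF m borel_measurable_lebesgue_on_AE[OF m AE] AE]) simp
  then show ?thesis by (simp add: sqnorm_def)
qed

definition sobolev_set :: "real set" where
  "sobolev_set = {(LINT x|lebesgue_on UNIV. (norm (wgrad UNIV u x))\<^sup>2) | u.
     u \<in> Lp_fun 6 UNIV \<and> (\<exists>g. has_weak_gradient UNIV u g \<and> g \<in> Lp_fun 2 UNIV) \<and>
     (LINT x|lebesgue_on UNIV. \<bar>u x\<bar>^6) = 1}"

lemma sobolev_const_eq: "sobolev_const = Inf sobolev_set"
  unfolding sobolev_const_def sobolev_set_def ..

lemma sobolev_set_nonneg: "y \<in> sobolev_set \<Longrightarrow> 0 \<le> y"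
  by (auto simp: sobolev_set_def intro!: Bochner_Integration.integral_nonneg)

text \<open>Division by the L^6 norm a = c^(1/6) normalises the constraint, and it divides the
  Dirichlet integral by a^2 = c^(1/3).\<close>

lemma test_sobolev_set:
  assumes \<psi>: "\<psi> \<in> test_functions UNIV" and I: "(LINT x|lebesgue_on UNIV. \<bar>\<psi> x\<bar>^6) = c" "c > 0"
  shows "sqnorm (lebesgue_on UNIV) (cgrad \<psi>) / root 3 c \<in> sobolev_set"
proof -
  define a where "a = root 6 c"
  have a: "a > 0" "a^6 = c" "a\<^sup>2 = root 3 c"
  proof -
    show "a > 0" "a^6 = c" using I(2) by (auto simp: a_def)
    have "(a\<^sup>2)^3 = c" using \<open>a^6 = c\<close> by (simp flip: power_mult)
    then show "a\<^sup>2 = root 3 c" using real_root_power_cancel[of 3 "a\<^sup>2"] by simp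
  qed
  \<comment> \<open>The term \<open>0 * \<psi> x\<close> brings the multiple into the form of
    \<open>test_functions_lin\<close>.\<close>
  define v where "v = (\<lambda>x. (1 / a) * \<psi> x + 0 * \<psi> x)"
  have v: "v \<in> test_functions UNIV" unfolding v_def by (rule test_functions_lin[OF \<psi> \<psi>])
  have cv: "cgrad v = (\<lambda>x. (1 / a) *\<^sub>R cgrad \<psi> x)"
    unfolding v_def by (rule ext, subst cgrad_lin[OF test_functions_smooth[OF \<psi>] test_functions_smooth[OF \<psi>]]) simp
  have "(LINT x|lebesgue_on UNIV. \<bar>v x\<bar>^6) = (LINT x|lebesgue_on UNIV. \<bar>\<psi> x\<bar>^6 / c)"
    using a by (intro Bochner_Integration.integral_cong) (auto simp: v_def abs_mult power_mult_distrib power_divide)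
  then have "(LINT x|lebesgue_on UNIV. \<bar>v x\<bar>^6) = 1" using I by simp
  moreover have "v \<in> Lp_fun 6 UNIV" "cgrad v \<in> Lp_fun 2 UNIV" using test_Lp[OF v, of 6] by auto
  moreover have "has_weak_gradient UNIV v (cgrad v)" by (rule has_weak_gradient_test[OF v open_UNIV])
  ultimately have "(LINT x|lebesgue_on UNIV. (norm (wgrad UNIV v x))\<^sup>2) \<in> sobolev_set"
    by (auto simp: sobolev_set_def)
  also have "(LINT x|lebesgue_on UNIV. (norm (wgrad UNIV v x))\<^sup>2) = sqnorm (lebesgue_on UNIV) (cgrad \<psi>) / root 3 c"
    unfolding sqnorm_wgrad_test[OF v] cv sqnorm_scaleR using a by (simp add: power_divide)
  finally show ?thesis .
qed

text \<open>The point is that the set is not empty: the infimum of the empty set of reals is unspecified.\<close>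

lemma sobolev_const_nonneg: "0 \<le> sobolev_const"
proof -
  define v where "v = box_bump 0 (One :: real^3) 1"
  have v: "v \<in> test_functions UNIV" unfolding v_def by (rule test_functions_box_bump) simp
  have i: "integrable (lebesgue_on UNIV) (\<lambda>x. \<bar>v x\<bar>^6)"
    using test_Lp(1)[OF v, of 6] by (simp add: Lp_fun_def)
  have "(LINT x|lebesgue_on UNIV. \<bar>v x\<bar>^6) \<noteq> 0"
  proof
    assume "(LINT x|lebesgue_on UNIV. \<bar>v x\<bar>^6) = 0"
    then have "AE x in lebesgue_on UNIV. \<bar>v x\<bar>^6 = 0"
      using i by (subst (asm) integral_nonneg_eq_0_iff_AE) auto
    then have "AE x in lebesgue. \<bar>v x\<bar>^6 = 0" by (simp only: lebesgue_on_UNIV_eq)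
    then have "AE x in lebesgue. x \<notin> box 0 (One :: real^3)"
    proof eventually_elim
      fix x assume "\<bar>v x\<bar>^6 = 0"
      moreover have "v x \<noteq> 0" if "x \<in> box 0 One"
        using that by (auto simp: v_def box_bump_def expinv_def mem_box)
      ultimately show "x \<notin> box 0 One" by auto
    qed
    then have "box 0 (One :: real^3) \<in> null_sets lebesgue"
      by (subst AE_iff_null_sets) auto
    then have "negligible (box 0 (One :: real^3))" by (simp add: negligible_iff_null_sets)
    then show False by (simp add: negligible_interval box_eq_empty)
  qed
  moreover have "0 \<le> (LINT x|lebesgue_on UNIV. \<bar>v x\<bar>^6)" by (intro Bochner_Integration.integral_nonneg) simp
  ultimately have "0 < (LINT x|lebesgue_on UNIV. \<bar>v x\<bar>^6)" by linarith
  then have "sobolev_set \<noteq> {}" using test_sobolev_set[OF v refl] by blast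
  then show ?thesis unfolding sobolev_const_eq by (rule cInf_greatest) (rule sobolev_set_nonneg)
qed

text \<open>If the L^6 integral vanishes there is nothing to normalise and the bound is trivial;
  otherwise the normalised function competes in the infimum.\<close>

lemma Sobolev_test:
  assumes \<psi>: "\<psi> \<in> test_functions UNIV" and S: "sobolev_const > 0"
  shows "(LINT x|lebesgue_on UNIV. \<bar>\<psi> x\<bar>^6) \<le> (sqnorm (lebesgue_on UNIV) (cgrad \<psi>))^3 / sobolev_const^3"
proof -
  define c where "c = (LINT x|lebesgue_on UNIV. \<bar>\<psi> x\<bar>^6)"
  define E where "E = sqnorm (lebesgue_on UNIV) (cgrad \<psi>)"
  have "c \<ge> 0" unfolding c_def by (intro Bochner_Integration.integral_nonneg) simp
  show ?thesis
  proof (cases "c = 0")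
    case True
    then show ?thesis unfolding c_def[symmetric] using S by simp
  next
    case False
    then have c: "c > 0" using \<open>c \<ge> 0\<close> by simp
    have "sobolev_const \<le> E / root 3 c"
      unfolding sobolev_const_eq E_def
      by (rule cInf_lower[OF test_sobolev_set[OF \<psi> c_def[symmetric] c]]) (auto intro!: bdd_belowI[of _ 0] sobolev_set_nonneg)
    then have "sobolev_const * root 3 c \<le> E" using c by (simp add: field_simps)
    then have "(sobolev_const * root 3 c)^3 \<le> E^3" using S c by (intro power_mono) auto
    then have "sobolev_const^3 * c \<le> E^3" using c by (simp add: power_mult_distrib)
    then show ?thesis unfolding c_def[symmetric] E_def[symmetric] using S by (simp add: field_simps)
  qed
qed

lemma lebesgue_on_test_UNIV:
  fixes F :: "real^3 \<Rightarrow> 'b::euclidean_space"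
  assumes "F \<in> borel_measurable borel" "\<Omega> \<in> sets lebesgue" "\<And>x. x \<notin> \<Omega> \<Longrightarrow> F x = 0"
  shows "integral\<^sup>L (lebesgue_on \<Omega>) F = integral\<^sup>L (lebesgue_on UNIV) F"
  using lebesgue_on_eq_lborel(1)[OF assms] lebesgue_on_eq_lborel(1)[OF assms(1), of UNIV] by simp

context bounded_open_set
begin

lemma test_integrals_UNIV:
  assumes \<psi>: "\<psi> \<in> test_functions \<Omega>"
  shows "sqnorm M (cgrad \<psi>) = sqnorm (lebesgue_on UNIV) (cgrad \<psi>)"
    and "sqnorm M \<psi> = sqnorm (lebesgue_on UNIV) \<psi>"
    and "F \<in> borel_measurable borel \<Longrightarrow> F 0 = 0 \<Longrightarrow> (LINT x|M. F (\<psi> x) :: real) = (LINT x|lebesgue_on UNIV. F (\<psi> x))"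
proof -
  have [measurable]: "\<psi> \<in> borel_measurable borel" "cgrad \<psi> \<in> borel_measurable borel"
    by (auto intro: borel_smooth borel_cgrad test_functions_smooth[OF \<psi>])
  obtain K where K: "compact K" "K \<subseteq> \<Omega>" "\<And>x. x \<notin> K \<Longrightarrow> \<psi> x = 0" using test_functionsE[OF \<psi>] by blast
  have 0: "\<psi> x = 0" "cgrad \<psi> x = 0" if "x \<notin> \<Omega>" for x
    using K that cgrad_eq_0[of K "\<psi>" x] by auto
  show "sqnorm M (cgrad \<psi>) = sqnorm (lebesgue_on UNIV) (cgrad \<psi>)"
    unfolding sqnorm_def by (rule lebesgue_on_test_UNIV[OF _ Omega_sets]) (auto simp: 0)
  show "sqnorm M \<psi> = sqnorm (lebesgue_on UNIV) \<psi>"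
    unfolding sqnorm_def by (rule lebesgue_on_test_UNIV[OF _ Omega_sets]) (auto simp: 0)
  assume F: "F \<in> borel_measurable borel" "F 0 = 0"
  then show "(LINT x|M. F (\<psi> x)) = (LINT x|lebesgue_on UNIV. F (\<psi> x))"
    by (intro lebesgue_on_test_UNIV[OF _ Omega_sets] measurable_compose[OF _ F(1)]) (auto simp: 0)
qed

text \<open>The device that carries an integral inequality from test functions to H^1_0: Fatou's
  lemma along an almost everywhere convergent subsequence on the left, continuity of the bound on
  the right. Continuity is asked only along nonnegative sequences, because \<open>powr\<close> is
  used at arguments that may tend to 0.\<close>

lemma grad_pair_Fatou:
  fixes F :: "real \<Rightarrow> real"
  assumes u: "grad_pair u G" and F: "continuous_on UNIV F" "F 0 = 0" "\<And>t. 0 \<le> F t"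
    and bd: "\<And>\<psi>. \<psi> \<in> test_functions \<Omega> \<Longrightarrow> (LINT x|M. F (\<psi> x)) \<le> B (sqnorm M \<psi>) (sqnorm M (cgrad \<psi>))"
    and B: "\<And>x y. (\<And>n. 0 \<le> x n) \<Longrightarrow> (\<And>n. 0 \<le> y n) \<Longrightarrow> x \<longlonglongrightarrow> sqnorm M u \<Longrightarrow> y \<longlonglongrightarrow> sqnorm M G \<Longrightarrow>
      (\<lambda>n. B (x n) (y n)) \<longlonglongrightarrow> B (sqnorm M u) (sqnorm M G)"
  shows "integrable M (\<lambda>x. F (u x)) \<and> (LINT x|M. F (u x)) \<le> B (sqnorm M u) (sqnorm M G)"
proof -
  obtain \<psi> where \<psi>: "\<And>n. \<psi> n \<in> test_functions \<Omega>" "(\<lambda>n. sqnorm M (\<lambda>x. \<psi> n x - u x)) \<longlonglongrightarrow> 0"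
    "(\<lambda>n. sqnorm M (\<lambda>x. cgrad (\<psi> n) x - G x)) \<longlonglongrightarrow> 0" using grad_pairE[OF u] by blast
  note si = grad_pair_square_integrable[OF u]
  obtain r where r: "strict_mono r" "AE x in M. (\<lambda>k. \<psi> (r k) x) \<longlonglongrightarrow> u x"
    using AE_subseq_of_sqnorm[OF test_square_integrable(1)[OF \<psi>(1)] si(1) \<psi>(2)] by blast
  have l1: "(\<lambda>k. sqnorm M (\<psi> (r k))) \<longlonglongrightarrow> sqnorm M u"
    using LIMSEQ_subseq_LIMSEQ[OF sqnorm_tendsto[OF test_square_integrable(1)[OF \<psi>(1)] si(1) \<psi>(2)] r(1)] by (simp add: o_def)
  have l2: "(\<lambda>k. sqnorm M (cgrad (\<psi> (r k)))) \<longlonglongrightarrow> sqnorm M G"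
    using LIMSEQ_subseq_LIMSEQ[OF sqnorm_tendsto[OF test_square_integrable(2)[OF \<psi>(1)] si(2) \<psi>(3)] r(1)] by (simp add: o_def)
  have Fm: "F \<in> borel_measurable borel" by (rule borel_measurable_continuous_onI[OF F(1)])
  show ?thesis
  proof (rule Fatou_bound[where h="\<lambda>k x. F (\<psi> (r k) x)" and B="\<lambda>k. B (sqnorm M (\<psi> (r k))) (sqnorm M (cgrad (\<psi> (r k))))"])
    show "integrable M (\<lambda>x. F (\<psi> (r k) x))" for k
      by (intro integrable_lborel_lebesgue_on[OF _ Omega_sets] integrable_lborel_compose_test[OF \<psi>(1)] F)
    show "(\<lambda>x. F (u x)) \<in> borel_measurable M"
      by (rule measurable_compose[OF square_integrable_measurable[OF si(1)] Fm])
    show "AE x in M. (\<lambda>k. F (\<psi> (r k) x)) \<longlonglongrightarrow> F (u x)"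
      using r(2)
    proof eventually_elim
      fix x assume "(\<lambda>k. \<psi> (r k) x) \<longlonglongrightarrow> u x"
      moreover have "isCont F (u x)" using F(1) by (simp add: continuous_on_eq_continuous_at)
      ultimately show "(\<lambda>k. F (\<psi> (r k) x)) \<longlonglongrightarrow> F (u x)" by (rule isCont_tendsto_compose[rotated])
    qed
    show "(\<lambda>k. B (sqnorm M (\<psi> (r k))) (sqnorm M (cgrad (\<psi> (r k))))) \<longlonglongrightarrow> B (sqnorm M u) (sqnorm M G)"
      by (rule B[OF _ _ l1 l2]) auto
  qed (use F bd \<psi>(1) in auto)
qed

theorem Sobolev_grad_pair:
  assumes u: "grad_pair u G" and S: "sobolev_const > 0"
  shows "integrable M (\<lambda>x. (u x)^6)" "(LINT x|M. (u x)^6) \<le> (sqnorm M G)^3 / sobolev_const^3"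
proof -
  have "integrable M (\<lambda>x. (u x)^6) \<and> (LINT x|M. (u x)^6) \<le> (\<lambda>_ y. y^3 / sobolev_const^3) (sqnorm M u) (sqnorm M G)"
  proof (rule grad_pair_Fatou[OF u, where F="\<lambda>t. t^6"])
    fix \<psi> assume \<psi>: "\<psi> \<in> test_functions \<Omega>"
    then have \<psi>': "\<psi> \<in> test_functions UNIV" using test_functions_mono by blast
    show "(LINT x|M. (\<psi> x)^6) \<le> (sqnorm M (cgrad \<psi>))^3 / sobolev_const^3"
      using Sobolev_test[OF \<psi>' S] test_integrals_UNIV(1)[OF \<psi>] test_integrals_UNIV(3)[OF \<psi>, of "\<lambda>t. t^6"]
      by (simp add: power_even_abs)
  qed (use S in \<open>auto intro!: continuous_intros tendsto_intros\<close>)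
  then show "integrable M (\<lambda>x. (u x)^6)" "(LINT x|M. (u x)^6) \<le> (sqnorm M G)^3 / sobolev_const^3" by auto
qed

theorem Gagliardo_Nirenberg_grad_pair:
  assumes u: "grad_pair u G" and C: "gagliardo_nirenberg_const q C" and q: "2 < q" "q < 6"
  shows "integrable M (\<lambda>x. \<bar>u x\<bar> powr q)"
    and "(LINT x|M. \<bar>u x\<bar> powr q) \<le> C * (sqnorm M u) powr ((6 - q) / 4) * (sqnorm M G) powr (3 * (q - 2) / 4)"
proof -
  have "integrable M (\<lambda>x. \<bar>u x\<bar> powr q) \<and>
      (LINT x|M. \<bar>u x\<bar> powr q) \<le> (\<lambda>x y. C * x powr ((6 - q) / 4) * y powr (3 * (q - 2) / 4)) (sqnorm M u) (sqnorm M G)"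
  proof (rule grad_pair_Fatou[OF u, where F="\<lambda>t. \<bar>t\<bar> powr q"])
    fix \<psi> assume \<psi>: "\<psi> \<in> test_functions \<Omega>"
    then have \<psi>': "\<psi> \<in> test_functions UNIV" using test_functions_mono by blast
    have "\<psi> \<in> H1 UNIV"
      unfolding W1_def using test_Lp[OF \<psi>, of 2] has_weak_gradient_test[OF \<psi>' open_UNIV] by auto
    then have "(LINT x|lebesgue_on UNIV. \<bar>\<psi> x\<bar> powr q) \<le>
        C * (LINT x|lebesgue_on UNIV. \<bar>\<psi> x\<bar>\<^sup>2) powr ((6 - q) / 4) *
        (LINT x|lebesgue_on UNIV. (norm (wgrad UNIV \<psi> x))\<^sup>2) powr (3 * (q - 2) / 4)"
      using C unfolding gagliardo_nirenberg_const_def by blast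
    then show "(LINT x|M. \<bar>\<psi> x\<bar> powr q) \<le> C * (sqnorm M \<psi>) powr ((6 - q) / 4) * (sqnorm M (cgrad \<psi>)) powr (3 * (q - 2) / 4)"
      using q unfolding sqnorm_wgrad_test[OF \<psi>'] test_integrals_UNIV(1,2)[OF \<psi>]
      by (subst test_integrals_UNIV(3)[OF \<psi>, of "\<lambda>t. \<bar>t\<bar> powr q"]) (auto simp: sqnorm_def)
  next
    show "continuous_on UNIV (\<lambda>t::real. \<bar>t\<bar> powr q)"
      using q by (intro continuous_on_powr' continuous_intros) auto
    show "(\<lambda>n. C * x n powr ((6 - q) / 4) * y n powr (3 * (q - 2) / 4)) \<longlonglongrightarrow>
        C * sqnorm M u powr ((6 - q) / 4) * sqnorm M G powr (3 * (q - 2) / 4)"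
      if "\<And>n. 0 \<le> x n" "\<And>n. 0 \<le> y n" "x \<longlonglongrightarrow> sqnorm M u" "y \<longlonglongrightarrow> sqnorm M G" for x y
      using q that by (intro tendsto_mult tendsto_const tendsto_powr') (auto intro!: always_eventually)
  qed auto
  then show "integrable M (\<lambda>x. \<bar>u x\<bar> powr q)"
    "(LINT x|M. \<bar>u x\<bar> powr q) \<le> C * (sqnorm M u) powr ((6 - q) / 4) * (sqnorm M G) powr (3 * (q - 2) / 4)" by auto
qed

end

section \<open>Convergence of the nonlinear terms\<close>

lemma abs_mult_le_six:
  fixes a c :: real shows "\<bar>a * c\<bar> ^ 2 \<le> 2 + a^6 + c^6"
proof -
  have "(a * c)\<^sup>2 \<le> a^4 + c^4"
  proof -
    have "2 * (a\<^sup>2 * c\<^sup>2) \<le> (a\<^sup>2)\<^sup>2 + (c\<^sup>2)\<^sup>2" using sum_squares_bound[of "a\<^sup>2" "c\<^sup>2"] by (simp only: mult.assoc)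
    moreover have "0 \<le> a\<^sup>2 * c\<^sup>2" by simp
    ultimately have "a\<^sup>2 * c\<^sup>2 \<le> (a\<^sup>2)\<^sup>2 + (c\<^sup>2)\<^sup>2" by argo
    then show ?thesis by (simp add: power_mult_distrib flip: power_mult)
  qed
  moreover have "t^4 \<le> 1 + t^6" for t :: real
  proof (cases "\<bar>t\<bar> \<le> 1")
    case True
    then have "\<bar>t\<bar>^4 \<le> 1" by (intro power_le_one) auto
    then show ?thesis by (simp add: power_even_abs add_increasing2)
  next
    case False
    then have "\<bar>t\<bar>^4 \<le> \<bar>t\<bar>^6" by (intro power_increasing) auto
    then show ?thesis by (simp add: power_even_abs)
  qed
  from this[of a] this[of c] have "a^4 + c^4 \<le> 2 + a^6 + c^6" by linarith
  ultimately show ?thesis by simp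
qed

lemma square_le_six: "(t::real)\<^sup>2 \<le> 1 + t^6"
proof (cases "\<bar>t\<bar> \<le> 1")
  case True
  then have "\<bar>t\<bar>\<^sup>2 \<le> 1" by (intro power_le_one) auto
  then show ?thesis by (simp add: add_increasing2)
next
  case False
  then have "\<bar>t\<bar>\<^sup>2 \<le> \<bar>t\<bar>^6" by (intro power_increasing) auto
  then show ?thesis by (simp add: power_even_abs)
qed

text \<open>Every term on the right becomes small after integration when v tends to 0 in L^2 and is
  bounded in L^6: those with the factor d because d is free, the tail of b for large L, and the last
  one for fixed d and L. The proof compares x with d y when |b| exceeds L, and L with d y
  otherwise.\<close>

lemma quintic_cross_bound:
  fixes b v d L :: real
  assumes d: "0 < d" "d \<le> 1" and L: "L \<ge> 1"
  shows "\<bar>b\<bar> * \<bar>v\<bar>^5 + \<bar>b\<bar>^5 * \<bar>v\<bar> \<le>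
    2 * d * v^6 + 2 / d^5 * (if \<bar>b\<bar> > L then b^6 else 0) + d * b\<^sup>2 + (L^4 / d^3 + L^8 / d) * v\<^sup>2"
proof -
  define x y where "x = \<bar>b\<bar>" and "y = \<bar>v\<bar>"
  have xy: "x \<ge> 0" "y \<ge> 0" by (auto simp: x_def y_def)
  have pows: "v^6 = y^6" "b^6 = x^6" "b\<^sup>2 = x\<^sup>2" "v\<^sup>2 = y\<^sup>2" by (auto simp: x_def y_def power_even_abs)
  have "x * y^5 + x^5 * y \<le> 2 * d * y^6 + 2 / d^5 * (if x > L then x^6 else 0) + d * x\<^sup>2 + (L^4 / d^3 + L^8 / d) * y\<^sup>2"
  proof (cases "x > L")
    case True
    have "x * y^5 + x^5 * y \<le> 2 * d * y^6 + 2 / d^5 * x^6"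
    proof (cases "x \<le> d * y")
      case True
      have "x * y^5 \<le> (d * y) * y^5" using True xy by (intro mult_right_mono) auto
      moreover have "x^5 * y \<le> (d * y)^5 * y" using True xy by (intro mult_right_mono power_mono) auto
      moreover have "(d * y)^5 * y \<le> d * y^6"
      proof -
        have "d^5 \<le> d^1" using d by (intro power_decreasing) auto
        then have "d^5 * y^6 \<le> d * y^6" using xy by (intro mult_right_mono) auto
        then show ?thesis by (simp add: power_mult_distrib eval_nat_numeral mult_ac)
      qed
      moreover have "(d * y) * y^5 = d * y^6" by (simp add: eval_nat_numeral mult_ac)
      moreover have "0 \<le> 2 / d^5 * x^6" using d by simp
      ultimately show ?thesis by argo
    next
      case False
      then have y: "y \<le> x / d" using d by (simp add: field_simps)
      have "x * y^5 \<le> x * (x / d)^5" using y xy by (intro mult_left_mono power_mono) auto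
      moreover have "x * (x / d)^5 = 1 / d^5 * x^6" by (simp add: power_divide eval_nat_numeral mult_ac)
      moreover have "x^5 * y \<le> x^5 * (x / d)" using y xy by (intro mult_left_mono) auto
      moreover have "x^5 * (x / d) \<le> 1 / d^5 * x^6"
      proof -
        have "d^5 \<le> d^1" using d by (intro power_decreasing) auto
        then have "1 / d \<le> 1 / d^5" using d by (intro divide_left_mono) auto
        then have "1 / d * x^6 \<le> 1 / d^5 * x^6" using xy by (intro mult_right_mono) auto
        then show ?thesis by (simp add: eval_nat_numeral mult_ac)
      qed
      moreover have "0 \<le> 2 * d * y^6" using d by simp
      moreover have "2 / d^5 * x^6 = 2 * (1 / d^5 * x^6)" by simp
      ultimately show ?thesis by argo
    qed
    moreover have "0 \<le> d * x\<^sup>2 + (L^4 / d^3 + L^8 / d) * y\<^sup>2" using d L by simp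
    ultimately show ?thesis using True by simp
  next
    case False
    have "x * y^5 \<le> d * y^6 + L^4 / d^3 * y\<^sup>2"
    proof (cases "L \<le> d * y")
      case True
      have "x * y^5 \<le> (d * y) * y^5" using True False xy by (intro mult_right_mono) auto
      moreover have "(d * y) * y^5 = d * y^6" by (simp add: eval_nat_numeral mult_ac)
      moreover have "0 \<le> L^4 / d^3 * y\<^sup>2" using d L by simp
      ultimately show ?thesis by argo
    next
      case nL: False
      then have y: "y \<le> L / d" using d by (simp add: field_simps)
      have "x * y^5 = x * y^3 * y\<^sup>2" by (simp add: eval_nat_numeral mult_ac)
      also have "\<dots> \<le> L * (L / d)^3 * y\<^sup>2"
        using y xy False L by (intro mult_right_mono mult_mono power_mono) auto
      also have "\<dots> = L^4 / d^3 * y\<^sup>2" by (simp add: power_divide eval_nat_numeral mult_ac)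
      finally show ?thesis using d xy by (simp add: add_increasing)
    qed
    moreover have "x^5 * y \<le> d * x\<^sup>2 + L^8 / d * y\<^sup>2"
    proof -
      have "x^5 * y = x^4 * (x * y)" by (simp add: eval_nat_numeral mult_ac)
      also have "\<dots> \<le> L^4 * (x * y)" using False xy by (intro mult_right_mono power_mono) auto
      \<comment> \<open>Young's inequality from the square of d x - L^4 y, divided by d.\<close>
      also have "\<dots> \<le> d * x\<^sup>2 + L^8 / d * y\<^sup>2"
      proof -
        have "0 \<le> (d * x - L^4 * y)\<^sup>2" by simp
        also have "\<dots> = d\<^sup>2 * x\<^sup>2 - 2 * d * (L^4 * (x * y)) + L^8 * y\<^sup>2"
          by (simp add: power2_diff power_mult_distrib flip: power_mult)
        finally have "2 * d * (L^4 * (x * y)) \<le> d\<^sup>2 * x\<^sup>2 + L^8 * y\<^sup>2" by argo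
        moreover have "0 \<le> d * (L^4 * (x * y))" using d L xy by simp
        ultimately have "d * (L^4 * (x * y)) \<le> d\<^sup>2 * x\<^sup>2 + L^8 * y\<^sup>2" by argo
        also have "\<dots> = d * (d * x\<^sup>2 + L^8 / d * y\<^sup>2)" using d by (simp add: field_simps power2_eq_square)
        finally show ?thesis using d by simp
      qed
      finally show ?thesis .
    qed
    moreover have "0 \<le> d * y^6" using d xy by simp
    ultimately have "x * y^5 + x^5 * y \<le> 2 * (d * y^6) + d * x\<^sup>2 + (L^4 / d^3 * y\<^sup>2 + L^8 / d * y\<^sup>2)" by argo
    then show ?thesis using False by (simp add: distrib_right mult.assoc)
  qed
  then show ?thesis unfolding pows x_def[symmetric] y_def[symmetric] .
qed

text \<open>In the binomial expansion each mixed monomial of degree six is dominated by the two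
  extreme ones, and the coefficients 5, 10, 10, 5, 1 add up to 31.\<close>

lemma quintic_expansion:
  fixes b v :: real
  shows "\<bar>(b + v)^5 * v - v^6\<bar> \<le> 31 * (\<bar>b\<bar> * \<bar>v\<bar>^5 + \<bar>b\<bar>^5 * \<bar>v\<bar>)"
proof -
  define x y where "x = \<bar>b\<bar>" and "y = \<bar>v\<bar>"
  have xy: "x \<ge> 0" "y \<ge> 0" by (auto simp: x_def y_def)
  have mono: "x^Suc i * y^(5 - i) \<le> x * y^5 + x^5 * y" if "i \<le> 4" for i
  proof (cases "x \<le> y")
    case True
    have "x^Suc i * y^(5 - i) = x * (x^i * y^(5 - i))" by simp
    also have "\<dots> \<le> x * (y^i * y^(5 - i))" using True xy by (intro mult_left_mono mult_right_mono power_mono) auto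
    also have "y^i * y^(5 - i) = y^5" using that by (simp flip: power_add)
    finally show ?thesis using xy by (simp add: add_increasing2)
  next
    case False
    have "5 - i = Suc (4 - i)" using that by simp
    then have "x^Suc i * y^(5 - i) = x^Suc i * y^(4 - i) * y" by simp
    also have "\<dots> \<le> x^Suc i * x^(4 - i) * y" using False xy by (intro mult_left_mono mult_right_mono power_mono) auto
    also have "x^Suc i * x^(4 - i) = x^5" using that by (simp flip: power_add power_Suc)
    finally show ?thesis using xy by (simp add: add_increasing)
  qed
  have eq: "(b + v)^5 * v - v^6 = 5 * (b * v^5) + 10 * (b^2 * v^4) + 10 * (b^3 * v^3) + 5 * (b^4 * v^2) + b^5 * v"
    by (simp add: eval_nat_numeral algebra_simps)
  have "\<bar>(b + v)^5 * v - v^6\<bar> \<le> 5 * (x * y^5) + 10 * (x^2 * y^4) + 10 * (x^3 * y^3) + 5 * (x^4 * y^2) + x^5 * y"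
    unfolding eq x_def y_def by (intro order.trans[OF abs_triangle_ineq] add_mono) (auto simp: abs_mult power_abs)
  also have "\<dots> \<le> 31 * (x * y^5 + x^5 * y)"
    using mono[of 0] mono[of 1] mono[of 2] mono[of 3] mono[of 4] by (simp add: eval_nat_numeral)
  finally show ?thesis by (simp add: x_def y_def)
qed

text \<open>Again the binomial coefficients add up to 31. With x the maximum of |b| and |\<psi>|
  each monomial is at most x^(5-i) |v|^(i+1), and comparing |v| with d x puts it below d x^6 or
  |v|^6 / d^5.\<close>

lemma quintic_difference:
  fixes b v \<psi> d :: real
  assumes d: "0 < d" "d \<le> 1"
  shows "\<bar>((b + v)^5 - b^5) * \<psi>\<bar> \<le> 31 * (d * (b^6 + \<psi>^6) + v^6 / d^5)"
proof -
  define x y z where "x = max \<bar>b\<bar> \<bar>\<psi>\<bar>" and "y = \<bar>v\<bar>" and "z = \<bar>\<psi>\<bar>"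
  have xy: "x \<ge> 0" "y \<ge> 0" "z \<ge> 0" "z \<le> x" "\<bar>b\<bar> \<le> x" by (auto simp: x_def y_def z_def)
  define R where "R = d * x^6 + y^6 / d^5"
  have term_le: "x^(5 - i) * y^Suc i \<le> R" if i: "i \<le> 4" for i
  proof (cases "y \<le> d * x")
    case True
    have "x^(5 - i) * y^Suc i \<le> x^(5 - i) * (d * x)^Suc i" using True xy by (intro mult_left_mono power_mono) auto
    also have "\<dots> = d^Suc i * x^6" using i by (simp add: power_mult_distrib mult_ac flip: power_add power_Suc)
    also have "\<dots> \<le> d * x^6"
      using d xy power_decreasing[of 1 "Suc i" d] by (intro mult_right_mono) auto
    finally show ?thesis using d xy by (simp add: R_def add_increasing2)
  next
    case False
    then have x: "x \<le> y / d" using d by (simp add: field_simps)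
    have "x^(5 - i) * y^Suc i \<le> (y / d)^(5 - i) * y^Suc i" using x xy by (intro mult_right_mono power_mono) auto
    also have "\<dots> = y^6 / d^(5 - i)" using i by (simp add: power_divide flip: power_add power_Suc)
    also have "\<dots> \<le> y^6 / d^5"
      using d xy by (intro divide_left_mono power_decreasing) auto
    finally show ?thesis using d xy by (simp add: R_def add_increasing)
  qed
  have t: "\<bar>b\<bar>^(4 - i) * y^Suc i * z \<le> R" if i: "i \<le> 4" for i
  proof -
    have "\<bar>b\<bar>^(4 - i) * y^Suc i * z \<le> x^(4 - i) * y^Suc i * x"
      using xy by (intro mult_mono power_mono) auto
    also have "\<dots> = x^(5 - i) * y^Suc i"
    proof -
      have "5 - i = Suc (4 - i)" using i by simp
      then show ?thesis by simp
    qed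
    finally show ?thesis using term_le[OF i] by linarith
  qed
  have eq: "((b + v)^5 - b^5) * \<psi> = 5 * (b^4 * v * \<psi>) + 10 * (b^3 * v^2 * \<psi>) + 10 * (b^2 * v^3 * \<psi>) + 5 * (b * v^4 * \<psi>) + v^5 * \<psi>"
    by (simp add: eval_nat_numeral algebra_simps)
  have "\<bar>((b + v)^5 - b^5) * \<psi>\<bar> \<le> 5 * (\<bar>b\<bar>^4 * y * z) + 10 * (\<bar>b\<bar>^3 * y^2 * z) + 10 * (\<bar>b\<bar>^2 * y^3 * z) + 5 * (\<bar>b\<bar> * y^4 * z) + y^5 * z"
    unfolding eq y_def z_def by (intro order.trans[OF abs_triangle_ineq] add_mono) (auto simp: abs_mult power_abs)
  also have "\<dots> \<le> 31 * R"
    using t[of 0] t[of 1] t[of 2] t[of 3] t[of 4] by (simp add: eval_nat_numeral)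
  also have "R \<le> d * (b^6 + \<psi>^6) + v^6 / d^5"
  proof -
    have "x^6 \<le> b^6 + \<psi>^6" unfolding x_def by (auto simp: max_def power_even_abs)
    then have "d * x^6 \<le> d * (b^6 + \<psi>^6)" using d by (intro mult_left_mono) auto
    then show ?thesis by (simp add: R_def y_def power_even_abs)
  qed
  finally show ?thesis by simp
qed

text \<open>For m <= 1 the function |t|^m t grows at most quadratically, and its difference
  quotients are bounded by an affine expression in the arguments. That is the growth which L^2
  pairings of L^6 functions tolerate.\<close>

lemma powr_difference:
  fixes a b m :: real
  assumes m: "0 < m" "m \<le> 1"
  shows "\<bar>\<bar>a\<bar> powr m * a - \<bar>b\<bar> powr m * b\<bar> \<le> 2 * (1 + \<bar>a\<bar> + \<bar>b\<bar>) * \<bar>a - b\<bar>"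
proof -
  have le1: "t powr m \<le> 1 + t" if "t \<ge> 0" for t
  proof (cases "t \<le> 1")
    case True
    then show ?thesis using that m by (simp add: powr_le1 add_increasing2)
  next
    case False
    then have "t powr m \<le> t powr 1" using m by (intro powr_mono) auto
    then show ?thesis using that by simp
  qed
  have pos: "s powr m * s - t powr m * t \<le> 2 * (1 + s) * (s - t) \<and> t powr m * t \<le> s powr m * s" if "0 \<le> t" "t \<le> s" for s t
  proof (cases "s = 0")
    case True then show ?thesis using that by simp
  next
    case False
    then have s: "s > 0" using that by simp
    \<comment> \<open>Here m <= 1 enters: it bounds t^m from below by s^m (t / s), and the resulting
      difference factors through (s + t) (s - t).\<close>
    have "(t / s) \<le> (t / s) powr m"
    proof (cases "t = 0")
      case False
      then have "(t / s) powr 1 \<le> (t / s) powr m" using m that s by (intro powr_mono') auto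
      then show ?thesis using that s by simp
    qed simp
    then have "s powr m * (t / s) \<le> s powr m * (t / s) powr m" by (intro mult_left_mono) auto
    also have "s powr m * (t / s) powr m = t powr m" using s that by (simp add: powr_divide)
    finally have "s powr m * (t / s) * t \<le> t powr m * t" using that by (intro mult_right_mono) auto
    moreover have "s powr m * s - s powr m * (t / s) * t = s powr m * ((s + t) / s) * (s - t)"
      using s by (simp add: field_simps)
    moreover have "s powr m * ((s + t) / s) * (s - t) \<le> (1 + s) * 2 * (s - t)"
      using s that by (intro mult_right_mono mult_mono le1) (auto simp: field_simps)
    moreover have "t powr m * t \<le> s powr m * s"
      using that m by (intro mult_mono powr_mono2) auto
    ultimately show ?thesis by argo
  qed
  have same: "\<bar>s powr m * s - t powr m * t\<bar> \<le> 2 * (1 + s + t) * \<bar>s - t\<bar>" if "0 \<le> t" "0 \<le> s" for s t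
  proof -
    have *: "\<bar>s powr m * s - t powr m * t\<bar> \<le> 2 * (1 + s + t) * \<bar>s - t\<bar>" if "0 \<le> t" "t \<le> s" for s t
    proof -
      have "2 * (1 + s) * (s - t) \<le> 2 * (1 + s + t) * (s - t)" using that by (intro mult_right_mono) auto
      then show ?thesis using pos[OF that] that by simp
    qed
    show ?thesis
    proof (cases "t \<le> s")
      case True then show ?thesis using *[of t s] that by simp
    next
      case False then show ?thesis using *[of s t] that by (simp add: abs_minus_commute add_ac)
    qed
  qed
  have opp: "s powr m * s + t powr m * t \<le> 2 * (1 + s + t) * (s + t)" if "0 \<le> t" "0 \<le> s" for s t
  proof -
    have "s powr m * s \<le> (1 + s + t) * s" "t powr m * t \<le> (1 + s + t) * t"
      using le1[of s] le1[of t] that by (intro mult_right_mono; linarith)+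
    then have "s powr m * s + t powr m * t \<le> (1 + s + t) * (s + t)" by (simp only: distrib_left[of "1 + s + t"])
    also have "\<dots> \<le> 2 * ((1 + s + t) * (s + t))" using that by simp
    finally show ?thesis by (simp only: mult.assoc)
  qed
  consider "a \<ge> 0" "b \<ge> 0" | "a \<ge> 0" "b < 0" | "a < 0" "b \<ge> 0" | "a < 0" "b < 0" by linarith
  then show ?thesis
  proof cases
    case 1 then show ?thesis using same[of b a] by simp
  next
    case 2
    have "0 \<le> a powr m * a" "0 \<le> (- b) powr m * (- b)" by (rule mult_nonneg_nonneg; use 2 in simp)+
    moreover have "\<bar>a\<bar> powr m * a = a powr m * a" "\<bar>b\<bar> powr m * b = - ((- b) powr m * (- b))" using 2 by auto
    ultimately have "\<bar>\<bar>a\<bar> powr m * a - \<bar>b\<bar> powr m * b\<bar> = a powr m * a + (- b) powr m * (- b)" by linarith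
    moreover have "1 + \<bar>a\<bar> + \<bar>b\<bar> = 1 + a + (- b)" "\<bar>a - b\<bar> = a + (- b)" using 2 by auto
    ultimately show ?thesis using opp[of "-b" a] 2 by (simp only: neg_0_le_iff_le less_imp_le)
  next
    case 3
    have "0 \<le> b powr m * b" "0 \<le> (- a) powr m * (- a)" by (rule mult_nonneg_nonneg; use 3 in simp)+
    moreover have "\<bar>b\<bar> powr m * b = b powr m * b" "\<bar>a\<bar> powr m * a = - ((- a) powr m * (- a))" using 3 by auto
    ultimately have "\<bar>\<bar>a\<bar> powr m * a - \<bar>b\<bar> powr m * b\<bar> = (- a) powr m * (- a) + b powr m * b" by linarith
    moreover have "1 + \<bar>a\<bar> + \<bar>b\<bar> = 1 + (- a) + b" "\<bar>a - b\<bar> = (- a) + b" using 3 by auto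
    ultimately show ?thesis using opp[of b "-a"] 3 by (simp only: neg_0_le_iff_le less_imp_le)
  next
    case 4 
    have "\<bar>(- a) powr m * (- a) - (- b) powr m * (- b)\<bar> \<le> 2 * (1 + (- a) + (- b)) * \<bar>(- a) - (- b)\<bar>"
      using same[of "-b" "-a"] 4 by simp
    then show ?thesis using 4 by (simp add: abs_minus_commute)
  qed
qed

section \<open>Products under L^2 convergence and L^6 bounds\<close>

definition six_integrable :: "'a measure \<Rightarrow> ('a \<Rightarrow> real) \<Rightarrow> bool" where
  "six_integrable M u \<longleftrightarrow> u \<in> borel_measurable M \<and> integrable M (\<lambda>x. (u x)^6)"

text \<open>What compactness and the Sobolev inequality provide together: strong convergence in L^2
  with bounded L^6 norms. The terms below the critical power are continuous under it.\<close>

definition six_tendsto :: "'a measure \<Rightarrow> (nat \<Rightarrow> 'a \<Rightarrow> real) \<Rightarrow> ('a \<Rightarrow> real) \<Rightarrow> bool" where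
  "six_tendsto M u u0 \<longleftrightarrow> (\<forall>n. six_integrable M (u n)) \<and> six_integrable M u0 \<and>
     (\<exists>K. \<forall>n. (LINT x|M. (u n x)^6) \<le> K) \<and> (\<lambda>n. sqnorm M (\<lambda>x. u n x - u0 x)) \<longlonglongrightarrow> 0"

lemma six_integrable_measurable: "six_integrable M u \<Longrightarrow> u \<in> borel_measurable M"
  by (simp add: six_integrable_def)

lemma integral_bounded_null:
  fixes a v :: "nat \<Rightarrow> 'a \<Rightarrow> real"
  assumes a: "\<And>n. square_integrable M (a n)" "\<And>n. sqnorm M (a n) \<le> K"
    and v: "\<And>n. square_integrable M (v n)" "(\<lambda>n. sqnorm M (v n)) \<longlonglongrightarrow> 0"
  shows "(\<lambda>n. LINT x|M. a n x * v n x) \<longlonglongrightarrow> 0"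
proof -
  have "(\<lambda>n. sqrt (K * sqnorm M (v n))) \<longlonglongrightarrow> sqrt (K * 0)"
    by (intro tendsto_intros v)
  then have lim0: "(\<lambda>n. sqrt (K * sqnorm M (v n))) \<longlonglongrightarrow> 0" by simp
  show ?thesis
  proof (rule Lim_null_comparison[OF _ lim0], intro always_eventually allI)
    fix n
    have "(LINT x|M. a n x * v n x)\<^sup>2 \<le> sqnorm M (a n) * sqnorm M (v n)"
      using integral_Cauchy_Schwarz[OF a(1) v(1)] by (simp only: inner_real_def)
    also have "\<dots> \<le> K * sqnorm M (v n)" by (intro mult_right_mono a) simp
    finally show "norm (LINT x|M. a n x * v n x) \<le> sqrt (K * sqnorm M (v n))"
      by (simp add: real_le_rsqrt)
  qed
qed

lemma square_integrable_mult_integrable: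
  fixes f g :: "'a \<Rightarrow> real"
  shows "square_integrable M f \<Longrightarrow> square_integrable M g \<Longrightarrow> integrable M (\<lambda>x. f x * g x)"
  using square_integrable_inner[of M f g] by (simp only: inner_real_def)

lemma sqnorm_three_le:
  fixes f g h :: "'a \<Rightarrow> real"
  assumes "square_integrable M f" "square_integrable M g" "square_integrable M h"
  shows "square_integrable M (\<lambda>x. 2 * (f x + g x + h x))"
    and "sqnorm M (\<lambda>x. 2 * (f x + g x + h x)) \<le> 16 * sqnorm M f + 16 * sqnorm M g + 8 * sqnorm M h"
proof -
  have fg: "square_integrable M (\<lambda>x. f x + g x)" by (intro square_integrable_add assms)
  show "square_integrable M (\<lambda>x. 2 * (f x + g x + h x))"
    using square_integrable_scaleR[OF square_integrable_add[OF fg assms(3)], of 2] by simp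
  have "sqnorm M (\<lambda>x. 2 * (f x + g x + h x)) = 4 * sqnorm M (\<lambda>x. f x + g x + h x)"
    using sqnorm_scaleR[of M 2 "\<lambda>x. f x + g x + h x"] by simp
  then show "sqnorm M (\<lambda>x. 2 * (f x + g x + h x)) \<le> 16 * sqnorm M f + 16 * sqnorm M g + 8 * sqnorm M h"
    using sqnorm_add_le[OF fg assms(3)] sqnorm_add_le[OF assms(1,2)] by argo
qed

context finite_measure
begin

lemma six_integrable_square:
  assumes u: "six_integrable M u"
  shows "square_integrable M u" "sqnorm M u \<le> measure M (space M) + (LINT x|M. (u x)^6)"
proof -
  have m[measurable]: "u \<in> borel_measurable M" and i: "integrable M (\<lambda>x. (u x)^6)"
    using u by (auto simp: six_integrable_def)
  have i1: "integrable M (\<lambda>x. 1 + (u x)^6)" using i by simp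
  have int: "integrable M (\<lambda>x. (u x)\<^sup>2)"
    by (rule Bochner_Integration.integrable_bound[OF i1]) (use square_le_six in \<open>auto intro!: AE_I2 simp: abs_of_nonneg add_nonneg_nonneg\<close>)
  then show "square_integrable M u" using m by (simp add: square_integrable_def)
  have "sqnorm M u \<le> (LINT x|M. 1 + (u x)^6)"
    unfolding sqnorm_def using int i1 square_le_six by (intro integral_mono) auto
  then show "sqnorm M u \<le> measure M (space M) + (LINT x|M. (u x)^6)" using i by simp
qed

lemma six_integrable_mult:
  assumes u: "six_integrable M u" and w: "six_integrable M w"
  shows "square_integrable M (\<lambda>x. u x * w x)"
    and "sqnorm M (\<lambda>x. u x * w x) \<le> 2 * measure M (space M) + (LINT x|M. (u x)^6) + (LINT x|M. (w x)^6)"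
proof -
  have m[measurable]: "u \<in> borel_measurable M" "w \<in> borel_measurable M"
    and i: "integrable M (\<lambda>x. (u x)^6)" "integrable M (\<lambda>x. (w x)^6)"
    using u w by (auto simp: six_integrable_def)
  have i1: "integrable M (\<lambda>x. 2 + (u x)^6 + (w x)^6)" using i by simp
  have le: "(u x * w x)\<^sup>2 \<le> 2 + (u x)^6 + (w x)^6" for x using abs_mult_le_six[of "u x" "w x"] by simp
  have int: "integrable M (\<lambda>x. (u x * w x)\<^sup>2)"
    by (rule Bochner_Integration.integrable_bound[OF i1]) (use le in \<open>auto intro!: AE_I2 simp: abs_of_nonneg add_nonneg_nonneg\<close>)
  then show "square_integrable M (\<lambda>x. u x * w x)" by (simp add: square_integrable_def)
  have "sqnorm M (\<lambda>x. u x * w x) \<le> (LINT x|M. 2 + (u x)^6 + (w x)^6)"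
    unfolding sqnorm_def using int i1 le by (intro integral_mono) auto
  then show "sqnorm M (\<lambda>x. u x * w x) \<le> 2 * measure M (space M) + (LINT x|M. (u x)^6) + (LINT x|M. (w x)^6)"
    using i by simp
qed

lemma six_tendstoD:
  assumes "six_tendsto M u u0"
  shows "\<And>n. six_integrable M (u n)" "six_integrable M u0" "\<And>n. square_integrable M (u n)" "square_integrable M u0"
    "(\<lambda>n. sqnorm M (\<lambda>x. u n x - u0 x)) \<longlonglongrightarrow> 0" "\<exists>K. \<forall>n. (LINT x|M. (u n x)^6) \<le> K"
  using assms six_integrable_square(1) unfolding six_tendsto_def by blast+

lemma six_tendsto_const: "six_integrable M u \<Longrightarrow> six_tendsto M (\<lambda>_. u) u"
  by (auto simp: six_tendsto_def sqnorm_def)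

text \<open>The factors are replaced one at a time. The other two form a product bounded in L^2 by
  their L^6 norms, and the difference of the replaced factor tends to 0 in L^2.\<close>

lemma six_tendsto_triple:
  assumes a: "six_tendsto M a a0" and c: "six_tendsto M c c0" and d: "six_tendsto M d d0"
  shows "(\<lambda>n. LINT x|M. a n x * c n x * d n x) \<longlonglongrightarrow> (LINT x|M. a0 x * c0 x * d0 x)"
proof -
  note A = six_tendstoD[OF a] and C = six_tendstoD[OF c] and D = six_tendstoD[OF d]
  obtain Ka Kc Kd where K: "\<And>n. (LINT x|M. (a n x)^6) \<le> Ka" "\<And>n. (LINT x|M. (c n x)^6) \<le> Kc" "\<And>n. (LINT x|M. (d n x)^6) \<le> Kd"
    using A(6) C(6) D(6) by blast
  define \<mu> where "\<mu> = measure M (space M)"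
  have 1: "(\<lambda>n. LINT x|M. (c n x * d n x) * (a n x - a0 x)) \<longlonglongrightarrow> 0"
  proof (rule integral_bounded_null[where K="2 * \<mu> + Kc + Kd"])
    show "sqnorm M (\<lambda>x. c n x * d n x) \<le> 2 * \<mu> + Kc + Kd" for n
      using six_integrable_mult(2)[OF C(1)[of n] D(1)[of n]] K(2,3)[of n] unfolding \<mu>_def by linarith
  qed (intro six_integrable_mult C D A square_integrable_diff)+
  have 2: "(\<lambda>n. LINT x|M. (a0 x * d n x) * (c n x - c0 x)) \<longlonglongrightarrow> 0"
  proof (rule integral_bounded_null[where K="2 * \<mu> + (LINT x|M. (a0 x)^6) + Kd"])
    show "sqnorm M (\<lambda>x. a0 x * d n x) \<le> 2 * \<mu> + (LINT x|M. (a0 x)^6) + Kd" for n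
      using six_integrable_mult(2)[OF A(2) D(1)[of n]] K(3)[of n] unfolding \<mu>_def by linarith
  qed (intro six_integrable_mult C D A square_integrable_diff)+
  have 3: "(\<lambda>n. LINT x|M. (a0 x * c0 x) * (d n x - d0 x)) \<longlonglongrightarrow> 0"
    by (rule integral_bounded_null[OF _ order_refl]) (intro six_integrable_mult C D A square_integrable_diff)+
  have i: "integrable M (\<lambda>x. (f x * g x) * h x)"
    if "six_integrable M f" "six_integrable M g" "square_integrable M h" for f g h :: "'a \<Rightarrow> real"
    by (intro square_integrable_mult_integrable six_integrable_mult that)
  have "(LINT x|M. (c n x * d n x) * (a n x - a0 x)) + (LINT x|M. (a0 x * d n x) * (c n x - c0 x))
      + (LINT x|M. (a0 x * c0 x) * (d n x - d0 x)) = (LINT x|M. a n x * c n x * d n x) - (LINT x|M. a0 x * c0 x * d0 x)" for n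
  proof -
    have i4: "integrable M (\<lambda>x. a n x * c n x * d n x)" "integrable M (\<lambda>x. a0 x * c0 x * d0 x)"
      by (intro i A C D)+
    have "(LINT x|M. (c n x * d n x) * (a n x - a0 x)) + (LINT x|M. (a0 x * d n x) * (c n x - c0 x))
      + (LINT x|M. (a0 x * c0 x) * (d n x - d0 x)) =
      (LINT x|M. (c n x * d n x) * (a n x - a0 x) + (a0 x * d n x) * (c n x - c0 x) + (a0 x * c0 x) * (d n x - d0 x))"
      using i[OF C(1) D(1) square_integrable_diff[OF A(3,4)], of n n n] i[OF A(2) D(1) square_integrable_diff[OF C(3,4)], of n n]
        i[OF A(2) C(2) square_integrable_diff[OF D(3,4)], of n]
      by simp
    also have "\<dots> = (LINT x|M. a n x * c n x * d n x - a0 x * c0 x * d0 x)"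
      by (rule Bochner_Integration.integral_cong) (auto simp: algebra_simps)
    finally show ?thesis using i4 by simp
  qed
  then have "(\<lambda>n. (LINT x|M. a n x * c n x * d n x) - (LINT x|M. a0 x * c0 x * d0 x)) \<longlonglongrightarrow> 0"
    using tendsto_add[OF tendsto_add[OF 1 2] 3] by simp
  then show ?thesis by (simp add: LIM_zero_iff)
qed

lemma six_tendsto_double:
  assumes a: "six_tendsto M a a0" and c: "six_tendsto M c c0"
  shows "(\<lambda>n. LINT x|M. a n x * c n x) \<longlonglongrightarrow> (LINT x|M. a0 x * c0 x)"
proof -
  have "six_integrable M (\<lambda>_. 1)" by (simp add: six_integrable_def)
  from six_tendsto_triple[OF a c six_tendsto_const[OF this]] show ?thesis by simp
qed

lemma powr_square_integrable:
  assumes u: "six_integrable M u" and m: "0 < m" "m \<le> 1"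
  shows "square_integrable M (\<lambda>x. \<bar>u x\<bar> powr m * u x)"
  unfolding square_integrable_def
proof
  note [measurable] = six_integrable_measurable[OF u]
  show "(\<lambda>x. \<bar>u x\<bar> powr m * u x) \<in> borel_measurable M" by measurable
  \<comment> \<open>The summand 0 fits the three-term form of \<open>sqnorm_three_le\<close>; the
    bound itself is \<open>powr_difference\<close> at b = 0.\<close>
  have s: "square_integrable M (\<lambda>x. 2 * (\<bar>u x\<bar> + \<bar>u x * u x\<bar> + 0))"
    using six_integrable_square(1)[OF u] six_integrable_mult(1)[OF u u]
    by (intro sqnorm_three_le) (auto simp: square_integrable_def)
  show "integrable M (\<lambda>x. (norm (\<bar>u x\<bar> powr m * u x))\<^sup>2)"
  proof (rule Bochner_Integration.integrable_bound)
    show "integrable M (\<lambda>x. (norm (2 * (\<bar>u x\<bar> + \<bar>u x * u x\<bar> + 0)))\<^sup>2)" using s by (simp only: square_integrable_def)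
    have "norm (\<bar>u x\<bar> powr m * u x) \<le> norm (2 * (\<bar>u x\<bar> + \<bar>u x * u x\<bar> + 0))" for x
      using powr_difference[OF m, of "u x" 0] by (simp add: abs_mult algebra_simps)
    then have "(norm (\<bar>u x\<bar> powr m * u x))\<^sup>2 \<le> (norm (2 * (\<bar>u x\<bar> + \<bar>u x * u x\<bar> + 0)))\<^sup>2" for x
      by (rule power_mono) simp
    then show "AE x in M. norm ((norm (\<bar>u x\<bar> powr m * u x))\<^sup>2) \<le> norm ((norm (2 * (\<bar>u x\<bar> + \<bar>u x * u x\<bar> + 0)))\<^sup>2)"
      by (intro AE_I2) (simp only: real_norm_def abs_power2)
  qed simp
qed

text \<open>The Lipschitz-type bound turns the first difference into a pairing of |u n - u0|, null
  in L^2, with products bounded in L^2; the second difference replaces \<open>w n\<close> against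
  the fixed power of \<open>u0\<close>.\<close>

lemma six_tendsto_powr:
  assumes u: "six_tendsto M u u0" and w: "six_tendsto M w w0" and m: "0 < m" "m \<le> 1"
  shows "(\<lambda>n. LINT x|M. \<bar>u n x\<bar> powr m * u n x * w n x) \<longlonglongrightarrow> (LINT x|M. \<bar>u0 x\<bar> powr m * u0 x * w0 x)"
proof -
  note U = six_tendstoD[OF u] and W = six_tendstoD[OF w]
  obtain Ku Kw where K: "\<And>n. (LINT x|M. (u n x)^6) \<le> Ku" "\<And>n. (LINT x|M. (w n x)^6) \<le> Kw"
    using U(6) W(6) by blast
  define \<mu> where "\<mu> = measure M (space M)"
  define f where "f = (\<lambda>t::real. \<bar>t\<bar> powr m * t)"
  have f: "square_integrable M (\<lambda>x. f (u n x))" "square_integrable M (\<lambda>x. f (u0 x))" for n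
    unfolding f_def by (intro powr_square_integrable U m)+
  define a where "a = (\<lambda>n x. 2 * (\<bar>w n x\<bar> + \<bar>u n x * w n x\<bar> + \<bar>u0 x * w n x\<bar>))"
  have abs: "square_integrable M (\<lambda>x. \<bar>g x\<bar>)" "sqnorm M (\<lambda>x. \<bar>g x\<bar>) = sqnorm M g" if "square_integrable M g" for g :: "'a \<Rightarrow> real"
    using that by (auto simp: square_integrable_def sqnorm_def)
  note s1 = abs(1)[OF W(3)] and s2 = abs(1)[OF six_integrable_mult(1)[OF U(1) W(1)]] and s3 = abs(1)[OF six_integrable_mult(1)[OF U(2) W(1)]]
  have a: "square_integrable M (a n)" for n
    unfolding a_def by (rule sqnorm_three_le(1)[OF s1 s2 s3])
  have aK: "sqnorm M (a n) \<le> 16 * (\<mu> + Kw) + 16 * (2 * \<mu> + Ku + Kw) + 8 * (2 * \<mu> + (LINT x|M. (u0 x)^6) + Kw)" for n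
  proof -
    have "sqnorm M (a n) \<le> 16 * sqnorm M (\<lambda>x. \<bar>w n x\<bar>) + 16 * sqnorm M (\<lambda>x. \<bar>u n x * w n x\<bar>) + 8 * sqnorm M (\<lambda>x. \<bar>u0 x * w n x\<bar>)"
      unfolding a_def by (rule sqnorm_three_le(2)[OF s1 s2 s3])
    moreover have "sqnorm M (\<lambda>x. \<bar>w n x\<bar>) \<le> \<mu> + Kw"
      using abs(2)[OF W(3)[of n]] six_integrable_square(2)[OF W(1)[of n]] K(2)[of n] unfolding \<mu>_def by linarith
    moreover have "sqnorm M (\<lambda>x. \<bar>u n x * w n x\<bar>) \<le> 2 * \<mu> + Ku + Kw"
      using abs(2)[OF six_integrable_mult(1)[OF U(1)[of n] W(1)[of n]]] six_integrable_mult(2)[OF U(1)[of n] W(1)[of n]] K[of n]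
      unfolding \<mu>_def by linarith
    moreover have "sqnorm M (\<lambda>x. \<bar>u0 x * w n x\<bar>) \<le> 2 * \<mu> + (LINT x|M. (u0 x)^6) + Kw"
      using abs(2)[OF six_integrable_mult(1)[OF U(2) W(1)[of n]]] six_integrable_mult(2)[OF U(2) W(1)[of n]] K[of n]
      unfolding \<mu>_def by linarith
    ultimately show ?thesis by argo
  qed
  have v: "square_integrable M (\<lambda>x. u n x - u0 x)" for n by (intro square_integrable_diff U)
  have lim0: "(\<lambda>n. LINT x|M. a n x * \<bar>u n x - u0 x\<bar>) \<longlonglongrightarrow> 0"
    by (rule integral_bounded_null[OF a aK abs(1)[OF v]]) (simp only: abs(2)[OF v] U)
  have 1: "(\<lambda>n. LINT x|M. (f (u n x) - f (u0 x)) * w n x) \<longlonglongrightarrow> 0"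
  proof (rule Lim_null_comparison[OF _ lim0], intro always_eventually allI)
    fix n
    have "norm (LINT x|M. (f (u n x) - f (u0 x)) * w n x) \<le> (LINT x|M. norm ((f (u n x) - f (u0 x)) * w n x))"
      by (rule integral_norm_bound)
    also have "\<dots> \<le> (LINT x|M. a n x * \<bar>u n x - u0 x\<bar>)"
    proof (rule integral_mono)
      show "integrable M (\<lambda>x. norm ((f (u n x) - f (u0 x)) * w n x))"
        by (intro integrable_norm square_integrable_mult_integrable square_integrable_diff f W)
      show "integrable M (\<lambda>x. a n x * \<bar>u n x - u0 x\<bar>)"
        by (intro square_integrable_mult_integrable a abs v)
      fix x
      have "\<bar>f (u n x) - f (u0 x)\<bar> * \<bar>w n x\<bar> \<le> (2 * (1 + \<bar>u n x\<bar> + \<bar>u0 x\<bar>) * \<bar>u n x - u0 x\<bar>) * \<bar>w n x\<bar>"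
        unfolding f_def by (intro mult_right_mono powr_difference m) auto
      also have "\<dots> = a n x * \<bar>u n x - u0 x\<bar>" by (simp add: a_def abs_mult algebra_simps)
      finally show "norm ((f (u n x) - f (u0 x)) * w n x) \<le> a n x * \<bar>u n x - u0 x\<bar>" by (simp add: abs_mult)
    qed
    finally show "norm (LINT x|M. (f (u n x) - f (u0 x)) * w n x) \<le> (LINT x|M. a n x * \<bar>u n x - u0 x\<bar>)" .
  qed
  have 2: "(\<lambda>n. LINT x|M. f (u0 x) * (w n x - w0 x)) \<longlonglongrightarrow> 0"
    by (rule integral_bounded_null[OF f(2) order_refl]) (intro square_integrable_diff W)+
  have "(LINT x|M. (f (u n x) - f (u0 x)) * w n x) + (LINT x|M. f (u0 x) * (w n x - w0 x)) =
      (LINT x|M. f (u n x) * w n x) - (LINT x|M. f (u0 x) * w0 x)" for n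
    using square_integrable_mult_integrable[OF f(1) W(3), of n n] square_integrable_mult_integrable[OF f(2) W(3), of n]
      square_integrable_mult_integrable[OF f(2) W(4)]
    by (simp add: left_diff_distrib right_diff_distrib)
  then have "(\<lambda>n. (LINT x|M. f (u n x) * w n x) - (LINT x|M. f (u0 x) * w0 x)) \<longlonglongrightarrow> 0"
    using tendsto_add[OF 1 2] by simp
  then show ?thesis by (simp add: LIM_zero_iff f_def)
qed

section \<open>The critical term\<close>

lemma quintic_integrable:
  assumes u: "six_integrable M u" and w: "six_integrable M w"
  shows "integrable M (\<lambda>x. (u x)^5 * w x)"
proof -
  note [measurable] = six_integrable_measurable[OF u] six_integrable_measurable[OF w]
  have "integrable M (\<lambda>x. 31 * (1 * (0^6 + (w x)^6) + (u x)^6 / 1^5))"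
    using u w by (simp add: six_integrable_def)
  then show ?thesis
    by (rule Bochner_Integration.integrable_bound)
       (use quintic_difference[of 1 0 "u _" "w _"] in \<open>auto intro!: AE_I2 simp: abs_of_nonneg\<close>)
qed

text \<open>Under strong L^6 convergence the parameter d first makes the fixed part small; the
  remaining integral, weighted by 1 / d^5, then tends to 0.\<close>

lemma quintic_strong_tendsto:
  assumes u: "\<And>n. six_integrable M (u n)" and u0: "six_integrable M u0"
    and v: "\<And>n. six_integrable M (\<lambda>x. u n x - u0 x)" "(\<lambda>n. LINT x|M. (u n x - u0 x)^6) \<longlonglongrightarrow> 0"
    and w: "six_integrable M w"
  shows "(\<lambda>n. LINT x|M. (u n x)^5 * w x) \<longlonglongrightarrow> (LINT x|M. (u0 x)^5 * w x)"
proof -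
  define I where "I = (LINT x|M. (u0 x)^6) + (LINT x|M. (w x)^6)"
  have I: "I \<ge> 0" unfolding I_def by (intro add_nonneg_nonneg Bochner_Integration.integral_nonneg) auto
  have bound: "\<bar>(LINT x|M. (u n x)^5 * w x) - (LINT x|M. (u0 x)^5 * w x)\<bar> \<le> 31 * (d * I + (LINT x|M. (u n x - u0 x)^6) / d^5)"
    if d: "0 < d" "d \<le> 1" for n d
  proof -
    have "(LINT x|M. (u n x)^5 * w x) - (LINT x|M. (u0 x)^5 * w x) = (LINT x|M. ((u n x)^5 - (u0 x)^5) * w x)"
      using quintic_integrable[OF u w, of n] quintic_integrable[OF u0 w] by (simp add: left_diff_distrib)
    then have "\<bar>(LINT x|M. (u n x)^5 * w x) - (LINT x|M. (u0 x)^5 * w x)\<bar> \<le> (LINT x|M. \<bar>((u n x)^5 - (u0 x)^5) * w x\<bar>)"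
      using integral_abs_bound by simp
    also have "\<dots> \<le> (LINT x|M. 31 * (d * ((u0 x)^6 + (w x)^6) + (u n x - u0 x)^6 / d^5))"
    proof (rule integral_mono)
      show "integrable M (\<lambda>x. \<bar>((u n x)^5 - (u0 x)^5) * w x\<bar>)"
        using quintic_integrable[OF u w, of n] quintic_integrable[OF u0 w] by (simp add: left_diff_distrib)
      show "integrable M (\<lambda>x. 31 * (d * ((u0 x)^6 + (w x)^6) + (u n x - u0 x)^6 / d^5))"
        using u0 v(1)[of n] w by (simp add: six_integrable_def)
      show "\<bar>((u n x)^5 - (u0 x)^5) * w x\<bar> \<le> 31 * (d * ((u0 x)^6 + (w x)^6) + (u n x - u0 x)^6 / d^5)" for x
        using quintic_difference[OF d, of "u0 x" "u n x - u0 x" "w x"] by simp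
    qed
    also have "\<dots> = 31 * (d * I + (LINT x|M. (u n x - u0 x)^6) / d^5)"
      using u0 v(1)[of n] w by (simp add: six_integrable_def I_def)
    finally show ?thesis .
  qed
  have "(\<lambda>n. (LINT x|M. (u n x)^5 * w x) - (LINT x|M. (u0 x)^5 * w x)) \<longlonglongrightarrow> 0"
  proof (rule LIMSEQ_I)
    fix e :: real assume e: "e > 0"
    \<comment> \<open>The choice gives 31 d I < e / 2, half of the allowed error; the added 1 keeps
      the denominator positive.\<close>
    define d where "d = min 1 (e / (62 * (I + 1)))"
    have d: "0 < d" "d \<le> 1" using e I by (auto simp: d_def)
    have "d * (62 * (I + 1)) \<le> e / (62 * (I + 1)) * (62 * (I + 1))"
      using I by (intro mult_right_mono) (auto simp: d_def)
    also have "\<dots> = e" using I by simp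
    finally have "d * (62 * (I + 1)) \<le> e" .
    then have dI: "62 * (d * I) < e" using d I by (simp add: algebra_simps)
    have "(\<lambda>n. 31 * ((LINT x|M. (u n x - u0 x)^6) / d^5)) \<longlonglongrightarrow> 31 * (0 / d^5)"
      using d by (intro tendsto_intros v) auto
    then have "\<forall>\<^sub>F n in sequentially. 31 * ((LINT x|M. (u n x - u0 x)^6) / d^5) < e / 2"
      by (rule order_tendstoD(2)) (use e in simp)
    then obtain N where N: "\<And>n. n \<ge> N \<Longrightarrow> 31 * ((LINT x|M. (u n x - u0 x)^6) / d^5) < e / 2"
      by (auto simp: eventually_sequentially)
    have "norm ((LINT x|M. (u n x)^5 * w x) - (LINT x|M. (u0 x)^5 * w x) - 0) < e" if "n \<ge> N" for n
      using bound[OF d, of n] N[OF that] dI unfolding real_norm_def diff_0_right by argo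
    then show "\<exists>N. \<forall>n\<ge>N. norm ((LINT x|M. (u n x)^5 * w x) - (LINT x|M. (u0 x)^5 * w x) - 0) < e" by blast
  qed
  then show ?thesis by (simp add: LIM_zero_iff)
qed

lemma six_tail:
  assumes b: "six_integrable M b" and e: "e > 0"
  shows "\<exists>L\<ge>1. (LINT x|M. (if \<bar>b x\<bar> > L then (b x)^6 else 0)) < e"
proof -
  note [measurable] = six_integrable_measurable[OF b]
  have "(\<lambda>n. LINT x|M. (if \<bar>b x\<bar> > real (Suc n) then (b x)^6 else 0)) \<longlonglongrightarrow> (LINT x|M. 0)"
  proof (rule integral_dominated_convergence[where w="\<lambda>x. (b x)^6"])
    show "integrable M (\<lambda>x. (b x)^6)" using b by (simp add: six_integrable_def)
    show "AE x in M. (\<lambda>n. if \<bar>b x\<bar> > real (Suc n) then (b x)^6 else 0) \<longlonglongrightarrow> 0"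
    proof (rule AE_I2)
      fix x
      obtain N where "\<bar>b x\<bar> \<le> real N" using real_arch_simple by blast
      then show "(\<lambda>n. if \<bar>b x\<bar> > real (Suc n) then (b x)^6 else 0) \<longlonglongrightarrow> 0"
        by (intro tendsto_eventually) (auto simp: eventually_sequentially intro!: exI[of _ N])
    qed
  qed auto
  then have "\<forall>\<^sub>F n in sequentially. (LINT x|M. (if \<bar>b x\<bar> > real (Suc n) then (b x)^6 else 0)) < e"
    by (rule order_tendstoD(2)) (use e in simp)
  then obtain n where "(LINT x|M. (if \<bar>b x\<bar> > real (Suc n) then (b x)^6 else 0)) < e"
    using eventually_happens'[OF sequentially_bot] by blast
  then show ?thesis by (intro exI[of _ "real (Suc n)"]) auto
qed

text \<open>The part of the Brezis--Lieb lemma that is needed, made elementary because the critical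
  exponent is an even integer.\<close>

lemma quintic_Brezis_Lieb:
  assumes u: "six_tendsto M u b" and v: "\<And>n. six_integrable M (\<lambda>x. u n x - b x)"
    and vK: "\<And>n. (LINT x|M. (u n x - b x)^6) \<le> K"
  shows "(\<lambda>n. (LINT x|M. (u n x)^5 * (u n x - b x)) - (LINT x|M. (u n x - b x)^6)) \<longlonglongrightarrow> 0"
proof -
  note U = six_tendstoD[OF u]
  note [measurable] = six_integrable_measurable[OF U(2)]
  define I where "I = sqnorm M b"
  have I: "I \<ge> 0" by (simp add: I_def)
  have "0 \<le> (LINT x|M. (u 0 x - b x)^6)" by (intro Bochner_Integration.integral_nonneg) auto
  then have K: "K \<ge> 0" using vK[of 0] by linarith
  define tail where "tail = (\<lambda>L. LINT x|M. (if \<bar>b x\<bar> > L then (b x)^6 else 0))"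
  have b6: "integrable M (\<lambda>x. (b x)^6)" "integrable M (\<lambda>x. (b x)\<^sup>2)"
    using U(2,4) by (auto simp: six_integrable_def square_integrable_def)
  have itail: "integrable M (\<lambda>x. if \<bar>b x\<bar> > L then (b x)^6 else 0)" for L
    by (rule Bochner_Integration.integrable_bound[OF b6(1)]) auto
  have bound: "\<bar>(LINT x|M. (u n x)^5 * (u n x - b x)) - (LINT x|M. (u n x - b x)^6)\<bar> \<le>
      31 * (2 * d * K + 2 / d^5 * tail L + d * I + (L^4 / d^3 + L^8 / d) * sqnorm M (\<lambda>x. u n x - b x))"
    if d: "0 < d" "d \<le> 1" and L: "L \<ge> 1" for n d L
  proof -
    define w where "w = (\<lambda>x. u n x - b x)"
    have w6: "integrable M (\<lambda>x. (w x)^6)" using v[of n] by (simp add: w_def six_integrable_def)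
    have w2: "integrable M (\<lambda>x. (w x)\<^sup>2)" using six_integrable_square(1)[OF v[of n]] by (simp add: w_def square_integrable_def)
    have i5: "integrable M (\<lambda>x. (u n x)^5 * w x)" unfolding w_def by (rule quintic_integrable[OF U(1) v])
    define R where "R = (\<lambda>x. 2 * d * (w x)^6 + 2 / d^5 * (if \<bar>b x\<bar> > L then (b x)^6 else 0) + d * (b x)\<^sup>2 + (L^4 / d^3 + L^8 / d) * (w x)\<^sup>2)"
    have R: "integrable M R" unfolding R_def by (intro Bochner_Integration.integrable_add integrable_mult_right w6 itail b6 w2)
    have "(LINT x|M. (u n x)^5 * w x) - (LINT x|M. (w x)^6) = (LINT x|M. (u n x)^5 * w x - (w x)^6)"
      using i5 w6 by simp
    then have "\<bar>(LINT x|M. (u n x)^5 * w x) - (LINT x|M. (w x)^6)\<bar> \<le> (LINT x|M. \<bar>(u n x)^5 * w x - (w x)^6\<bar>)"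
      using integral_abs_bound by simp
    also have "\<dots> \<le> (LINT x|M. 31 * R x)"
    proof (rule integral_mono)
      show "integrable M (\<lambda>x. \<bar>(u n x)^5 * w x - (w x)^6\<bar>)" using i5 w6 by simp
      show "integrable M (\<lambda>x. 31 * R x)" using R by simp
      show "\<bar>(u n x)^5 * w x - (w x)^6\<bar> \<le> 31 * R x" for x
        using quintic_expansion[of "b x" "w x"] quintic_cross_bound[OF d L, of "b x" "w x"]
        unfolding R_def by (simp add: w_def)
    qed
    also have "\<dots> = 31 * (2 * d * (LINT x|M. (w x)^6) + 2 / d^5 * tail L + d * I + (L^4 / d^3 + L^8 / d) * sqnorm M w)"
    proof -
      have "(LINT x|M. R x) = 2 * d * (LINT x|M. (w x)^6) + 2 / d^5 * tail L + d * I + (L^4 / d^3 + L^8 / d) * sqnorm M w"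
        unfolding R_def tail_def I_def sqnorm_def real_norm_def power2_abs
        by (simp only: Bochner_Integration.integral_add Bochner_Integration.integrable_add integrable_mult_right
            integral_mult_right_zero w6 itail b6 w2 simp_thms)
      then show ?thesis by simp
    qed
    also have "\<dots> \<le> 31 * (2 * d * K + 2 / d^5 * tail L + d * I + (L^4 / d^3 + L^8 / d) * sqnorm M w)"
      using vK[of n] d by (simp add: w_def mult_left_mono)
    finally show ?thesis by (simp add: w_def)
  qed
  show ?thesis
  proof (rule LIMSEQ_I)
    fix e :: real assume e: "e > 0"
    \<comment> \<open>Each error source gets e / 3, in this order: d against the bounds K and I,
      then L depending on d, and finally n. The numbers 93 and 186 are 3 * 31 and 6 * 31.\<close>
    define d where "d = min 1 (e / (93 * (2 * K + I + 1)))"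
    have d: "0 < d" "d \<le> 1" using e I K by (auto simp: d_def)
    have pos: "0 < 2 * K + I + 1" using I K by simp
    have "d * (93 * (2 * K + I + 1)) \<le> e / (93 * (2 * K + I + 1)) * (93 * (2 * K + I + 1))"
      using pos by (intro mult_right_mono) (auto simp: d_def)
    also have "\<dots> = e" using pos by simp
    finally have "93 * (2 * d * K + d * I) + 93 * d \<le> e" by (simp add: algebra_simps)
    then have dI: "31 * (2 * d * K + d * I) < e / 3" using d by argo
    obtain L where L: "L \<ge> 1" "tail L < e * d^5 / 186"
      using six_tail[OF U(2), of "e * d^5 / 186"] e d by (auto simp: tail_def)
    have Lt: "31 * (2 / d^5 * tail L) < e / 3"
    proof -
      have "2 / d^5 * tail L < 2 / d^5 * (e * d^5 / 186)" using L d by (intro mult_strict_left_mono) auto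
      also have "\<dots> = e / 93" using d by simp
      finally show ?thesis by simp
    qed
    have "(\<lambda>n. 31 * ((L^4 / d^3 + L^8 / d) * sqnorm M (\<lambda>x. u n x - b x))) \<longlonglongrightarrow> 31 * ((L^4 / d^3 + L^8 / d) * 0)"
      by (intro tendsto_intros U)
    then have "\<forall>\<^sub>F n in sequentially. 31 * ((L^4 / d^3 + L^8 / d) * sqnorm M (\<lambda>x. u n x - b x)) < e / 3"
      by (rule order_tendstoD(2)) (use e in simp)
    then obtain N where N: "\<And>n. n \<ge> N \<Longrightarrow> 31 * ((L^4 / d^3 + L^8 / d) * sqnorm M (\<lambda>x. u n x - b x)) < e / 3"
      by (auto simp: eventually_sequentially)
    have arith: "x < e" if "x \<le> 31 * (p + q + r + s)" "31 * (p + r) < e / 3" "31 * q < e / 3" "31 * s < e / 3" for x p q r s :: real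
      using that by argo
    have "norm ((LINT x|M. (u n x)^5 * (u n x - b x)) - (LINT x|M. (u n x - b x)^6) - 0) < e" if "n \<ge> N" for n
      unfolding real_norm_def diff_0_right by (rule arith[OF bound[OF d L(1), of n] dI Lt N[OF that]])
    then show "\<exists>N. \<forall>n\<ge>N. norm ((LINT x|M. (u n x)^5 * (u n x - b x)) - (LINT x|M. (u n x - b x)^6) - 0) < e" by blast
  qed
qed

end

section \<open>A priori bounds\<close>

lemma abs_integral_mult_le:
  fixes f g :: "'a \<Rightarrow> real"
  assumes f: "square_integrable M f" and g: "square_integrable M g"
  shows "\<bar>LINT x|M. f x * g x\<bar> \<le> sqnorm M f + sqnorm M g"
proof -
  have "\<bar>LINT x|M. f x * g x\<bar> \<le> (LINT x|M. \<bar>f x * g x\<bar>)" by (rule integral_abs_bound)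
  also have "\<dots> \<le> (LINT x|M. (norm (f x))\<^sup>2 + (norm (g x))\<^sup>2)"
    using f g square_integrable_mult_integrable[OF f g] abs_inner_le_sq[of "f _" "g _"]
    by (intro integral_mono) (auto simp: square_integrable_def)
  also have "\<dots> = sqnorm M f + sqnorm M g"
    using f g unfolding sqnorm_def square_integrable_def by simp
  finally show ?thesis .
qed

lemma powr_le_six:
  assumes "0 < q" "q \<le> 6" shows "\<bar>t\<bar> powr q \<le> 1 + (t::real)^6"
proof (cases "\<bar>t\<bar> \<le> 1")
  case True
  then have "\<bar>t\<bar> powr q \<le> 1" using assms by (intro powr_le1) auto
  then show ?thesis by (simp add: add_increasing2)
next
  case False
  then have "\<bar>t\<bar> powr q \<le> \<bar>t\<bar> powr 6" using assms by (intro powr_mono) auto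
  then show ?thesis by simp
qed

context bounded_open_set
begin

lemma grad_pair_six_integrable:
  "grad_pair u G \<Longrightarrow> sobolev_const > 0 \<Longrightarrow> six_integrable M u"
  using Sobolev_grad_pair(1) grad_pair_square_integrable(1) square_integrable_measurable
  unfolding six_integrable_def by blast

text \<open>On a finite measure the L^6 bound controls L^2, but by an expression that is not
  homogeneous in v. Applying it to c v, with c chosen so that the gradient is normalised, restores
  homogeneity.\<close>

lemma Poincare:
  assumes v: "grad_pair v H" and S: "sobolev_const > 0"
  shows "sqnorm M v \<le> (measure M (space M) + 1 / sobolev_const^3) * sqnorm M H"
proof -
  define \<mu> h n where "\<mu> = measure M (space M)" and "h = sqnorm M H" and "n = sqnorm M v"
  have nn: "\<mu> \<ge> 0" "h \<ge> 0" "n \<ge> 0" by (auto simp: \<mu>_def h_def n_def)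
  have scaled: "c\<^sup>2 * n \<le> \<mu> + (c\<^sup>2 * h)^3 / sobolev_const^3" for c
  proof -
    have p: "grad_pair (\<lambda>x. c * v x) (\<lambda>x. c *\<^sub>R H x)" using grad_pair_lin[OF v v, of c 0] by simp
    have "sqnorm M (\<lambda>x. c * v x) \<le> \<mu> + (LINT x|M. (c * v x)^6)"
      unfolding \<mu>_def by (rule six_integrable_square(2)[OF grad_pair_six_integrable[OF p S]])
    also have "\<dots> \<le> \<mu> + (sqnorm M (\<lambda>x. c *\<^sub>R H x))^3 / sobolev_const^3"
      using Sobolev_grad_pair(2)[OF p S] by simp
    finally show ?thesis
      using sqnorm_scaleR[of M c v] sqnorm_scaleR[of M c H] by (simp add: n_def h_def)
  qed
  have "n \<le> (\<mu> + 1 / sobolev_const^3) * h"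
  proof (cases "h = 0")
    case True
    have "n = 0"
    proof (rule ccontr)
      assume "n \<noteq> 0"
      then have "n > 0" using nn by simp
      \<comment> \<open>With vanishing gradient the scaling is unrestricted; this c makes the
        left-hand side \<mu> + 1.\<close>
      have "(sqrt ((\<mu> + 1) / n))\<^sup>2 * n \<le> \<mu>" using scaled[of "sqrt ((\<mu> + 1) / n)"] True by simp
      then show False using \<open>n > 0\<close> nn by simp
    qed
    then show ?thesis using True by simp
  next
    case False
    then have h: "h > 0" using nn by simp
    have "(sqrt (1 / h))\<^sup>2 * n \<le> \<mu> + ((sqrt (1 / h))\<^sup>2 * h)^3 / sobolev_const^3" by (rule scaled)
    then have "n / h \<le> \<mu> + 1 / sobolev_const^3" using h by simp
    then show ?thesis using h by (simp add: field_simps)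
  qed
  then show ?thesis by (simp add: \<mu>_def h_def n_def)
qed

lemma wgrad_inner_cong:
  assumes u: "grad_pair u G" and H: "square_integrable M H"
  shows "(LINT x|M. H x \<bullet> wgrad \<Omega> u x) = (LINT x|M. H x \<bullet> G x)"
    and "(LINT x|M. wgrad \<Omega> u x \<bullet> H x) = (LINT x|M. G x \<bullet> H x)"
proof -
  note m = square_integrable_measurable[OF grad_pair_square_integrable(2)[OF u]]
    square_integrable_measurable[OF grad_pair_square_integrable(2)[OF grad_pair_wgrad[OF u]]]
    square_integrable_measurable[OF H]
  show "(LINT x|M. H x \<bullet> wgrad \<Omega> u x) = (LINT x|M. H x \<bullet> G x)"
  proof (rule integral_cong_AE)
    show "AE x in M. H x \<bullet> wgrad \<Omega> u x = H x \<bullet> G x"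
      using grad_pair_wgrad_AE[OF u] by eventually_elim simp
  qed (intro borel_measurable_inner m)+
  then show "(LINT x|M. wgrad \<Omega> u x \<bullet> H x) = (LINT x|M. G x \<bullet> H x)" by (simp add: inner_commute)
qed

lemma HH_H1_0: "\<phi> \<in> HH \<Omega> \<Longrightarrow> grad_pair \<phi> (wgrad \<Omega> \<phi>)"
  by (simp add: HH_def H1_0_iff)

lemma HH_integrable_four:
  assumes "\<phi> \<in> HH \<Omega>" shows "integrable M (\<lambda>x. (norm (wgrad \<Omega> \<phi> x))^4)"
proof -
  obtain g where g: "has_weak_gradient \<Omega> \<phi> g" "g \<in> Lp_fun 4 \<Omega>"
    using assms by (auto simp: HH_def W1_0_def W1_def)
  have AE: "AE x in M. g x = wgrad \<Omega> \<phi> x"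
    using wgrad_AE[OF open_Omega g(1)] by eventually_elim simp
  have m: "wgrad \<Omega> \<phi> \<in> borel_measurable M"
    by (rule square_integrable_measurable[OF grad_pair_square_integrable(2)[OF HH_H1_0[OF assms]]])
  have "integrable M (\<lambda>x. (norm (g x))^4)" using g(2) by (simp add: Lp_fun_def)
  then show ?thesis
    by (rule integrable_cong_AE_imp) (use m AE in auto)
qed

lemma quasi_poisson_energy:
  assumes Q: "quasi_poisson_solution \<Omega> \<epsilon> u \<phi>"
  shows "sqnorm M (wgrad \<Omega> \<phi>) + \<epsilon>^4 * (LINT x|M. (norm (wgrad \<Omega> \<phi> x))^4) = (LINT x|M. (u x)\<^sup>2 * \<phi> x)"
proof -
  have "\<phi> \<in> HH \<Omega>" using Q by (simp add: quasi_poisson_solution_def)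
  with Q have "(LINT x|M. wgrad \<Omega> \<phi> x \<bullet> wgrad \<Omega> \<phi> x) +
      \<epsilon>^4 * (LINT x|M. (norm (wgrad \<Omega> \<phi> x))\<^sup>2 * (wgrad \<Omega> \<phi> x \<bullet> wgrad \<Omega> \<phi> x)) = (LINT x|M. (u x)\<^sup>2 * \<phi> x)"
    unfolding quasi_poisson_solution_def by blast
  then show ?thesis
    by (simp add: sqnorm_def power4_eq_xxxx power2_eq_square mult.assoc flip: power2_norm_eq_inner)
qed

text \<open>The energy identity writes the pairing I as the sum of two nonnegative parts h and A.
  Cauchy--Schwarz and the Poincare inequality give I^2 <= B h <= B I, so I, and with it each part,
  is at most B.\<close>

lemma quasi_poisson_bounds:
  assumes Q: "quasi_poisson_solution \<Omega> \<epsilon> u \<phi>" and S: "sobolev_const > 0"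
    and u: "six_integrable M u" "(LINT x|M. (u x)^6) \<le> K"
  defines "B \<equiv> (2 * measure M (space M) + 2 * K) * (measure M (space M) + 1 / sobolev_const^3)"
  shows "sqnorm M (wgrad \<Omega> \<phi>) \<le> B" "\<epsilon>^4 * (LINT x|M. (norm (wgrad \<Omega> \<phi> x))^4) \<le> B"
proof -
  have "\<phi> \<in> HH \<Omega>" using Q by (simp add: quasi_poisson_solution_def)
  note \<phi> = HH_H1_0[OF this]
  define I h A where "I = (LINT x|M. (u x)\<^sup>2 * \<phi> x)" and "h = sqnorm M (wgrad \<Omega> \<phi>)"
    and "A = \<epsilon>^4 * (LINT x|M. (norm (wgrad \<Omega> \<phi> x))^4)"
  have hA: "h + A = I" using quasi_poisson_energy[OF Q] by (simp add: h_def A_def I_def)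
  have nn: "h \<ge> 0" "A \<ge> 0" by (auto simp: h_def A_def intro!: mult_nonneg_nonneg Bochner_Integration.integral_nonneg)
  have "0 \<le> (LINT x|M. (u x)^6)" by (intro Bochner_Integration.integral_nonneg) auto
  then have K: "K \<ge> 0" using u(2) by linarith
  have "(LINT x|M. (u x * u x) * \<phi> x)\<^sup>2 \<le> sqnorm M (\<lambda>x. u x * u x) * sqnorm M \<phi>"
    using integral_Cauchy_Schwarz[OF six_integrable_mult(1)[OF u(1) u(1)] grad_pair_square_integrable(1)[OF \<phi>]]
    by (simp only: inner_real_def)
  then have "I\<^sup>2 \<le> sqnorm M (\<lambda>x. u x * u x) * sqnorm M \<phi>" by (simp add: I_def power2_eq_square)
  also have "\<dots> \<le> (2 * measure M (space M) + 2 * K) * ((measure M (space M) + 1 / sobolev_const^3) * h)"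
    using six_integrable_mult(2)[OF u(1) u(1)] u(2) Poincare[OF \<phi> S] K unfolding h_def
    by (intro mult_mono) (auto intro: add_nonneg_nonneg)
  also have "\<dots> = B * h" by (simp add: B_def)
  finally have "I\<^sup>2 \<le> B * h" .
  moreover have "B \<ge> 0" using K S by (simp add: B_def)
  then have "B * h \<le> B * I" using hA nn by (intro mult_left_mono) auto
  ultimately have "I * I \<le> B * I" by (simp add: power2_eq_square)
  then have "I \<le> B" using \<open>B \<ge> 0\<close> hA nn by (cases "I = 0") auto
  then have "h \<le> B" "A \<le> B" using hA nn by linarith+
  then show "sqnorm M (wgrad \<Omega> \<phi>) \<le> B" "\<epsilon>^4 * (LINT x|M. (norm (wgrad \<Omega> \<phi> x))^4) \<le> B"
    unfolding h_def A_def .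
qed

text \<open>Testing with \<open>u\<close> isolates the multiplier times the mass. The potential term
  contributes P + 2 V + 2 K, the subcritical power V + K and the critical one K, where V is the
  total measure.\<close>

lemma multiplier_bound:
  assumes sol: "schroedinger_solution \<Omega> q u \<phi> \<mu>" and q: "2 < q" "q \<le> 3"
    and u: "six_integrable M u" "(LINT x|M. (u x)^6) \<le> K" "sqnorm M u = b\<^sup>2" "sqnorm M (wgrad \<Omega> u) \<le> R"
    and \<phi>: "square_integrable M \<phi>" "sqnorm M \<phi> \<le> P"
  shows "\<bar>\<mu>\<bar> * b\<^sup>2 \<le> R + P + 3 * measure M (space M) + 4 * K"
proof -
  have "u \<in> H1_0 \<Omega>" using sol by (simp add: schroedinger_solution_def)
  with sol have eq: "(LINT x|M. wgrad \<Omega> u x \<bullet> wgrad \<Omega> u x) + (LINT x|M. \<phi> x * u x * u x) + \<mu> * (LINT x|M. u x * u x) =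
        (LINT x|M. \<bar>u x\<bar> powr (q - 2) * u x * u x) + (LINT x|M. \<bar>u x\<bar>^4 * u x * u x)"
    unfolding schroedinger_solution_def by blast
  have e1: "(LINT x|M. wgrad \<Omega> u x \<bullet> wgrad \<Omega> u x) = sqnorm M (wgrad \<Omega> u)"
    by (simp add: sqnorm_def power2_norm_eq_inner)
  have e2: "(LINT x|M. u x * u x) = b\<^sup>2" using u(3) by (simp add: sqnorm_def power2_eq_square)
  have e3: "(LINT x|M. \<bar>u x\<bar>^4 * u x * u x) = (LINT x|M. (u x)^6)"
    by (rule Bochner_Integration.integral_cong) (auto simp: eval_nat_numeral)
  have p1: "\<bar>LINT x|M. \<phi> x * u x * u x\<bar> \<le> P + 2 * measure M (space M) + 2 * K"
    using abs_integral_mult_le[OF \<phi>(1) six_integrable_mult(1)[OF u(1) u(1)]] \<phi>(2) six_integrable_mult(2)[OF u(1) u(1)] u(2)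
    by (simp add: mult.assoc)
  have p2: "\<bar>LINT x|M. \<bar>u x\<bar> powr (q - 2) * u x * u x\<bar> \<le> measure M (space M) + K"
  proof -
    have i: "integrable M (\<lambda>x. \<bar>u x\<bar> powr (q - 2) * u x * u x)"
      using q by (intro square_integrable_mult_integrable powr_square_integrable six_integrable_square u) auto
    have "\<bar>LINT x|M. \<bar>u x\<bar> powr (q - 2) * u x * u x\<bar> \<le> (LINT x|M. \<bar>\<bar>u x\<bar> powr (q - 2) * u x * u x\<bar>)"
      by (rule integral_abs_bound)
    also have "\<dots> \<le> (LINT x|M. 1 + (u x)^6)"
    proof (rule integral_mono)
      show "integrable M (\<lambda>x. 1 + (u x)^6)" using u(1) by (simp add: six_integrable_def)
      show "\<bar>\<bar>u x\<bar> powr (q - 2) * u x * u x\<bar> \<le> 1 + (u x)^6" for x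
      proof -
        have "\<bar>\<bar>u x\<bar> powr (q - 2) * u x * u x\<bar> = \<bar>u x\<bar> powr (q - 2) * \<bar>u x\<bar> powr 2"
          by (simp add: abs_mult power2_eq_square)
        also have "\<dots> = \<bar>u x\<bar> powr q" by (subst powr_add[symmetric]) simp
        finally show ?thesis using powr_le_six[of q "u x"] q by simp
      qed
    qed (use i in simp)
    also have "\<dots> \<le> measure M (space M) + K" using u(1,2) by (simp add: six_integrable_def)
    finally show ?thesis .
  qed
  have "0 \<le> (LINT x|M. (u x)^6)" by (intro Bochner_Integration.integral_nonneg) auto
  then have "\<bar>\<mu> * b\<^sup>2\<bar> \<le> R + P + 3 * measure M (space M) + 4 * K"
    using eq p1 p2 u(2,4) sqnorm_nonneg[of M "wgrad \<Omega> u"] unfolding e1 e2 e3 abs_le_iff by (intro conjI; linarith)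
  then show ?thesis by (simp add: abs_mult)
qed

text \<open>Beyond R1 the energy would be positive. Up to R2 this is the positivity of
  \<open>GG\<close>, since T <= 1. From R2 on the truncation removes the critical term; because the
  subcritical exponent is below 2, its domination by t^2 / 2 at one point between R1 and R2 persists
  for larger t.\<close>

lemma truncated_energy_bound:
  assumes u: "u \<in> mass_sphere \<Omega> b" and q: "2 < q" "q < 8/3" and b: "b > 0"
    and C: "gagliardo_nirenberg_const q C" and R: "truncation_radii q C b R1 R2"
    and T: "truncation_function R1 R2 T" and S: "sobolev_const > 0" and neg: "ET \<Omega> q T \<epsilon> u < 0"
  shows "sqnorm M (wgrad \<Omega> u) \<le> R1\<^sup>2"
proof -
  have p: "grad_pair u (wgrad \<Omega> u)" and ub: "sqnorm M u = b\<^sup>2"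
    using u by (auto simp: mass_sphere_def H1_0_iff sqnorm_def)
  define t where "t = grad_norm \<Omega> u"
  have t: "t \<ge> 0" "t\<^sup>2 = sqnorm M (wgrad \<Omega> u)"
    by (auto simp: t_def grad_norm_def sqnorm_def intro!: Bochner_Integration.integral_nonneg)
  define \<alpha> where "\<alpha> = 3 * (q - 2) / 2"
  have \<alpha>: "0 < \<alpha>" "\<alpha> < 2" using q by (auto simp: \<alpha>_def)
  have C0: "C > 0" using C by (simp add: gagliardo_nirenberg_const_def)
  define c where "c = 1 / q * b powr (3 - q / 2) * C"
  have c: "c \<ge> 0" using C0 q by (simp add: c_def)
  define X Y where "X = (LINT x|M. \<bar>u x\<bar> powr q)" and "Y = (LINT x|M. \<bar>u x\<bar>^6)"
  have X: "1 / q * X \<le> c * t powr \<alpha>"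
  proof -
    have "X \<le> C * (b\<^sup>2) powr ((6 - q) / 4) * (t\<^sup>2) powr (3 * (q - 2) / 4)"
      using Gagliardo_Nirenberg_grad_pair(2)[OF p C] q unfolding X_def ub t by simp
    also have "(b\<^sup>2) powr ((6 - q) / 4) = b powr (3 - q / 2)"
    proof -
      have "(b\<^sup>2) powr ((6 - q) / 4) = (b powr 2) powr ((6 - q) / 4)" using b by simp
      also have "\<dots> = b powr (2 * ((6 - q) / 4))" unfolding powr_powr ..
      also have "2 * ((6 - q) / 4) = 3 - q / 2" by (simp add: field_simps)
      finally show ?thesis .
    qed
    also have "(t\<^sup>2) powr (3 * (q - 2) / 4) = t powr \<alpha>"
    proof -
      have "(t\<^sup>2) powr (3 * (q - 2) / 4) = (t powr 2) powr (3 * (q - 2) / 4)" using t by simp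
      also have "\<dots> = t powr (2 * (3 * (q - 2) / 4))" unfolding powr_powr ..
      also have "2 * (3 * (q - 2) / 4) = \<alpha>" by (simp add: \<alpha>_def)
      finally show ?thesis .
    qed
    finally have "1 / q * X \<le> 1 / q * (C * b powr (3 - q / 2) * t powr \<alpha>)"
      using q by (intro mult_left_mono) auto
    then show ?thesis by (simp add: c_def mult_ac)
  qed
  have Y: "0 \<le> Y" "Y \<le> t^6 / sobolev_const^3"
  proof -
    show "0 \<le> Y" by (auto simp: Y_def intro!: Bochner_Integration.integral_nonneg)
    have "t^6 = (t\<^sup>2)^3" by (simp flip: power_mult)
    then show "Y \<le> t^6 / sobolev_const^3"
      using Sobolev_grad_pair(2)[OF p S] by (simp add: Y_def t(2))
  qed
  have energy: "t\<^sup>2 / 2 - 1 / q * X - T t / 6 * Y \<le> ET \<Omega> q T \<epsilon> u"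
  proof -
    have "0 \<le> 1/4 * (LINT x|M. (norm (wgrad \<Omega> (phi_sol \<Omega> \<epsilon> u) x))\<^sup>2)"
      by (intro mult_nonneg_nonneg Bochner_Integration.integral_nonneg) auto
    moreover have "0 \<le> 3 * \<epsilon>^4 / 8 * (LINT x|M. (norm (wgrad \<Omega> (phi_sol \<Omega> \<epsilon> u) x))^4)"
      by (intro mult_nonneg_nonneg Bochner_Integration.integral_nonneg) auto
    moreover have "t\<^sup>2 = (LINT x|M. (norm (wgrad \<Omega> u x))\<^sup>2)" using t(2) by (simp add: sqnorm_def)
    ultimately show ?thesis unfolding ET_def X_def Y_def t_def[symmetric] by linarith
  qed
  have GGeq: "GG q C b s = s\<^sup>2 / 2 - c * s powr \<alpha> - s^6 / (6 * sobolev_const^3)" for s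
    by (simp add: GG_def c_def \<alpha>_def)
  have R12: "0 < R1" "R1 < R2" "\<And>s. R1 < s \<Longrightarrow> s < R2 \<Longrightarrow> GG q C b s > 0"
    using R by (auto simp: truncation_radii_def)
  have "t \<le> R1"
  proof (rule ccontr)
    assume "\<not> t \<le> R1"
    then have tR: "R1 < t" by simp
    have "ET \<Omega> q T \<epsilon> u > 0"
    proof (cases "t < R2")
      case True
      have "T t \<le> 1" using T t(1) by (simp add: truncation_function_def)
      then have "T t / 6 * Y \<le> 1 / 6 * (t^6 / sobolev_const^3)"
        using Y by (intro order.trans[OF mult_right_mono mult_left_mono]) auto
      moreover have "1 / 6 * (t^6 / sobolev_const^3) = t^6 / (6 * sobolev_const^3)" by simp
      moreover have "GG q C b t > 0" using R12(3) tR True by blast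
      ultimately show ?thesis using energy X unfolding GGeq by linarith
    next
      case False
      then have "T t = 0" using T by (simp add: truncation_function_def)
      \<comment> \<open>Any point of the open interval would do: positivity of \<open>GG\<close>
        there is what gets extrapolated.\<close>
      define s where "s = (R1 + R2) / 2"
      have s: "R1 < s" "s < R2" "s > 0" using R12 by (auto simp: s_def)
      have "c * s powr \<alpha> < s\<^sup>2 / 2"
      proof -
        have "0 \<le> s^6 / (6 * sobolev_const^3)" using S by simp
        then show ?thesis using R12(3)[OF s(1,2)] unfolding GGeq by linarith
      qed
      have ts: "t / s \<ge> 1" using False s by (simp add: field_simps)
      have "c * t powr \<alpha> = c * s powr \<alpha> * (t / s) powr \<alpha>" using s t(1) by (simp add: powr_divide)
      also have "\<dots> \<le> c * s powr \<alpha> * (t / s) powr 2"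
        using ts \<alpha> c by (intro mult_left_mono powr_mono) auto
      also have "\<dots> < s\<^sup>2 / 2 * (t / s) powr 2"
        using ts \<open>c * s powr \<alpha> < s\<^sup>2 / 2\<close> by (intro mult_strict_right_mono) auto
      also have "\<dots> = t\<^sup>2 / 2" using s ts by (simp add: power_divide)
      finally show ?thesis using energy X \<open>T t = 0\<close> by simp
    qed
    then show False using neg by simp
  qed
  then show ?thesis using t by (simp flip: t(2) add: power_mono)
qed

end

section \<open>Passage to the limit\<close>

text \<open>Young's inequality for the exponents 4/3 and 4, with an elementary constant.\<close>

lemma cube_mult_le:
  fixes x y d :: real
  assumes "0 \<le> x" "0 \<le> y" "0 < d"
  shows "x^3 * y \<le> d * x^4 + y^4 / d^3"
proof (cases "y \<le> d * x")
  case True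
  have "x^3 * y \<le> x^3 * (d * x)" using True assms by (intro mult_left_mono) auto
  also have "\<dots> = d * x^4" by (simp add: eval_nat_numeral)
  finally show ?thesis using assms by (simp add: add_increasing2)
next
  case False
  then have "x \<le> y / d" using assms by (simp add: field_simps)
  then have "x^3 * y \<le> (y / d)^3 * y" using assms by (intro mult_right_mono power_mono) auto
  also have "\<dots> = y^4 / d^3" by (simp add: power_divide eval_nat_numeral)
  finally show ?thesis using assms by (simp add: add_increasing)
qed

context bounded_open_set
begin

text \<open>The weight in \<open>cube_mult_le\<close> is e n itself. After multiplication by the
  fourth power of e n both terms carry one factor e n: the first next to the quantity bounded by
  \<open>B\<close>, the second next to the fixed integral of the test function.\<close>

lemma quasi_term_null:
  assumes e: "\<And>n. e n > 0" "e \<longlonglongrightarrow> 0" and \<phi>: "\<And>n. \<phi> n \<in> HH \<Omega>"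
    and B: "\<And>n. e n ^ 4 * (LINT x|M. (norm (wgrad \<Omega> (\<phi> n) x))^4) \<le> B" and \<psi>: "\<psi> \<in> HH \<Omega>"
  shows "(\<lambda>n. e n ^ 4 * (LINT x|M. (norm (wgrad \<Omega> (\<phi> n) x))\<^sup>2 * (wgrad \<Omega> (\<phi> n) x \<bullet> wgrad \<Omega> \<psi> x))) \<longlonglongrightarrow> 0"
proof -
  define Y where "Y = (LINT x|M. (norm (wgrad \<Omega> \<psi> x))^4)"
  note i4 = HH_integrable_four[OF \<phi>] and j4 = HH_integrable_four[OF \<psi>]
  have "(\<lambda>n. e n * B + e n * Y) \<longlonglongrightarrow> 0 * B + 0 * Y" by (intro tendsto_intros e)
  then have lim0: "(\<lambda>n. e n * B + e n * Y) \<longlonglongrightarrow> 0" by simp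
  show ?thesis
  proof (rule Lim_null_comparison[OF _ lim0], intro always_eventually allI)
    fix n
    define g where "g = wgrad \<Omega> (\<phi> n)"
    define h where "h = wgrad \<Omega> \<psi>"
    have m[measurable]: "g \<in> borel_measurable M" "h \<in> borel_measurable M"
      unfolding g_def h_def
      by (rule square_integrable_measurable[OF grad_pair_square_integrable(2)[OF HH_H1_0]], fact)+
    have le: "\<bar>(norm (g x))\<^sup>2 * (g x \<bullet> h x)\<bar> \<le> e n * (norm (g x))^4 + (norm (h x))^4 / (e n)^3" for x
    proof -
      have "\<bar>(norm (g x))\<^sup>2 * (g x \<bullet> h x)\<bar> \<le> (norm (g x))\<^sup>2 * (norm (g x) * norm (h x))"
        unfolding abs_mult by (intro mult_mono Cauchy_Schwarz_ineq2) auto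
      also have "\<dots> = (norm (g x))^3 * norm (h x)" by (simp add: eval_nat_numeral)
      also have "\<dots> \<le> e n * (norm (g x))^4 + (norm (h x))^4 / (e n)^3" by (intro cube_mult_le e) auto
      finally show ?thesis .
    qed
    have i: "integrable M (\<lambda>x. e n * (norm (g x))^4 + (norm (h x))^4 / (e n)^3)"
      using i4[of n] j4 by (simp add: g_def h_def)
    have ib: "integrable M (\<lambda>x. (norm (g x))\<^sup>2 * (g x \<bullet> h x))"
      by (rule Bochner_Integration.integrable_bound[OF i]) (use le in \<open>auto intro!: AE_I2 order.trans[OF le]\<close>)
    have "\<bar>LINT x|M. (norm (g x))\<^sup>2 * (g x \<bullet> h x)\<bar> \<le> (LINT x|M. \<bar>(norm (g x))\<^sup>2 * (g x \<bullet> h x)\<bar>)"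
      by (rule integral_abs_bound)
    also have "\<dots> \<le> (LINT x|M. e n * (norm (g x))^4 + (norm (h x))^4 / (e n)^3)"
      using ib i le by (intro integral_mono) auto
    also have "\<dots> = e n * (LINT x|M. (norm (g x))^4) + Y / (e n)^3"
      using i4[of n] j4 by (simp add: g_def h_def Y_def)
    finally have "e n ^ 4 * \<bar>LINT x|M. (norm (g x))\<^sup>2 * (g x \<bullet> h x)\<bar> \<le> e n ^ 4 * (e n * (LINT x|M. (norm (g x))^4) + Y / (e n)^3)"
      using e(1)[of n] by (intro mult_left_mono) auto
    also have "\<dots> = e n * (e n ^ 4 * (LINT x|M. (norm (g x))^4)) + e n * Y"
      using e(1)[of n] by (simp add: field_simps eval_nat_numeral)
    also have "\<dots> \<le> e n * B + e n * Y"
      using B[of n] e(1)[of n] by (simp add: g_def mult_left_mono)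
    finally show "norm (e n ^ 4 * (LINT x|M. (norm (wgrad \<Omega> (\<phi> n) x))\<^sup>2 * (wgrad \<Omega> (\<phi> n) x \<bullet> wgrad \<Omega> \<psi> x))) \<le> e n * B + e n * Y"
      using e(1)[of n] by (simp add: abs_mult g_def h_def)
  qed
qed

text \<open>Smooth test functions come first since they lie in \<open>HH\<close>, whereas a general
  element of H^1_0 need not have a gradient in L^4. For strong convergence, dropping the quasilinear
  energy bounds the squared gradient norm of \<open>\<phi> n\<close> by a triple product whose limit
  is the squared gradient norm of \<open>\<phi>0\<close>.\<close>

lemma quasi_poisson_limit:
  assumes e: "\<And>n. e n > 0" "e \<longlonglongrightarrow> 0" and Q: "\<And>n. quasi_poisson_solution \<Omega> (e n) (u n) (\<phi> n)"
    and B: "\<And>n. e n ^ 4 * (LINT x|M. (norm (wgrad \<Omega> (\<phi> n) x))^4) \<le> B"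
    and u: "six_tendsto M u u0" and \<phi>: "six_tendsto M \<phi> \<phi>0" and p0: "grad_pair \<phi>0 (wgrad \<Omega> \<phi>0)"
    and weak: "\<And>v H. grad_pair v H \<Longrightarrow> (\<lambda>n. LINT x|M. wgrad \<Omega> (\<phi> n) x \<bullet> H x) \<longlonglongrightarrow> (LINT x|M. wgrad \<Omega> \<phi>0 x \<bullet> H x)"
    and S: "sobolev_const > 0"
  shows "poisson_solution \<Omega> u0 \<phi>0 \<and> (\<lambda>n. sqnorm M (\<lambda>x. wgrad \<Omega> (\<phi> n) x - wgrad \<Omega> \<phi>0 x)) \<longlonglongrightarrow> 0"
proof
  have HH: "\<phi> n \<in> HH \<Omega>" for n using Q[of n] by (simp add: quasi_poisson_solution_def)
  note U = six_tendstoD[OF u]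
  note g = grad_pair_square_integrable(2)[OF HH_H1_0[OF HH]]
  note g0 = grad_pair_square_integrable(2)[OF p0]
  have u0sq: "square_integrable M (\<lambda>x. (u0 x)\<^sup>2)"
    using six_integrable_mult(1)[OF U(2) U(2)] by (simp add: power2_eq_square)
  have test: "(LINT x|M. wgrad \<Omega> \<phi>0 x \<bullet> cgrad \<eta> x) = (LINT x|M. (u0 x)\<^sup>2 * \<eta> x)" if \<eta>: "\<eta> \<in> test_functions \<Omega>" for \<eta>
  proof -
    note \<eta>H = test_in_HH[OF \<eta>] and p\<eta> = grad_pair_test[OF \<eta>]
    have "(\<lambda>n. (LINT x|M. wgrad \<Omega> (\<phi> n) x \<bullet> wgrad \<Omega> \<eta> x) +
        e n ^ 4 * (LINT x|M. (norm (wgrad \<Omega> (\<phi> n) x))\<^sup>2 * (wgrad \<Omega> (\<phi> n) x \<bullet> wgrad \<Omega> \<eta> x)))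
        \<longlonglongrightarrow> (LINT x|M. wgrad \<Omega> \<phi>0 x \<bullet> wgrad \<Omega> \<eta> x) + 0"
      by (intro tendsto_add weak[OF grad_pair_wgrad[OF p\<eta>]] quasi_term_null[OF e HH B \<eta>H])
    moreover have "(LINT x|M. wgrad \<Omega> (\<phi> n) x \<bullet> wgrad \<Omega> \<eta> x) +
        e n ^ 4 * (LINT x|M. (norm (wgrad \<Omega> (\<phi> n) x))\<^sup>2 * (wgrad \<Omega> (\<phi> n) x \<bullet> wgrad \<Omega> \<eta> x)) = (LINT x|M. u n x * u n x * \<eta> x)" for n
      using Q[of n] \<eta>H unfolding quasi_poisson_solution_def power2_eq_square by blast
    moreover have "(\<lambda>n. LINT x|M. u n x * u n x * \<eta> x) \<longlonglongrightarrow> (LINT x|M. u0 x * u0 x * \<eta> x)"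
      by (intro six_tendsto_triple u six_tendsto_const grad_pair_six_integrable[OF p\<eta> S])
    ultimately have "(LINT x|M. wgrad \<Omega> \<phi>0 x \<bullet> wgrad \<Omega> \<eta> x) = (LINT x|M. u0 x * u0 x * \<eta> x)"
      using LIMSEQ_unique by fastforce
    then show ?thesis using wgrad_inner_cong(1)[OF p\<eta> g0] by (simp add: power2_eq_square)
  qed
  have eq: "(LINT x|M. wgrad \<Omega> \<phi>0 x \<bullet> wgrad \<Omega> \<psi> x) = (LINT x|M. (u0 x)\<^sup>2 * \<psi> x)" if "\<psi> \<in> H1_0 \<Omega>" for \<psi>
  proof -
    have p: "grad_pair \<psi> (wgrad \<Omega> \<psi>)" using that H1_0_iff by blast
    note si = grad_pair_square_integrable[OF p]
    obtain \<eta> where \<eta>: "\<And>n. \<eta> n \<in> test_functions \<Omega>" "(\<lambda>n. sqnorm M (\<lambda>x. \<eta> n x - \<psi> x)) \<longlonglongrightarrow> 0"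
      "(\<lambda>n. sqnorm M (\<lambda>x. cgrad (\<eta> n) x - wgrad \<Omega> \<psi> x)) \<longlonglongrightarrow> 0" using grad_pairE[OF p] by blast
    have "(\<lambda>n. LINT x|M. cgrad (\<eta> n) x \<bullet> wgrad \<Omega> \<phi>0 x) \<longlonglongrightarrow> (LINT x|M. wgrad \<Omega> \<psi> x \<bullet> wgrad \<Omega> \<phi>0 x)"
      by (rule integral_inner_tendsto[OF test_square_integrable(2)[OF \<eta>(1)] si(2) g0 \<eta>(3)])
    moreover have "(\<lambda>n. LINT x|M. \<eta> n x * (u0 x)\<^sup>2) \<longlonglongrightarrow> (LINT x|M. \<psi> x * (u0 x)\<^sup>2)"
      using integral_inner_tendsto[OF test_square_integrable(1)[OF \<eta>(1)] si(1) u0sq \<eta>(2)] by (simp only: inner_real_def)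
    ultimately show ?thesis
      using test[OF \<eta>(1)] LIMSEQ_unique by (fastforce simp: inner_commute mult.commute)
  qed
  show "poisson_solution \<Omega> u0 \<phi>0"
    unfolding poisson_solution_def using eq grad_pair_imp_H1_0[OF p0] by blast
  have en0: "sqnorm M (wgrad \<Omega> \<phi>0) = (LINT x|M. u0 x * u0 x * \<phi>0 x)"
    using eq[OF grad_pair_imp_H1_0[OF p0]] unfolding sqnorm_def power2_norm_eq_inner by (simp add: power2_eq_square)
  \<comment> \<open>The expanded squared distance, with its leading term replaced by the upper
    bound.\<close>
  have "(\<lambda>n. (LINT x|M. u n x * u n x * \<phi> n x) - 2 * (LINT x|M. wgrad \<Omega> (\<phi> n) x \<bullet> wgrad \<Omega> \<phi>0 x) + sqnorm M (wgrad \<Omega> \<phi>0))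
      \<longlonglongrightarrow> (LINT x|M. u0 x * u0 x * \<phi>0 x) - 2 * (LINT x|M. wgrad \<Omega> \<phi>0 x \<bullet> wgrad \<Omega> \<phi>0 x) + sqnorm M (wgrad \<Omega> \<phi>0)"
    by (intro tendsto_intros six_tendsto_triple u \<phi> weak[OF p0])
  moreover have "(LINT x|M. wgrad \<Omega> \<phi>0 x \<bullet> wgrad \<Omega> \<phi>0 x) = sqnorm M (wgrad \<Omega> \<phi>0)"
    by (simp add: sqnorm_def power2_norm_eq_inner)
  ultimately have lim0: "(\<lambda>n. (LINT x|M. u n x * u n x * \<phi> n x) - 2 * (LINT x|M. wgrad \<Omega> (\<phi> n) x \<bullet> wgrad \<Omega> \<phi>0 x) + sqnorm M (wgrad \<Omega> \<phi>0)) \<longlonglongrightarrow> 0"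
    using en0 by simp
  show "(\<lambda>n. sqnorm M (\<lambda>x. wgrad \<Omega> (\<phi> n) x - wgrad \<Omega> \<phi>0 x)) \<longlonglongrightarrow> 0"
  proof (rule Lim_null_comparison[OF _ lim0], intro always_eventually allI)
    fix n
    have "0 \<le> e n ^ 4 * (LINT x|M. (norm (wgrad \<Omega> (\<phi> n) x))^4)"
      by (intro mult_nonneg_nonneg Bochner_Integration.integral_nonneg) auto
    then have "sqnorm M (wgrad \<Omega> (\<phi> n)) \<le> (LINT x|M. u n x * u n x * \<phi> n x)"
      using quasi_poisson_energy[OF Q[of n]] unfolding power2_eq_square by linarith
    then show "norm (sqnorm M (\<lambda>x. wgrad \<Omega> (\<phi> n) x - wgrad \<Omega> \<phi>0 x)) \<le>
        (LINT x|M. u n x * u n x * \<phi> n x) - 2 * (LINT x|M. wgrad \<Omega> (\<phi> n) x \<bullet> wgrad \<Omega> \<phi>0 x) + sqnorm M (wgrad \<Omega> \<phi>0)"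
      unfolding real_norm_def abs_of_nonneg[OF sqnorm_nonneg]
      unfolding sqnorm_diff[OF g g0] by simp
  qed
qed

lemma schroedinger_strong_limit:
  assumes sol: "\<And>n. schroedinger_solution \<Omega> q (u n) (\<phi> n) (\<mu> n)" and q: "2 < q" "q \<le> 3"
    and S: "sobolev_const > 0" and \<rho>: "\<And>n. sqnorm M (wgrad \<Omega> (u n)) \<le> \<rho>" "\<rho> < sobolev_const powr (3/2)"
    and u: "six_tendsto M u u0" and p0: "grad_pair u0 (wgrad \<Omega> u0)"
    and weak: "\<And>v H. grad_pair v H \<Longrightarrow> (\<lambda>n. LINT x|M. wgrad \<Omega> (u n) x \<bullet> H x) \<longlonglongrightarrow> (LINT x|M. wgrad \<Omega> u0 x \<bullet> H x)"
    and \<phi>: "six_tendsto M \<phi> \<phi>0" and \<mu>: "\<mu> \<longlonglongrightarrow> \<mu>0"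
  shows "(\<lambda>n. sqnorm M (\<lambda>x. wgrad \<Omega> (u n) x - wgrad \<Omega> u0 x)) \<longlonglongrightarrow> 0"
proof -
  have p: "grad_pair (u n) (wgrad \<Omega> (u n))" for n using sol[of n] H1_0_iff by (simp add: schroedinger_solution_def)
  note si = grad_pair_square_integrable[OF p] and si0 = grad_pair_square_integrable[OF p0]
  note U = six_tendstoD[OF u]
  define v where "v = (\<lambda>n x. u n x - u0 x)"
  define H where "H = (\<lambda>n x. wgrad \<Omega> (u n) x - wgrad \<Omega> u0 x)"
  define x where "x = (\<lambda>n. sqnorm M (H n))"
  define y where "y = (\<lambda>n. LINT z|M. (v n z)^6)"
  have pv: "grad_pair (v n) (H n)" for n unfolding v_def H_def by (rule grad_pair_diff[OF p p0])
  note sH = grad_pair_square_integrable(2)[OF pv] and v6 = grad_pair_six_integrable[OF pv S]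
  have x0: "x n \<ge> 0" for n by (simp add: x_def)
  have yx: "y n \<le> x n ^ 3 / sobolev_const^3" for n
    unfolding x_def y_def by (rule Sobolev_grad_pair(2)[OF pv S])
  define W where "W = (\<lambda>n. LINT z|M. wgrad \<Omega> (u n) z \<bullet> wgrad \<Omega> u0 z)"
  have W: "W \<longlonglongrightarrow> sqnorm M (wgrad \<Omega> u0)"
    using weak[OF p0] by (simp add: W_def sqnorm_def power2_norm_eq_inner)
  have xW: "x n = sqnorm M (wgrad \<Omega> (u n)) - 2 * W n + sqnorm M (wgrad \<Omega> u0)" for n
    unfolding x_def H_def W_def by (rule sqnorm_diff[OF si(2) si0(2)])
  define K where "K = (2 * \<rho> + 2 * sqnorm M (wgrad \<Omega> u0))^3 / sobolev_const^3"
  have yK: "y n \<le> K" for n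
  proof -
    have "x n \<le> 2 * \<rho> + 2 * sqnorm M (wgrad \<Omega> u0)"
      using sqnorm_diff_le[OF si(2)[of n] si0(2)] \<rho>(1)[of n] by (simp add: x_def H_def)
    then have "x n ^ 3 / sobolev_const^3 \<le> K"
      using x0 S unfolding K_def by (intro divide_right_mono power_mono) auto
    then show ?thesis using yx[of n] by linarith
  qed
  \<comment> \<open>This single fact disposes of the potential, the multiplier and the subcritical
    power in the equation tested with \<open>v\<close>.\<close>
  have vt: "six_tendsto M v (\<lambda>_. 0)"
    unfolding six_tendsto_def
  proof (intro conjI allI exI[of _ K])
    show "six_integrable M (v n)" for n by (rule v6)
    show "six_integrable M (\<lambda>_. 0)" by (simp add: six_integrable_def)
    show "(LINT z|M. (v n z)^6) \<le> K" for n using yK[of n] by (simp add: y_def)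
    show "(\<lambda>n. sqnorm M (\<lambda>z. v n z - 0)) \<longlonglongrightarrow> 0" using U(5) by (simp add: v_def)
  qed
  \<comment> \<open>The equation tested with \<open>v n\<close> expresses this difference through
    terms that tend to 0.\<close>
  define r where "r = (\<lambda>n. x n - y n)"
  have "r \<longlonglongrightarrow> 0"
  proof -
    have eq: "r n = (LINT z|M. \<bar>u n z\<bar> powr (q - 2) * u n z * v n z) + ((LINT z|M. (u n z)^5 * v n z) - y n)
        - (LINT z|M. \<phi> n z * u n z * v n z) - \<mu> n * (LINT z|M. u n z * v n z) - (W n - sqnorm M (wgrad \<Omega> u0))" for n
    proof -
      have "v n \<in> H1_0 \<Omega>" by (rule grad_pair_imp_H1_0[OF pv])
      then have "(LINT z|M. wgrad \<Omega> (u n) z \<bullet> wgrad \<Omega> (v n) z) + (LINT z|M. \<phi> n z * u n z * v n z) + \<mu> n * (LINT z|M. u n z * v n z) =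
        (LINT z|M. \<bar>u n z\<bar> powr (q - 2) * u n z * v n z) + (LINT z|M. \<bar>u n z\<bar>^4 * u n z * v n z)"
        using sol[of n] unfolding schroedinger_solution_def by blast
      moreover have "(LINT z|M. wgrad \<Omega> (u n) z \<bullet> wgrad \<Omega> (v n) z) = x n + (W n - sqnorm M (wgrad \<Omega> u0))"
      proof -
        have "(LINT z|M. wgrad \<Omega> (u n) z \<bullet> wgrad \<Omega> (v n) z) = (LINT z|M. wgrad \<Omega> (u n) z \<bullet> H n z)"
          by (rule wgrad_inner_cong(1)[OF pv si(2)])
        also have "\<dots> = (LINT z|M. wgrad \<Omega> (u n) z \<bullet> wgrad \<Omega> (u n) z) - W n"
          unfolding H_def W_def inner_diff_right
          by (rule Bochner_Integration.integral_diff[OF square_integrable_inner[OF si(2) si(2)] square_integrable_inner[OF si(2) si0(2)]])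
        also have "(LINT z|M. wgrad \<Omega> (u n) z \<bullet> wgrad \<Omega> (u n) z) = sqnorm M (wgrad \<Omega> (u n))"
          by (simp add: sqnorm_def power2_norm_eq_inner)
        finally show ?thesis using xW[of n] by simp
      qed
      moreover have "(LINT z|M. \<bar>u n z\<bar>^4 * u n z * v n z) = (LINT z|M. (u n z)^5 * v n z)"
        by (rule Bochner_Integration.integral_cong) (auto simp: eval_nat_numeral)
      ultimately show ?thesis by (simp add: r_def)
    qed
    have 1: "(\<lambda>n. LINT z|M. \<bar>u n z\<bar> powr (q - 2) * u n z * v n z) \<longlonglongrightarrow> 0"
      using six_tendsto_powr[OF u vt, of "q - 2"] q by simp
    have 2: "(\<lambda>n. (LINT z|M. (u n z)^5 * v n z) - y n) \<longlonglongrightarrow> 0"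
      unfolding y_def v_def
      by (rule quintic_Brezis_Lieb[OF u, of K]) (use v6 yK in \<open>auto simp: v_def y_def\<close>)
    have 3: "(\<lambda>n. LINT z|M. \<phi> n z * u n z * v n z) \<longlonglongrightarrow> 0"
      using six_tendsto_triple[OF \<phi> u vt] by simp
    have 4: "(\<lambda>n. LINT z|M. u n z * v n z) \<longlonglongrightarrow> 0"
      using six_tendsto_double[OF u vt] by simp
    have "(\<lambda>n. (LINT z|M. \<bar>u n z\<bar> powr (q - 2) * u n z * v n z) + ((LINT z|M. (u n z)^5 * v n z) - y n)
        - (LINT z|M. \<phi> n z * u n z * v n z) - \<mu> n * (LINT z|M. u n z * v n z) - (W n - sqnorm M (wgrad \<Omega> u0)))
        \<longlonglongrightarrow> 0 + 0 - 0 - \<mu>0 * 0 - (sqnorm M (wgrad \<Omega> u0) - sqnorm M (wgrad \<Omega> u0))"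
      by (intro tendsto_intros 1 2 3 4 \<mu> W)
    then show ?thesis by (simp flip: eq)
  qed
  define S2 where "S2 = sobolev_const powr (3/2)"
  have S2: "S2\<^sup>2 = sobolev_const^3" "S2 > 0"
  proof -
    have "S2\<^sup>2 = sobolev_const powr 3" unfolding S2_def power2_eq_square by (simp flip: powr_add)
    then show "S2\<^sup>2 = sobolev_const^3" using S by simp
    show "S2 > 0" using S by (simp add: S2_def)
  qed
  \<comment> \<open>A level strictly between \<rho> and S^(3/2): passing to the limit needs room
    above \<rho>, and the strict inequality below S^(3/2) makes \<open>\<kappa>\<close>
    positive.\<close>
  define m where "m = (\<rho> + S2) / 2"
  have "\<rho> \<ge> 0" using \<rho>(1)[of 0] sqnorm_nonneg order.trans by blast
  then have m: "\<rho> < m" "m < S2" "0 < m" using \<rho>(2) S2 by (auto simp: m_def S2_def)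
  define \<kappa> where "\<kappa> = 1 - m\<^sup>2 / S2\<^sup>2"
  have \<kappa>: "\<kappa> > 0"
  proof -
    have "m\<^sup>2 < S2\<^sup>2" using m by (intro power_strict_mono) auto
    then show ?thesis using S2(2) by (simp add: \<kappa>_def)
  qed
  text \<open>The weak limit lowers the gradient norm, so eventually \<open>x n \<le> m\<close>, below the threshold where the
    critical term could balance the gradient term.\<close>
  have "(\<lambda>n. \<rho> - 2 * W n + sqnorm M (wgrad \<Omega> u0)) \<longlonglongrightarrow> \<rho> - 2 * sqnorm M (wgrad \<Omega> u0) + sqnorm M (wgrad \<Omega> u0)"
    by (intro tendsto_intros W)
  then have "\<forall>\<^sub>F n in sequentially. \<rho> - 2 * W n + sqnorm M (wgrad \<Omega> u0) < m"
    by (rule order_tendstoD(2)) (use m sqnorm_nonneg[of M "wgrad \<Omega> u0"] in linarith)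
  then have ev: "\<forall>\<^sub>F n in sequentially. norm (x n) \<le> r n / \<kappa>"
  proof eventually_elim
    fix n assume "\<rho> - 2 * W n + sqnorm M (wgrad \<Omega> u0) < m"
    then have "x n \<le> m" using xW[of n] \<rho>(1)[of n] by linarith
    have "y n \<le> x n * (x n)\<^sup>2 / S2\<^sup>2" using yx[of n] unfolding S2(1) by (simp add: power3_eq_cube power2_eq_square mult.assoc)
    also have "\<dots> \<le> x n * m\<^sup>2 / S2\<^sup>2"
      using \<open>x n \<le> m\<close> x0[of n] by (intro divide_right_mono mult_left_mono power_mono) auto
    finally have "\<kappa> * x n \<le> r n" by (simp add: \<kappa>_def r_def algebra_simps)
    then show "norm (x n) \<le> r n / \<kappa>" using \<kappa> x0[of n] by (simp add: field_simps)
  qed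
  have "(\<lambda>n. r n / \<kappa>) \<longlonglongrightarrow> 0 / \<kappa>" using \<kappa> \<open>r \<longlonglongrightarrow> 0\<close> by (intro tendsto_intros) auto
  then have "x \<longlonglongrightarrow> 0" by (intro Lim_null_comparison[OF ev]) simp
  then show ?thesis by (simp add: x_def H_def)
qed

text \<open>With strong convergence of gradients the Sobolev inequality gives strong L^6
  convergence, under which the critical term passes to the limit as well.\<close>

lemma schroedinger_limit:
  assumes sol: "\<And>n. schroedinger_solution \<Omega> q (u n) (\<phi> n) (\<mu> n)" and q: "2 < q" "q \<le> 3"
    and S: "sobolev_const > 0" and u: "six_tendsto M u u0" and p0: "grad_pair u0 (wgrad \<Omega> u0)"
    and strong: "(\<lambda>n. sqnorm M (\<lambda>x. wgrad \<Omega> (u n) x - wgrad \<Omega> u0 x)) \<longlonglongrightarrow> 0"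
    and \<phi>: "six_tendsto M \<phi> \<phi>0" and \<mu>: "\<mu> \<longlonglongrightarrow> \<mu>0"
  shows "schroedinger_solution \<Omega> q u0 \<phi>0 \<mu>0"
  unfolding schroedinger_solution_def
proof (intro conjI ballI)
  show "u0 \<in> H1_0 \<Omega>" by (rule grad_pair_imp_H1_0[OF p0])
  have p: "grad_pair (u n) (wgrad \<Omega> (u n))" for n using sol[of n] H1_0_iff by (simp add: schroedinger_solution_def)
  note si = grad_pair_square_integrable[OF p] and si0 = grad_pair_square_integrable[OF p0]
  note U = six_tendstoD[OF u]
  note pv = grad_pair_diff[OF p p0]
  have v6: "(\<lambda>n. LINT z|M. (u n z - u0 z)^6) \<longlonglongrightarrow> 0"
  proof -
    have "(\<lambda>n. (sqnorm M (\<lambda>x. wgrad \<Omega> (u n) x - wgrad \<Omega> u0 x))^3 / sobolev_const^3) \<longlonglongrightarrow> 0^3 / sobolev_const^3"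
      using S by (intro tendsto_intros strong) auto
    then have l: "(\<lambda>n. (sqnorm M (\<lambda>x. wgrad \<Omega> (u n) x - wgrad \<Omega> u0 x))^3 / sobolev_const^3) \<longlonglongrightarrow> 0" by simp
    show ?thesis
      by (rule tendsto_sandwich[OF _ _ tendsto_const l])
         (auto intro!: always_eventually Bochner_Integration.integral_nonneg Sobolev_grad_pair(2)[OF pv S])
  qed
  have u5: "(LINT x|M. \<bar>w x\<bar>^4 * w x * \<psi> x) = (LINT x|M. (w x)^5 * \<psi> x)" for w \<psi> :: "real^3 \<Rightarrow> real"
    by (rule Bochner_Integration.integral_cong) (auto simp: eval_nat_numeral)
  fix \<psi> assume "\<psi> \<in> H1_0 \<Omega>"
  then have p\<psi>: "grad_pair \<psi> (wgrad \<Omega> \<psi>)" using H1_0_iff by blast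
  note \<psi>6 = grad_pair_six_integrable[OF p\<psi> S]
  note \<psi>t = six_tendsto_const[OF \<psi>6]
  have "(\<lambda>n. (LINT x|M. wgrad \<Omega> (u n) x \<bullet> wgrad \<Omega> \<psi> x) + (LINT x|M. \<phi> n x * u n x * \<psi> x) + \<mu> n * (LINT x|M. u n x * \<psi> x))
      \<longlonglongrightarrow> (LINT x|M. wgrad \<Omega> u0 x \<bullet> wgrad \<Omega> \<psi> x) + (LINT x|M. \<phi>0 x * u0 x * \<psi> x) + \<mu>0 * (LINT x|M. u0 x * \<psi> x)"
    by (intro tendsto_add tendsto_mult \<mu> integral_inner_tendsto[OF si(2) si0(2) grad_pair_square_integrable(2)[OF p\<psi>] strong]
        six_tendsto_triple[OF \<phi> u \<psi>t] six_tendsto_double[OF u \<psi>t])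
  moreover have "(\<lambda>n. (LINT x|M. \<bar>u n x\<bar> powr (q - 2) * u n x * \<psi> x) + (LINT x|M. \<bar>u n x\<bar>^4 * u n x * \<psi> x))
      \<longlonglongrightarrow> (LINT x|M. \<bar>u0 x\<bar> powr (q - 2) * u0 x * \<psi> x) + (LINT x|M. \<bar>u0 x\<bar>^4 * u0 x * \<psi> x)"
    unfolding u5 using q
    by (intro tendsto_add six_tendsto_powr[OF u \<psi>t] quintic_strong_tendsto[OF U(1,2) grad_pair_six_integrable[OF pv S] v6 \<psi>6]) auto
  moreover have "(LINT x|M. wgrad \<Omega> (u n) x \<bullet> wgrad \<Omega> \<psi> x) + (LINT x|M. \<phi> n x * u n x * \<psi> x) + \<mu> n * (LINT x|M. u n x * \<psi> x) =
      (LINT x|M. \<bar>u n x\<bar> powr (q - 2) * u n x * \<psi> x) + (LINT x|M. \<bar>u n x\<bar>^4 * u n x * \<psi> x)" for n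
    using sol[of n] \<open>\<psi> \<in> H1_0 \<Omega>\<close> unfolding schroedinger_solution_def by blast
  ultimately show "(LINT x|M. wgrad \<Omega> u0 x \<bullet> wgrad \<Omega> \<psi> x) + (LINT x|M. \<phi>0 x * u0 x * \<psi> x) + \<mu>0 * (LINT x|M. u0 x * \<psi> x) =
      (LINT x|M. \<bar>u0 x\<bar> powr (q - 2) * u0 x * \<psi> x) + (LINT x|M. \<bar>u0 x\<bar>^4 * u0 x * \<psi> x)"
    by (simp only:) (rule LIMSEQ_unique)
qed

text \<open>Translates convergence of squared norms into the topology, whose norm uses
  \<open>wgrad\<close> of a difference instead of a difference of \<open>wgrad\<close>; the two
  agree almost everywhere.\<close>

lemma H1_0_limitin:
  assumes p: "\<And>n. grad_pair (u n) (wgrad \<Omega> (u n))" and p0: "grad_pair u0 (wgrad \<Omega> u0)"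
    and lim: "(\<lambda>n. sqnorm M (\<lambda>x. u n x - u0 x)) \<longlonglongrightarrow> 0"
      "(\<lambda>n. sqnorm M (\<lambda>x. wgrad \<Omega> (u n) x - wgrad \<Omega> u0 x)) \<longlonglongrightarrow> 0"
  shows "limitin (H1_0_top \<Omega>) u u0 sequentially"
  unfolding limitin_def
proof (intro conjI allI impI)
  show "u0 \<in> topspace (H1_0_top \<Omega>)" using grad_pair_imp_H1_0[OF p0] by simp
  have "H1_norm \<Omega> (\<lambda>x. u n x - u0 x) = sqrt (sqnorm M (\<lambda>x. u n x - u0 x) + sqnorm M (\<lambda>x. wgrad \<Omega> (u n) x - wgrad \<Omega> u0 x))" for n
  proof -
    note d = grad_pair_diff[OF p[of n] p0]
    have "sqnorm M (wgrad \<Omega> (\<lambda>x. u n x - u0 x)) = sqnorm M (\<lambda>x. wgrad \<Omega> (u n) x - wgrad \<Omega> u0 x)"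
      by (intro sqnorm_cong_AE grad_pair_wgrad_AE[OF d] square_integrable_measurable
          grad_pair_square_integrable(2)[OF d] grad_pair_square_integrable(2)[OF grad_pair_wgrad[OF d]])
    moreover have "(grad_norm \<Omega> (\<lambda>x. u n x - u0 x))\<^sup>2 = sqnorm M (wgrad \<Omega> (\<lambda>x. u n x - u0 x))"
      by (auto simp: grad_norm_def sqnorm_def intro!: Bochner_Integration.integral_nonneg)
    ultimately show ?thesis by (simp add: H1_norm_def sqnorm_def)
  qed
  moreover have "(\<lambda>n. sqrt (sqnorm M (\<lambda>x. u n x - u0 x) + sqnorm M (\<lambda>x. wgrad \<Omega> (u n) x - wgrad \<Omega> u0 x))) \<longlonglongrightarrow> sqrt (0 + 0)"
    by (intro tendsto_intros lim)
  ultimately have N: "(\<lambda>n. H1_norm \<Omega> (\<lambda>x. u n x - u0 x)) \<longlonglongrightarrow> 0" by simp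
  fix V assume "openin (H1_0_top \<Omega>) V \<and> u0 \<in> V"
  then obtain d where d: "d > 0" "\<And>v. v \<in> H1_0 \<Omega> \<Longrightarrow> H1_norm \<Omega> (\<lambda>x. v x - u0 x) < d \<Longrightarrow> v \<in> V"
    unfolding openin_H1_0_top by blast
  show "\<forall>\<^sub>F n in sequentially. u n \<in> V"
    using order_tendstoD(2)[OF N d(1)] by eventually_elim (rule d(2)[OF grad_pair_imp_H1_0[OF p]])
qed

end

text \<open>Nothing in the argument singles out one solution of the limit system, so the limit is
  taken along a subsequence of an arbitrary null sequence, the same one for all j.\<close>

theorem theorem1p2:
  fixes \<Omega> \<Omega>r :: "(real^3) set"
    and r q b bstar C R1 R2 :: real
    and k :: nat
    and T :: "real \<Rightarrow> real"
    and u \<phi> :: "nat \<Rightarrow> real \<Rightarrow> real^3 \<Rightarrow> real"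
    and \<mu> :: "nat \<Rightarrow> real \<Rightarrow> real"
  assumes "smooth_bounded_domain \<Omega>"
    and "r > 0"
    and "\<Omega>r = (\<lambda>x. r *\<^sub>R x) ` \<Omega>"
    and "2 < q" and "q < 8/3"
    and "gagliardo_nirenberg_const q C"
    and "mass_threshold q C bstar"
    and "0 < b" and "b < bstar"
    and "truncation_radii q C b R1 R2"
    and "truncation_function R1 R2 T"
    and "\<And>\<epsilon> j. \<epsilon> > 0 \<Longrightarrow> j \<in> {1..k} \<Longrightarrow>
           minimax_solution \<Omega>r q T b \<epsilon> j (u j \<epsilon>) (\<phi> j \<epsilon>) (\<mu> j \<epsilon>)"
    and "\<And>\<epsilon> i j. \<epsilon> > 0 \<Longrightarrow> i \<in> {1..k} \<Longrightarrow> j \<in> {1..k} \<Longrightarrow> i \<noteq> j \<Longrightarrow>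
           \<not> ((AE x in lebesgue_on \<Omega>r. u i \<epsilon> x = u j \<epsilon> x) \<and>
              (AE x in lebesgue_on \<Omega>r. \<phi> i \<epsilon> x = \<phi> j \<epsilon> x) \<and> \<mu> i \<epsilon> = \<mu> j \<epsilon>)"
  shows "\<forall>e :: nat \<Rightarrow> real. (\<forall>n. e n > 0) \<and> e \<longlonglongrightarrow> 0 \<longrightarrow>
           (\<exists>s :: nat \<Rightarrow> nat. strict_mono s \<and>
             (\<forall>j\<in>{1..k}. \<exists>u0 \<phi>0 \<mu>0.
                u0 \<in> mass_sphere \<Omega>r b \<and> \<phi>0 \<in> H1_0 \<Omega>r \<and>
                limitin (H1_0_top \<Omega>r) (\<lambda>n. u j (e (s n))) u0 sequentially \<and>
                limitin (H1_0_top \<Omega>r) (\<lambda>n. \<phi> j (e (s n))) \<phi>0 sequentially \<and>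
                SP_solution \<Omega>r q b u0 \<phi>0 \<mu>0))"
proof (intro allI impI)
  fix e :: "nat \<Rightarrow> real" assume e: "(\<forall>n. e n > 0) \<and> e \<longlonglongrightarrow> 0"
  have "open \<Omega>r" "bounded \<Omega>r"
    using assms(1-3) by (auto simp: smooth_bounded_domain_def open_scaling bounded_scaling)
  then interpret bounded_open_set \<Omega>r by unfold_locales
  have q3: "q \<le> 3" using assms(5) by simp
  have R1: "R1 > 0" "R1\<^sup>2 < sobolev_const powr (3/2)"
    using assms(10) by (auto simp: truncation_radii_def)
  \<comment> \<open>The strict bound on R1 excludes a vanishing Sobolev constant, since
    \<open>0 powr (3/2)\<close> is 0.\<close>
  have S: "sobolev_const > 0"
  proof (rule ccontr)
    assume "\<not> sobolev_const > 0"
    then have "sobolev_const = 0" using sobolev_const_nonneg by simp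
    then show False using R1 by simp
  qed
  define J where "J = {1..k}"
  define V where "V = measure M (space M)"
  \<comment> \<open>The L^6 bound for the solutions from the Sobolev inequality; the constants after
    it follow the chain from \<open>u\<close> to \<open>\<phi>\<close> to the multiplier, with
    \<open>P\<close> the Poincare constant.\<close>
  define K where "K = (R1\<^sup>2)^3 / sobolev_const^3"
  define P where "P = V + 1 / sobolev_const^3"
  define B\<phi> where "B\<phi> = (2 * V + 2 * K) * P"
  define B\<mu> where "B\<mu> = (R1\<^sup>2 + P * B\<phi> + 3 * V + 4 * K) / b\<^sup>2"
  have V: "V \<ge> 0" by (simp add: V_def)
  have K: "K \<ge> 0" and P: "P \<ge> 0" using S V by (auto simp: K_def P_def)
  then have B\<phi>: "B\<phi> \<ge> 0" using V by (simp add: B\<phi>_def)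
  have B\<mu>: "B\<mu> \<ge> 0" using V K P B\<phi> by (simp add: B\<mu>_def)
  have sol: "u j (e n) \<in> mass_sphere \<Omega>r b" "schroedinger_solution \<Omega>r q (u j (e n)) (\<phi> j (e n)) (\<mu> j (e n))"
      "quasi_poisson_solution \<Omega>r (e n) (u j (e n)) (\<phi> j (e n))" "ET \<Omega>r q T (e n) (u j (e n)) < 0"
    if "j \<in> J" for j n
  proof -
    have m: "minimax_solution \<Omega>r q T b (e n) j (u j (e n)) (\<phi> j (e n)) (\<mu> j (e n))"
      using assms(12) e that by (simp add: J_def)
    then show "u j (e n) \<in> mass_sphere \<Omega>r b" "schroedinger_solution \<Omega>r q (u j (e n)) (\<phi> j (e n)) (\<mu> j (e n))"
      "quasi_poisson_solution \<Omega>r (e n) (u j (e n)) (\<phi> j (e n))"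
      by (auto simp: minimax_solution_def quasi_SP_solution_def)
    have "ereal (ET \<Omega>r q T (e n) (u j (e n))) < 0" using m by (simp add: minimax_solution_def)
    then show "ET \<Omega>r q T (e n) (u j (e n)) < 0" by simp
  qed
  have pu: "grad_pair (u j (e n)) (wgrad \<Omega>r (u j (e n)))" and pp: "grad_pair (\<phi> j (e n)) (wgrad \<Omega>r (\<phi> j (e n)))"
    if "j \<in> J" for j n
    using sol(2,3)[OF that, of n] HH_H1_0 by (auto simp: schroedinger_solution_def quasi_poisson_solution_def H1_0_iff)
  have ub: "sqnorm M (u j (e n)) = b\<^sup>2" if "j \<in> J" for j n
    using sol(1)[OF that, of n] by (simp add: mass_sphere_def sqnorm_def)
  have gu: "sqnorm M (wgrad \<Omega>r (u j (e n))) \<le> R1\<^sup>2" if "j \<in> J" for j n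
    by (rule truncated_energy_bound[OF sol(1)[OF that] assms(4,5,8,6,10,11) S sol(4)[OF that]])
  have u6: "(LINT x|M. (u j (e n) x)^6) \<le> K" if "j \<in> J" for j n
  proof -
    have "(sqnorm M (wgrad \<Omega>r (u j (e n))))^3 / sobolev_const^3 \<le> K"
      unfolding K_def using gu[OF that, of n] S by (intro divide_right_mono power_mono) auto
    then show ?thesis using Sobolev_grad_pair(2)[OF pu[OF that, of n] S] by linarith
  qed
  note su = grad_pair_six_integrable[OF pu S] and sp = grad_pair_six_integrable[OF pp S]
  have gp: "sqnorm M (wgrad \<Omega>r (\<phi> j (e n))) \<le> B\<phi>"
      "e n ^ 4 * (LINT x|M. (norm (wgrad \<Omega>r (\<phi> j (e n)) x))^4) \<le> B\<phi>" if "j \<in> J" for j n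
    using quasi_poisson_bounds[OF sol(3)[OF that, of n] S su[OF that] u6[OF that]] by (auto simp: B\<phi>_def P_def V_def)
  have pb: "sqnorm M (\<phi> j (e n)) \<le> P * B\<phi>" if "j \<in> J" for j n
  proof -
    have "P * sqnorm M (wgrad \<Omega>r (\<phi> j (e n))) \<le> P * B\<phi>" by (rule mult_left_mono[OF gp(1)[OF that] P])
    then show ?thesis using Poincare[OF pp[OF that, of n] S] unfolding P_def V_def by linarith
  qed
  have p6: "(LINT x|M. (\<phi> j (e n) x)^6) \<le> B\<phi>^3 / sobolev_const^3" if "j \<in> J" for j n
  proof -
    have "(sqnorm M (wgrad \<Omega>r (\<phi> j (e n))))^3 / sobolev_const^3 \<le> B\<phi>^3 / sobolev_const^3"
      using gp(1)[OF that, of n] S by (intro divide_right_mono power_mono) auto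
    then show ?thesis using Sobolev_grad_pair(2)[OF pp[OF that, of n] S] by linarith
  qed
  have \<mu>b: "\<bar>\<mu> j (e n)\<bar> \<le> B\<mu>" if "j \<in> J" for j n
    using multiplier_bound[OF sol(2)[OF that, of n] assms(4) q3 su[OF that] u6[OF that] ub[OF that] gu[OF that]
        grad_pair_square_integrable(1)[OF pp[OF that]] pb[OF that]] assms(8)
    by (simp add: B\<mu>_def V_def field_simps)
  \<comment> \<open>Both kinds of functions in one family, the flag telling \<open>u\<close> from
    \<open>\<phi>\<close>, so that a single extraction treats them together.\<close>
  define w where "w = (\<lambda>n (j, c). if c then u j (e n) else \<phi> j (e n))"
  \<comment> \<open>The compactness theorem takes one bound; the sum of the nonnegative individual
    bounds serves.\<close>
  define B where "B = b\<^sup>2 + R1\<^sup>2 + B\<phi> + P * B\<phi> + B\<mu>"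
  have "P * B\<phi> \<ge> 0" using P B\<phi> by simp
  then have Bge: "b\<^sup>2 \<le> B" "R1\<^sup>2 \<le> B" "B\<phi> \<le> B" "P * B\<phi> \<le> B" "B\<mu> \<le> B"
    using B\<phi> B\<mu> zero_le_power2[of b] zero_le_power2[of R1] unfolding B_def by linarith+
  have "\<exists>s::nat\<Rightarrow>nat. strict_mono s \<and> (\<forall>i\<in>J \<times> UNIV. (\<exists>l. (\<lambda>n. (\<lambda>n (j, c). \<mu> j (e n)) (s n) i) \<longlonglongrightarrow> l) \<and>
    (\<exists>u0 G0. grad_pair u0 G0 \<and> (\<lambda>n. sqnorm M (\<lambda>x. w (s n) i x - u0 x)) \<longlonglongrightarrow> 0 \<and>
      (\<forall>v H. grad_pair v H \<longrightarrow> (\<lambda>n. LINT x|M. (\<lambda>n i. wgrad \<Omega>r (w n i)) (s n) i x \<bullet> H x) \<longlonglongrightarrow> (LINT x|M. G0 x \<bullet> H x))))"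
  proof (rule Rellich_family[where B=B])
    show "countable (J \<times> (UNIV :: bool set))" by (simp add: J_def countable_finite)
    fix n and i :: "nat \<times> bool" assume "i \<in> J \<times> UNIV"
    then obtain j c where i: "i = (j, c)" "j \<in> J" by auto
    show "grad_pair (w n i) (wgrad \<Omega>r (w n i))" using pu pp i by (simp add: w_def)
    show "sqnorm M (w n i) \<le> B" using ub[OF i(2), of n] pb[OF i(2), of n] Bge i by (simp add: w_def)
    show "sqnorm M (wgrad \<Omega>r (w n i)) \<le> B" using order.trans[OF gu[OF i(2), of n] Bge(2)] order.trans[OF gp(1)[OF i(2), of n] Bge(3)] i
      by (simp add: w_def)
    show "\<bar>(case i of (j, c) \<Rightarrow> \<mu> j (e n))\<bar> \<le> B" using order.trans[OF \<mu>b[OF i(2), of n] Bge(5)] i by simp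
  qed
  then obtain s where s: "strict_mono s"
    and \<mu>lim: "\<And>j c. j \<in> J \<Longrightarrow> \<exists>l. (\<lambda>n. \<mu> j (e (s n))) \<longlonglongrightarrow> l"
    and wlim: "\<And>j c. j \<in> J \<Longrightarrow> \<exists>u0 G0. grad_pair u0 G0 \<and> (\<lambda>n. sqnorm M (\<lambda>x. w (s n) (j, c) x - u0 x)) \<longlonglongrightarrow> 0 \<and>
      (\<forall>v H. grad_pair v H \<longrightarrow> (\<lambda>n. LINT x|M. wgrad \<Omega>r (w (s n) (j, c)) x \<bullet> H x) \<longlonglongrightarrow> (LINT x|M. G0 x \<bullet> H x))"
    by fastforce
  define e' where "e' = (\<lambda>n. e (s n))"
  have e': "\<And>n. e' n > 0" "e' \<longlonglongrightarrow> 0"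
    using e LIMSEQ_subseq_LIMSEQ[of e 0 s] s by (auto simp: e'_def o_def)
  have limit: "\<exists>f0. grad_pair f0 (wgrad \<Omega>r f0) \<and> (\<lambda>n. sqnorm M (\<lambda>x. w (s n) (j, c) x - f0 x)) \<longlonglongrightarrow> 0 \<and>
      (\<forall>v H. grad_pair v H \<longrightarrow> (\<lambda>n. LINT x|M. wgrad \<Omega>r (w (s n) (j, c)) x \<bullet> H x) \<longlonglongrightarrow> (LINT x|M. wgrad \<Omega>r f0 x \<bullet> H x))"
    if j: "j \<in> J" for j c
  proof -
    obtain f0 G0 where f0: "grad_pair f0 G0" "(\<lambda>n. sqnorm M (\<lambda>x. w (s n) (j, c) x - f0 x)) \<longlonglongrightarrow> 0"
        "\<And>v H. grad_pair v H \<Longrightarrow> (\<lambda>n. LINT x|M. wgrad \<Omega>r (w (s n) (j, c)) x \<bullet> H x) \<longlonglongrightarrow> (LINT x|M. G0 x \<bullet> H x)"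
      using wlim[OF j, of c] by blast
    have "(\<lambda>n. LINT x|M. wgrad \<Omega>r (w (s n) (j, c)) x \<bullet> H x) \<longlonglongrightarrow> (LINT x|M. wgrad \<Omega>r f0 x \<bullet> H x)"
      if "grad_pair v H" for v H
      using f0(3)[OF that] wgrad_inner_cong(2)[OF f0(1) grad_pair_square_integrable(2)[OF that]] by simp
    then show ?thesis using grad_pair_wgrad[OF f0(1)] f0(2) by blast
  qed
  have "\<exists>u0 \<phi>0 \<mu>0. u0 \<in> mass_sphere \<Omega>r b \<and> \<phi>0 \<in> H1_0 \<Omega>r \<and>
      limitin (H1_0_top \<Omega>r) (\<lambda>n. u j (e' n)) u0 sequentially \<and>
      limitin (H1_0_top \<Omega>r) (\<lambda>n. \<phi> j (e' n)) \<phi>0 sequentially \<and> SP_solution \<Omega>r q b u0 \<phi>0 \<mu>0"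
    if j: "j \<in> J" for j
  proof -
    obtain u0 where u0: "grad_pair u0 (wgrad \<Omega>r u0)" "(\<lambda>n. sqnorm M (\<lambda>x. u j (e' n) x - u0 x)) \<longlonglongrightarrow> 0"
        "\<And>v H. grad_pair v H \<Longrightarrow> (\<lambda>n. LINT x|M. wgrad \<Omega>r (u j (e' n)) x \<bullet> H x) \<longlonglongrightarrow> (LINT x|M. wgrad \<Omega>r u0 x \<bullet> H x)"
      using limit[OF j, of True] unfolding w_def e'_def by auto
    obtain \<phi>0 where \<phi>0: "grad_pair \<phi>0 (wgrad \<Omega>r \<phi>0)" "(\<lambda>n. sqnorm M (\<lambda>x. \<phi> j (e' n) x - \<phi>0 x)) \<longlonglongrightarrow> 0"
        "\<And>v H. grad_pair v H \<Longrightarrow> (\<lambda>n. LINT x|M. wgrad \<Omega>r (\<phi> j (e' n)) x \<bullet> H x) \<longlonglongrightarrow> (LINT x|M. wgrad \<Omega>r \<phi>0 x \<bullet> H x)"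
      using limit[OF j, of False] unfolding w_def e'_def by auto
    obtain \<mu>0 where \<mu>0: "(\<lambda>n. \<mu> j (e' n)) \<longlonglongrightarrow> \<mu>0" using \<mu>lim[OF j] by (auto simp: e'_def)
    have ut: "six_tendsto M (\<lambda>n. u j (e' n)) u0"
      unfolding six_tendsto_def using su[OF j] grad_pair_six_integrable[OF u0(1) S] u6[OF j] u0(2) by (auto simp: e'_def)
    have pt: "six_tendsto M (\<lambda>n. \<phi> j (e' n)) \<phi>0"
      unfolding six_tendsto_def using sp[OF j] grad_pair_six_integrable[OF \<phi>0(1) S] p6[OF j] \<phi>0(2) by (auto simp: e'_def)
    have Q: "quasi_poisson_solution \<Omega>r (e' n) (u j (e' n)) (\<phi> j (e' n))"
      and sch: "schroedinger_solution \<Omega>r q (u j (e' n)) (\<phi> j (e' n)) (\<mu> j (e' n))" for n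
      using sol(2,3)[OF j] by (auto simp: e'_def)
    have B4: "e' n ^ 4 * (LINT x|M. (norm (wgrad \<Omega>r (\<phi> j (e' n)) x))^4) \<le> B\<phi>" for n
      using gp(2)[OF j] by (simp add: e'_def)
    have gu': "sqnorm M (wgrad \<Omega>r (u j (e' n))) \<le> R1\<^sup>2" for n using gu[OF j] by (simp add: e'_def)
    note plim = quasi_poisson_limit[OF e' Q B4 ut pt \<phi>0(1,3) S]
    note ulim = schroedinger_strong_limit[OF sch assms(4) q3 S gu' R1(2) ut u0(1,3) pt \<mu>0]
    have "(\<lambda>n. sqnorm M (u j (e' n))) \<longlonglongrightarrow> sqnorm M u0"
      by (rule sqnorm_tendsto[OF _ grad_pair_square_integrable(1)[OF u0(1)] u0(2)])
         (simp add: e'_def grad_pair_square_integrable(1)[OF pu[OF j]])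
    then have "sqnorm M u0 = b\<^sup>2" using ub[OF j] by (simp add: e'_def LIMSEQ_const_iff)
    then have mass: "(LINT x|M. (u0 x)\<^sup>2) = b\<^sup>2" by (simp add: sqnorm_def)
    have "u0 \<in> mass_sphere \<Omega>r b"
      using mass grad_pair_imp_H1_0[OF u0(1)] by (simp add: mass_sphere_def)
    moreover have "\<phi>0 \<in> H1_0 \<Omega>r" by (rule grad_pair_imp_H1_0[OF \<phi>0(1)])
    moreover have "limitin (H1_0_top \<Omega>r) (\<lambda>n. u j (e' n)) u0 sequentially"
      by (rule H1_0_limitin[OF _ u0(1,2) ulim]) (use pu[OF j] in \<open>simp add: e'_def\<close>)
    moreover have "limitin (H1_0_top \<Omega>r) (\<lambda>n. \<phi> j (e' n)) \<phi>0 sequentially"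
      by (rule H1_0_limitin[OF _ \<phi>0(1,2) conjunct2[OF plim]]) (use pp[OF j] in \<open>simp add: e'_def\<close>)
    \<comment> \<open>The limit system has the multiplier on the right-hand side, hence the opposite
      sign.\<close>
    moreover have "SP_solution \<Omega>r q b u0 \<phi>0 (- \<mu>0)"
      unfolding SP_solution_def
      using schroedinger_limit[OF sch assms(4) q3 S ut u0(1) ulim pt \<mu>0] plim mass by simp
    ultimately show ?thesis by blast
  qed
  then show "\<exists>s :: nat \<Rightarrow> nat. strict_mono s \<and>
             (\<forall>j\<in>{1..k}. \<exists>u0 \<phi>0 \<mu>0.
                u0 \<in> mass_sphere \<Omega>r b \<and> \<phi>0 \<in> H1_0 \<Omega>r \<and>
                limitin (H1_0_top \<Omega>r) (\<lambda>n. u j (e (s n))) u0 sequentially \<and>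
                limitin (H1_0_top \<Omega>r) (\<lambda>n. \<phi> j (e (s n))) \<phi>0 sequentially \<and>
                SP_solution \<Omega>r q b u0 \<phi>0 \<mu>0)"
    using s by (auto simp: e'_def J_def)
qed

end
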